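(* Every confluent temperature-1 tile assembly system either has a finite maximal producible assembly $\alpha_{\max}$ or is para-periodic, i.e. $\alpha_{\max}$ contains an ultimately periodic assembly path.
   Context: Directions $D=\{E=(1,0),N=(0,1),S=(0,-1),W=(-1,0)\}$; $\mathbb Z^2$ is the grid graph; a free path is a word over $D$ whose walk is simple; $\vec m$ is the displacement of finite $m$. A tile type is a map $t:D\to\Sigma$ ($\Sigma$ a finite set of glues). A temperature-1 TAS is a pair $(T,\sigma)$ with $T$ a finite set of tile types and $\sigma$ a seed tile type. An assembly is a partial map $\alpha:\mathbb Z^2\to T\cup\{\sigma\}$; its binding graph has vertices $\mathrm{Dom}(\alpha)$ and an edge $\{v,v+d\}$ iff $\alpha(v)_d=\alpha(v+d)_{-d}$. It is producible if its binding graph is connected and $\alpha((0,0))=\sigma$. The TAS is confluent if any two producible assemblies agree on the intersection of their domains; then there is a unique maximal producible assembly $\alpha_{\max}$ whose domain contains the domain of every producible assembly. An ultimately periodic assembly path is a producible assembly whose binding graph is a path $(0,0).mp^\omega$ ($m,p$ finite words, $p\ne\epsilon$, following the letters from the origin) and such that $\alpha(\vec m+i\vec p+\vec q)=\alpha(\vec m+\vec q)$ for all $i\ge 0$ and all prefixes $q$ of $p$. $\alpha_{\max}$ contains such a path if it is the restriction of $\alpha_{\max}$ to a path of its binding graph. *)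

theory Defs
  imports Main
begin

type_synonym pos = "int \<times> int"

datatype dir = E | N | S | W

fun vec :: "dir \<Rightarrow> pos" where
  "vec E = (1, 0)" | "vec N = (0, 1)" | "vec S = (0, -1)" | "vec W = (-1, 0)"

fun opp :: "dir \<Rightarrow> dir" where
  "opp E = W" | "opp W = E" | "opp N = S" | "opp S = N"

definition padd :: "pos \<Rightarrow> pos \<Rightarrow> pos" where
  "padd u v = (fst u + fst v, snd u + snd v)"

definition psmul :: "nat \<Rightarrow> pos \<Rightarrow> pos" where
  "psmul i u = (int i * fst u, int i * snd u)"

definition disp :: "dir list \<Rightarrow> pos" where
  "disp xs = foldr padd (map vec xs) (0, 0)"

text \<open>The infinite word m p^omega (p assumed nonempty).\<close>
definition upword :: "dir list \<Rightarrow> dir list \<Rightarrow> nat \<Rightarrow> dir" where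
  "upword m p i = (if i < length m then m ! i else p ! ((i - length m) mod length p))"

definition walkpos :: "(nat \<Rightarrow> dir) \<Rightarrow> nat \<Rightarrow> pos" where
  "walkpos w k = disp (map w [0..<k])"

type_synonym 'g tile = "dir \<Rightarrow> 'g"
type_synonym 'g assembly = "pos \<Rightarrow> 'g tile option"

definition bond :: "'g assembly \<Rightarrow> pos \<Rightarrow> pos \<Rightarrow> bool" where
  "bond \<alpha> u v \<longleftrightarrow> u \<in> dom \<alpha> \<and> v \<in> dom \<alpha> \<and>
     (\<exists>d. v = padd u (vec d) \<and> the (\<alpha> u) d = the (\<alpha> v) (opp d))"

definition producible :: "'g tile set \<Rightarrow> 'g tile \<Rightarrow> 'g assembly \<Rightarrow> bool" where
  "producible T \<sigma> \<alpha> \<longleftrightarrow> \<alpha> (0, 0) = Some \<sigma> \<and> ran \<alpha> \<subseteq> insert \<sigma> T \<and>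
     (\<forall>v \<in> dom \<alpha>. (bond \<alpha>)\<^sup>*\<^sup>* (0, 0) v)"

definition confluent :: "'g tile set \<Rightarrow> 'g tile \<Rightarrow> bool" where
  "confluent T \<sigma> \<longleftrightarrow> (\<forall>\<alpha> \<beta>. producible T \<sigma> \<alpha> \<longrightarrow> producible T \<sigma> \<beta> \<longrightarrow>
     (\<forall>v \<in> dom \<alpha> \<inter> dom \<beta>. \<alpha> v = \<beta> v))"

text \<open>The maximal producible assembly: the union of all producible assemblies
  (well defined as a partial function when the system is confluent).\<close>
definition alpha_max :: "'g tile set \<Rightarrow> 'g tile \<Rightarrow> 'g assembly" where
  "alpha_max T \<sigma> v = (if \<exists>\<beta>. producible T \<sigma> \<beta> \<and> v \<in> dom \<beta>
      then (SOME \<beta>. producible T \<sigma> \<beta> \<and> v \<in> dom \<beta>) v else None)"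

definition up_assembly_path :: "'g tile set \<Rightarrow> 'g tile \<Rightarrow> 'g assembly \<Rightarrow> dir list \<Rightarrow> dir list \<Rightarrow> bool" where
  "up_assembly_path T \<sigma> \<beta> m p \<longleftrightarrow>
     p \<noteq> [] \<and> producible T \<sigma> \<beta> \<and>
     inj (walkpos (upword m p)) \<and>
     dom \<beta> = range (walkpos (upword m p)) \<and>
     (\<forall>u v. bond \<beta> u v \<longleftrightarrow>
        (\<exists>k. (u = walkpos (upword m p) k \<and> v = walkpos (upword m p) (Suc k)) \<or>
             (v = walkpos (upword m p) k \<and> u = walkpos (upword m p) (Suc k)))) \<and>
     (\<forall>i j. j \<le> length p \<longrightarrow>
        \<beta> (padd (padd (disp m) (psmul i (disp p))) (disp (take j p)))
          = \<beta> (padd (disp m) (disp (take j p))))"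

definition contains_up_path :: "'g tile set \<Rightarrow> 'g tile \<Rightarrow> 'g assembly \<Rightarrow> bool" where
  "contains_up_path T \<sigma> \<alpha> \<longleftrightarrow>
     (\<exists>\<beta> m p. up_assembly_path T \<sigma> \<beta> m p \<and> \<beta> = \<alpha> |` dom \<beta>)"

end

(* In an infinite system, Koenig's lemma gives an infinite self-avoiding path whose consecutive
   tiles bind, and confluence makes the tile at each position independent of the path leading to
   it.  Assume first that some point of such a path sees infinity along an axis ray, say the east
   ray.  Among all infinite binding paths that share the start of the path and avoid that ray, take
   the leftmost one Y.  Infinitely many of its points see infinity along translates of one shape,
   lying on the left of Y, so two of them carry the same tile and the same incoming direction.  If
   the two continuations of Y diverged, the one turning further left could be translated to the
   other point; by the Jordan curve theorem the translated path cannot cross Y or the visible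
   shape, and it would be more to the left than Y.  Hence Y is ultimately periodic.  If no path
   ever sees infinity, the path makes laps around the origin; a sufficiently large lap, cut off by a
   vertical ray at its highest point, contains a descending pair of equal visible points, and
   pumping the segment between them contradicts leftmostness.  In the resulting periodic path, always
   jumping to the farthest bound tile removes the chords. *)
theory Submission
  imports Defs "HOL-Library.Product_Plus" "HOL-Library.Infinite_Set"
begin

section \<open>The Jordan curve argument on the grid\<close>

text \<open>At temperature 1 mismatching glues never block growth, so every self-avoiding walk whose
  consecutive tiles bind is a producible assembly. The argument can therefore run on an abstract
  step relation on the grid, to which rotations and mirrors apply. Of the Jordan curve theorem one
  consequence is used: across a directed edge of a simple cycle the winding number drops by one from
  left to right, so two infinite walks that leave the cycle on different sides cannot both stay off
  it, whatever the orientation of the cycle.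

  The obstacle is that a path turning further left must be shown to be free of collisions before it
  may compete with the leftmost path. A line that the leftmost path does not meet guards it on the
  left, the rest of the leftmost path guards it on the right. Without a free axis ray no infinite
  competitor is at hand, so a cut path gets an artificial tail going north. The region below the cut
  is stable only under downward translations; this is why a descending pair is wanted and why one of
  the two comparisons has to be replaced by pumping.\<close>

definition unit :: "pos \<Rightarrow> bool" where
  "unit v \<longleftrightarrow> v = (1,0) \<or> v = (0,1) \<or> v = (-1,0) \<or> v = (0,-1)"

definition cw :: "pos \<Rightarrow> pos" where
  "cw v = (snd v, - fst v)"

text \<open>Turn from the backward direction: for distinct unit vectors, 1 is left, 2 straight, 3 right.\<close>
definition tn :: "pos \<Rightarrow> pos \<Rightarrow> nat" where
  "tn a b = (if b = cw a then 1 else if b = cw (cw a) then 2 else 3)"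

text \<open>\<open>wn Z n f\<close> is the winding number of the lattice walk \<open>Z\<close> around the unit face with lower left
  corner \<open>f\<close>, counted as signed crossings of the horizontal ray going east from that face.\<close>
definition cr :: "pos \<Rightarrow> pos \<Rightarrow> pos \<Rightarrow> int" where
  "cr f a b = (if fst a = fst b \<and> fst a > fst f then
      (if snd a = snd f \<and> snd b = snd f + 1 then 1
       else if snd a = snd f + 1 \<and> snd b = snd f then -1 else 0) else 0)"

definition wn :: "(nat \<Rightarrow> pos) \<Rightarrow> nat \<Rightarrow> pos \<Rightarrow> int" where
  "wn Z n f = (\<Sum>k<n. cr f (Z k) (Z (Suc k)))"

text \<open>The face on the left of the edge leaving \<open>c\<close> in direction \<open>v\<close>.\<close>
definition lface :: "pos \<Rightarrow> pos \<Rightarrow> pos" where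
  "lface c v = (if v = (1,0) then c else if v = (0,1) then c + (-1,0)
     else if v = (-1,0) then c + (-1,-1) else c + (0,-1))"

lemma unit_cw [simp]: "unit (cw v) = unit v"
  by (cases v) (auto simp: unit_def cw_def)

lemma unit_uminus [simp]: "unit (- v) = unit v"
  by (cases v) (auto simp: unit_def)

lemma unit_diffE:
  assumes "unit (b - a)"
  obtains v where "b = a + v" "unit v"
  by (rule that[of "b - a"]) (use assms in auto)

text \<open>Both sides are the face on the right of the edge from \<open>c\<close> to
  \<open>c + v\<close>; right faces are expressed through \<open>lface\<close> in this way.\<close>

lemma lface_opp: "unit v \<Longrightarrow> lface (c + v) (- v) = lface c (cw v)"
  unfolding unit_def by (elim disjE; cases c) (simp_all add: cw_def lface_def)

lemma tn_le: "tn a b \<le> 3" "1 \<le> tn a b"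
  by (auto simp: tn_def)

text \<open>The value 3 is the default of \<open>tn\<close> and is also taken by the backward
  direction itself, hence the exclusions \<open>b \<noteq> a\<close> and
  \<open>c \<noteq> a\<close>.\<close>

lemma tn_inj:
  assumes "unit a" "unit b" "unit c" "b \<noteq> a" "c \<noteq> a" "tn a b = tn a c"
  shows "b = c"
  using assms unfolding unit_def by (elim disjE) (simp_all add: tn_def cw_def)

section \<open>Jump of the winding number across an edge\<close>

definition netc :: "(nat \<Rightarrow> pos) \<Rightarrow> nat \<Rightarrow> pos \<Rightarrow> pos \<Rightarrow> int" where
  "netc Z n a b = (\<Sum>k<n. of_bool (Z k = a \<and> Z (Suc k) = b) - of_bool (Z k = b \<and> Z (Suc k) = a))"

lemma netc_swap: "netc Z n b a = - netc Z n a b"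
  unfolding netc_def sum_negf[symmetric] minus_diff_eq ..

lemma closed_telescope:
  fixes h :: "pos \<Rightarrow> int"
  assumes "Z n = Z 0"
  shows "(\<Sum>k<n. h (Z (Suc k)) - h (Z k)) = 0"
  using sum_lessThan_telescope[of "\<lambda>k. h (Z k)" n] assms by simp

text \<open>The rays of the two faces run along both sides of the half row strictly east of
  \<open>c\<close>. The difference of their crossings is the net vertical flow out of that half row,
  whose only other entrance is the edge from \<open>c\<close>. The potential \<open>h\<close>
  records whether the walk is in the half row, and its changes cancel over a closed walk.\<close>

lemma wn_diff_E:
  assumes "Z n = Z 0" "\<forall>k<n. unit (Z (Suc k) - Z k)"
  shows "wn Z n (lface c (1,0)) - wn Z n (lface c (0,-1)) = netc Z n c (c + (1,0))"
proof -
  define h :: "pos \<Rightarrow> int" where "h = (\<lambda>u. of_bool (snd u = snd c \<and> fst u > fst c))"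
  have pt: "cr (lface c (1,0)) (Z k) (Z (Suc k)) - cr (lface c (0,-1)) (Z k) (Z (Suc k))
      = (of_bool (Z k = c \<and> Z (Suc k) = c + (1,0)) - of_bool (Z k = c + (1,0) \<and> Z (Suc k) = c))
        - (h (Z (Suc k)) - h (Z k))" if kn: "k < n" for k
  proof -
    obtain v where v: "Z (Suc k) = Z k + v" "unit v"
      using unit_diffE[of "Z (Suc k)" "Z k"] assms(2) kn by blast
    obtain x y x0 y0 where xy: "Z k = (x, y)" "c = (x0, y0)" by (cases "Z k"; cases c) blast
    show ?thesis
      using v(2) unfolding v(1) h_def unit_def
      by (elim disjE; simp add: xy cr_def lface_def of_bool_def; arith?)
  qed
  have "wn Z n (lface c (1,0)) - wn Z n (lface c (0,-1))
     = (\<Sum>k<n. (of_bool (Z k = c \<and> Z (Suc k) = c + (1,0)) - of_bool (Z k = c + (1,0) \<and> Z (Suc k) = c))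
        - (h (Z (Suc k)) - h (Z k)))"
    unfolding wn_def sum_subtractf[symmetric] by (rule sum.cong) (use pt in auto)
  also have "\<dots> = netc Z n c (c + (1,0)) - (\<Sum>k<n. h (Z (Suc k)) - h (Z k))"
    by (simp add: netc_def sum_subtractf)
  finally show ?thesis using closed_telescope[OF assms(1), of h] by simp
qed

text \<open>Here both rays lie on one line, and the western one meets exactly one more vertical
  edge, the one from \<open>c\<close> to \<open>c + (0,1)\<close>. The equation holds for each step
  separately.\<close>

lemma wn_diff_N:
  assumes "Z n = Z 0" "\<forall>k<n. unit (Z (Suc k) - Z k)"
  shows "wn Z n (lface c (0,1)) - wn Z n (lface c (1,0)) = netc Z n c (c + (0,1))"
proof -
  have pt: "cr (lface c (0,1)) (Z k) (Z (Suc k)) - cr (lface c (1,0)) (Z k) (Z (Suc k))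
      = (of_bool (Z k = c \<and> Z (Suc k) = c + (0,1)) - of_bool (Z k = c + (0,1) \<and> Z (Suc k) = c))" if kn: "k < n" for k
  proof -
    obtain v where v: "Z (Suc k) = Z k + v" "unit v"
      using unit_diffE[of "Z (Suc k)" "Z k"] assms(2) kn by blast
    obtain x y x0 y0 where xy: "Z k = (x, y)" "c = (x0, y0)" by (cases "Z k"; cases c) blast
    show ?thesis
      using v(2) unfolding v(1) unit_def
      by (elim disjE; simp add: xy cr_def lface_def of_bool_def; arith?)
  qed
  show ?thesis
    unfolding wn_def netc_def sum_subtractf[symmetric] by (rule sum.cong) (use pt in auto)
qed

text \<open>Edges going west or south are the first two cases seen from their other endpoint, with
  the sign flipped by \<open>netc_swap\<close>.\<close>

lemma wn_diff:
  assumes "Z n = Z 0" "\<forall>k<n. unit (Z (Suc k) - Z k)" "unit v"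
  shows "wn Z n (lface c v) - wn Z n (lface c (cw v)) = netc Z n c (c + v)"
proof -
  consider "v = (1,0)" | "v = (0,1)" | "v = (-1,0)" | "v = (0,-1)"
    using assms(3) by (auto simp: unit_def)
  then show ?thesis
  proof cases
    case 1 then show ?thesis using wn_diff_E[OF assms(1,2), of c] by (simp add: cw_def)
  next
    case 2 then show ?thesis using wn_diff_N[OF assms(1,2), of c] by (simp add: cw_def)
  next
    case 3
    have "lface c (-1,0) = lface (c + (-1,0)) (0,-1)" "lface c (0,1) = lface (c + (-1,0)) (1,0)"
      by (auto simp: lface_def add.assoc)
    with 3 show ?thesis using wn_diff_E[OF assms(1,2), of "c + (-1,0)"]
      by (simp add: cw_def add.assoc zero_prod_def[symmetric] netc_swap[of Z n c])
  next
    case 4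
    have "lface c (0,-1) = lface (c + (0,-1)) (1,0)" "lface c (-1,0) = lface (c + (0,-1)) (0,1)"
      by (auto simp: lface_def add.assoc)
    with 4 show ?thesis using wn_diff_N[OF assms(1,2), of "c + (0,-1)"]
      by (simp add: cw_def add.assoc zero_prod_def[symmetric] netc_swap[of Z n c])
  qed
qed

lemma netc_off:
  assumes "u \<notin> Z ` {..n}"
  shows "netc Z n u b = 0"
  unfolding netc_def
  by (rule sum.neutral) (use assms in \<open>auto simp: image_iff\<close>)

text \<open>No edge of the walk touches \<open>u\<close>, so the four faces around \<open>u\<close>
  have equal winding number. This justifies reading \<open>wn Z n u\<close>, formally the value at
  the face with lower left corner \<open>u\<close>, as the winding number of the vertex
  \<open>u\<close>.\<close>

lemma wn_off:
  assumes "Z n = Z 0" "\<forall>k<n. unit (Z (Suc k) - Z k)" "u \<notin> Z ` {..n}" "unit v"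
  shows "wn Z n (lface u v) = wn Z n u"
proof -
  have st: "wn Z n (lface u w) = wn Z n (lface u (cw w))" if "unit w" for w
    using wn_diff[OF assms(1,2) that, of u] netc_off[OF assms(3)] by simp
  have u: "unit (1,0)" "unit (0,1)" "unit (-1,0)" "unit (0,-1)" by (auto simp: unit_def)
  have "wn Z n (lface u (1,0)) = wn Z n u" by (simp add: lface_def)
  with st[OF u(1)] st[OF u(2)] st[OF u(3)] st[OF u(4)] assms(4) show ?thesis
    by (auto simp: unit_def cw_def)
qed

lemma wn_step:
  assumes "Z n = Z 0" "\<forall>k<n. unit (Z (Suc k) - Z k)" "u \<notin> Z ` {..n}" "u + v \<notin> Z ` {..n}" "unit v"
  shows "wn Z n (u + v) = wn Z n u"
  using wn_off[OF assms(1,2,3), of "cw v"] wn_off[OF assms(1,2,4), of "- v"] lface_opp[OF assms(5), of u] assms(5)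
  by simp

lemma wn_walk:
  assumes "Z n = Z 0" "\<forall>k<n. unit (Z (Suc k) - Z k)"
    and "\<And>k. a \<le> k \<Longrightarrow> k \<le> b \<Longrightarrow> A k \<notin> Z ` {..n}" "\<And>k. a \<le> k \<Longrightarrow> k < b \<Longrightarrow> unit (A (Suc k) - A k)" "a \<le> b"
  shows "wn Z n (A b) = wn Z n (A a)"
  using assms(5,3,4)
proof (induction b rule: dec_induct)
  case base show ?case by simp
next
  case (step k)
  have "wn Z n (A k + (A (Suc k) - A k)) = wn Z n (A k)"
    by (rule wn_step[OF assms(1,2)]) (use step in auto)
  then show ?case using step by simp
qed

text \<open>West of the walk every passage through the row level of the face counts, and these
  cancel because the walk is closed. In all other distant positions the east ray meets no edge of
  the walk.\<close>

lemma wn_far: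
  assumes "Z n = Z 0" "\<forall>k<n. unit (Z (Suc k) - Z k)"
    and "\<forall>k\<le>n. \<bar>fst (Z k)\<bar> < B \<and> \<bar>snd (Z k)\<bar> < B" "\<bar>fst u\<bar> > B \<or> \<bar>snd u\<bar> > B"
  shows "wn Z n u = 0"
proof (cases "fst u < - B")
  case True
  define h :: "pos \<Rightarrow> int" where "h = (\<lambda>w. of_bool (snd w > snd u))"
  have "cr u (Z k) (Z (Suc k)) = h (Z (Suc k)) - h (Z k)" if kn: "k < n" for k
  proof -
    obtain v where v: "Z (Suc k) = Z k + v" "unit v"
      using unit_diffE[of "Z (Suc k)" "Z k"] assms(2) kn by blast
    have "fst (Z k) > fst u" using assms(3) True kn by (smt (verit) less_imp_le_nat)
    then show ?thesis
      using v(2) unfolding v(1) h_def unit_def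
      by (elim disjE) (simp_all add: cr_def of_bool_def)
  qed
  then have "wn Z n u = (\<Sum>k<n. h (Z (Suc k)) - h (Z k))" by (simp add: wn_def)
  then show ?thesis using closed_telescope[OF assms(1)] by simp
next
  case False
  have "cr u (Z k) (Z (Suc k)) = 0" if kn: "k < n" for k
  proof -
    have "\<bar>fst (Z k)\<bar> < B" "\<bar>snd (Z k)\<bar> < B" "\<bar>snd (Z (Suc k))\<bar> < B" using assms(3) kn by auto
    then show ?thesis using False assms(4) by (auto simp: cr_def)
  qed
  then show ?thesis by (simp add: wn_def)
qed

lemma finite_bound_pos:
  assumes "finite (U :: pos set)"
  shows "\<exists>B. \<forall>u\<in>U. \<bar>fst u\<bar> < B \<and> \<bar>snd u\<bar> < B"
  using assms
proof (induction U rule: finite_induct)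
  case empty show ?case by simp
next
  case (insert w U)
  then obtain B where "\<forall>u\<in>U. \<bar>fst u\<bar> < B \<and> \<bar>snd u\<bar> < B" by blast
  then have "\<forall>u\<in>insert w U. \<bar>fst u\<bar> < max B (\<bar>fst w\<bar> + \<bar>snd w\<bar> + 1) \<and> \<bar>snd u\<bar> < max B (\<bar>fst w\<bar> + \<bar>snd w\<bar> + 1)"
    by (auto simp: less_max_iff_disj)
  then show ?case by blast
qed

lemma infinite_escapes:
  assumes "infinite (U :: pos set)"
  shows "\<exists>u\<in>U. \<bar>fst u\<bar> > B \<or> \<bar>snd u\<bar> > B"
proof (rule ccontr)
  assume "\<not> ?thesis"
  then have "U \<subseteq> {-B..B} \<times> {-B..B}" by (force simp: abs_le_iff)
  then show False using assms finite_subset by blast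
qed

lemma wn_escape:
  assumes "Z n = Z 0" "\<forall>k<n. unit (Z (Suc k) - Z k)"
    and "\<And>k. 1 \<le> k \<Longrightarrow> A k \<notin> Z ` {..n}" "\<And>k. unit (A (Suc k) - A k)" "infinite (range A)"
  shows "wn Z n (A 1) = 0"
proof -
  obtain B where B: "\<forall>u\<in>Z ` {..n}. \<bar>fst u\<bar> < B \<and> \<bar>snd u\<bar> < B"
    using finite_bound_pos[of "Z ` {..n}"] by auto
  have "infinite (A ` {1..})"
  proof
    assume "finite (A ` {1..})"
    moreover have "A k \<in> insert (A 0) (A ` {1..})" for k by (cases "k = 0") auto
    then have "range A \<subseteq> insert (A 0) (A ` {1..})" by blast
    ultimately show False using assms(5) finite_subset by blast
  qed
  from infinite_escapes[OF this, of B] obtain k where k: "1 \<le> k" "\<bar>fst (A k)\<bar> > B \<or> \<bar>snd (A k)\<bar> > B" by auto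
  have "wn Z n (A k) = 0" by (rule wn_far[OF assms(1,2) _ k(2)]) (use B in auto)
  moreover have "wn Z n (A k) = wn Z n (A 1)"
    by (rule wn_walk[OF assms(1,2)]) (use assms(3,4) k in auto)
  ultimately show ?thesis by simp
qed

section \<open>Left and right side of a simple cycle\<close>

definition simple_cycle :: "(nat \<Rightarrow> pos) \<Rightarrow> nat \<Rightarrow> bool" where
  "simple_cycle Z n \<longleftrightarrow> n \<ge> 3 \<and> Z n = Z 0 \<and> inj_on Z {..<n} \<and> (\<forall>k<n. unit (Z (Suc k) - Z k))"

lemma simple_cycle_image:
  assumes "simple_cycle Z n"
  shows "Z ` {..n} = Z ` {..<n}"
proof -
  have "Z n \<in> Z ` {..<n}" using assms by (auto simp: simple_cycle_def)
  moreover have "{..n} = insert n {..<n}" by auto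
  ultimately show ?thesis by auto
qed

text \<open>A second traversal contradicts injectivity, and a reverse traversal would make the cycle
  go back and forth along one edge, which \<open>n \<ge> 3\<close> excludes.\<close>

lemma netc_edge:
  assumes "simple_cycle Z n" "k < n"
  shows "netc Z n (Z k) (Z (Suc k)) = 1"
proof -
  note c = assms(1)[unfolded simple_cycle_def]
  have inj: "i < n \<Longrightarrow> j < n \<Longrightarrow> Z i = Z j \<Longrightarrow> i = j" for i j
    using c by (auto simp: inj_on_def)
  have "(Z j = Z k \<and> Z (Suc j) = Z (Suc k)) \<longleftrightarrow> j = k" if "j < n" for j
    using inj[OF that assms(2)] by auto
  moreover have "\<not> (Z j = Z (Suc k) \<and> Z (Suc j) = Z k)" if jn: "j < n" for j
  proof
    assume as: "Z j = Z (Suc k) \<and> Z (Suc j) = Z k"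
    show False
    proof (cases "Suc k = n")
      case True
      then have "j = 0" using as inj[of j 0] jn c by auto
      then show False using as inj[of 1 k] c True assms(2) by auto
    next
      case False
      then have j: "j = Suc k" using inj[of j "Suc k"] as jn assms(2) by auto
      show False
      proof (cases "Suc j = n")
        case True then show False using as inj[of 0 k] c j assms(2) by auto
      next
        case False then show False using as inj[of "Suc j" k] jn j assms(2) by auto
      qed
    qed
  qed
  ultimately have "netc Z n (Z k) (Z (Suc k)) = (\<Sum>j<n. of_bool (j = k))"
    unfolding netc_def by (intro sum.cong) auto
  also have "\<dots> = 1" using assms(2) by (simp add: of_bool_def)
  finally show ?thesis .
qed

lemma netc_nonedge:
  assumes "simple_cycle Z n" "0 < p" "p < n" "b \<noteq> Z (p - 1)" "b \<noteq> Z (Suc p)"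
  shows "netc Z n (Z p) b = 0"
proof -
  note c = assms(1)[unfolded simple_cycle_def]
  have inj: "i < n \<Longrightarrow> j < n \<Longrightarrow> Z i = Z j \<Longrightarrow> i = j" for i j
    using c by (auto simp: inj_on_def)
  have "\<not> (Z j = Z p \<and> Z (Suc j) = b)" if "j < n" for j
    using inj[OF that assms(3)] assms(5) by auto
  moreover have "\<not> (Z j = b \<and> Z (Suc j) = Z p)" if jn: "j < n" for j
  proof
    assume as: "Z j = b \<and> Z (Suc j) = Z p"
    show False
    proof (cases "Suc j = n")
      case True then show False using as inj[of 0 p] assms c by auto
    next
      case False then have "Suc j = p" using as inj[of "Suc j" p] jn assms by auto
      then show False using as assms by auto
    qed
  qed
  ultimately show ?thesis unfolding netc_def by (intro sum.neutral) auto
qed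

definition lside :: "(nat \<Rightarrow> pos) \<Rightarrow> nat \<Rightarrow> nat \<Rightarrow> int" where
  "lside Z n p = wn Z n (lface (Z p) (Z (Suc p) - Z p))"

lemma simple_cycle_no_backtrack:
  assumes "simple_cycle Z n" "0 < p" "p < n"
  shows "Z (Suc p) \<noteq> Z (p - 1)"
proof
  note c = assms(1)[unfolded simple_cycle_def]
  have inj: "i < n \<Longrightarrow> j < n \<Longrightarrow> Z i = Z j \<Longrightarrow> i = j" for i j
    using c by (auto simp: inj_on_def)
  assume as: "Z (Suc p) = Z (p - 1)"
  show False
  proof (cases "Suc p = n")
    case True
    have "Z (p - 1) = Z 0" "0 < n" using True as c assms(3) by auto
    moreover have "p - 1 < n" using assms by linarith
    ultimately have "p - 1 = 0" using inj by blast
    then show False using True c by linarith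
  next
    case False
    then have "Suc p < n" "p - 1 < n" using assms by linarith+
    then have "Suc p = p - 1" using inj as by blast
    then show False by linarith
  qed
qed

text \<open>Only the two cycle edges at \<open>Z p\<close> have nonzero net traversals. Going
  clockwise around \<open>Z p\<close> from the backward edge, the faces up to the outgoing edge
  therefore share one value, and those behind it have one less. The face
  \<open>lface (Z p) g\<close> is the one met just before the direction \<open>g\<close>.\<close>

lemma side_faces:
  assumes Z: "simple_cycle Z n" and p: "0 < p" "p < n"
  defines "a \<equiv> Z (p - 1) - Z p" and "b \<equiv> Z (Suc p) - Z p"
  shows "lside Z n (p - 1) = lside Z n p"
    and "\<And>g. unit g \<Longrightarrow> tn a g < tn a b \<Longrightarrow> wn Z n (lface (Z p) g) = lside Z n p"
    and "\<And>g. unit g \<Longrightarrow> g \<noteq> a \<Longrightarrow> tn a b < tn a g \<Longrightarrow> wn Z n (lface (Z p) g) = lside Z n p - 1"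
proof -
  note c = Z[unfolded simple_cycle_def]
  have c1: "Z n = Z 0" and c2: "\<forall>k<n. unit (Z (Suc k) - Z k)" using c by auto
  have "unit (Z (Suc (p - 1)) - Z (p - 1))" using c2 p by (metis Suc_diff_1 less_imp_diff_less)
  then have ua: "unit a" unfolding a_def using unit_uminus[of "Z p - Z (p - 1)"] p by simp
  have ub: "unit b" unfolding b_def using c2 p by simp
  have ba: "b \<noteq> a" unfolding a_def b_def using simple_cycle_no_backtrack[OF Z p] by simp
  have ne: "netc Z n (Z p) (Z p + g) = 0" if g: "g \<noteq> a" "g \<noteq> b" for g
  proof (rule netc_nonedge[OF Z p])
    show "Z p + g \<noteq> Z (p - 1)" using g(1) unfolding a_def by (metis add_diff_cancel_left')
    show "Z p + g \<noteq> Z (Suc p)" using g(2) unfolding b_def by (metis add_diff_cancel_left')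
  qed
  have yes: "netc Z n (Z p) (Z p + b) = 1"
    using netc_edge[OF Z p(2)] by (simp add: b_def)
  define f where "f g = wn Z n (lface (Z p) g)" for g
  have same: "f g = f (cw g)" if "unit g" "g \<noteq> a" "g \<noteq> b" for g
    using wn_diff[OF c1 c2 that(1), of "Z p"] ne[OF that(2,3)] by (simp add: f_def)
  have step: "f b = f (cw b) + 1"
    using wn_diff[OF c1 c2 ub, of "Z p"] yes by (simp add: f_def)
  have Lp: "lside Z n p = f b" by (simp add: lside_def f_def b_def)
  have "lside Z n (p - 1) = wn Z n (lface (Z p + a) (- a))"
    using p by (simp add: lside_def a_def)
  also have "\<dots> = f (cw a)" by (simp add: lface_opp[OF ua] f_def)
  finally have Lm: "lside Z n (p - 1) = f (cw a)" .
  let ?a1 = "cw a" let ?a2 = "cw (cw a)" let ?a3 = "cw (cw (cw a))"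
  have dist: "?a1 \<noteq> a" "?a2 \<noteq> a" "?a3 \<noteq> a" "?a1 \<noteq> ?a2" "?a1 \<noteq> ?a3" "?a2 \<noteq> ?a3"
    using ua by (auto simp: unit_def cw_def)
  have cases4: "g = a \<or> g = ?a1 \<or> g = ?a2 \<or> g = ?a3" if "unit g" for g
    using ua that unfolding unit_def by (elim disjE) (simp_all add: cw_def)
  have tns: "tn a ?a1 = 1" "tn a ?a2 = 2" "tn a ?a3 = 3" using dist by (auto simp: tn_def)
  have u1: "unit ?a1" "unit ?a2" "unit ?a3" using ua by auto
  consider "b = ?a1" | "b = ?a2" | "b = ?a3" using cases4[OF ub] ba by blast
  then have "f ?a1 = f b \<and> (\<forall>g. unit g \<longrightarrow> tn a g < tn a b \<longrightarrow> f g = f b) \<and>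
     (\<forall>g. unit g \<longrightarrow> g \<noteq> a \<longrightarrow> tn a b < tn a g \<longrightarrow> f g = f b - 1)"
  proof cases
    case 1
    have "f ?a2 = f ?a3" using same[OF u1(2)] dist 1 by simp
    moreover have "tn a g < tn a b \<Longrightarrow> False" for g using 1 tns tn_le(2)[of a g] by simp
    ultimately show ?thesis using 1 step tns cases4 by (metis add_diff_cancel_right')
  next
    case 2
    have "f ?a1 = f ?a2" using same[OF u1(1)] dist 2 by simp
    moreover have "tn a a = 3" using dist by (simp add: tn_def)
    moreover have "g = ?a1" if "unit g" "tn a g < tn a b" for g
      using cases4[OF that(1)] that(2) tns 2 \<open>tn a a = 3\<close> by auto
    moreover have "g = ?a3" if "unit g" "g \<noteq> a" "tn a b < tn a g" for g
      using cases4[OF that(1)] that(2,3) tns 2 by auto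
    moreover have "f ?a3 = f b - 1" using step 2 by simp
    ultimately show ?thesis using 2 by metis
  next
    case 3
    have "f ?a1 = f ?a2" using same[OF u1(1)] dist 3 by simp
    moreover have "f ?a2 = f ?a3" using same[OF u1(2)] dist 3 by simp
    moreover have "tn a a = 3" using dist by (simp add: tn_def)
    moreover have "tn a b < tn a g \<Longrightarrow> False" for g using 3 tns tn_le(1)[of a g] by simp
    ultimately show ?thesis using 3 tns cases4 by (metis less_irrefl)
  qed
  then show "lside Z n (p - 1) = lside Z n p"
    and "\<And>g. unit g \<Longrightarrow> tn a g < tn a b \<Longrightarrow> wn Z n (lface (Z p) g) = lside Z n p"
    and "\<And>g. unit g \<Longrightarrow> g \<noteq> a \<Longrightarrow> tn a b < tn a g \<Longrightarrow> wn Z n (lface (Z p) g) = lside Z n p - 1"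
    unfolding Lp Lm f_def by auto
qed

lemma lside_const:
  assumes "simple_cycle Z n" "p < n"
  shows "lside Z n p = lside Z n 0"
  using assms(2)
proof (induction p)
  case (Suc p)
  then show ?case using side_faces(1)[OF assms(1), of "Suc p"] by simp
qed simp

text \<open>The face on the left of the edge from \<open>Z p\<close> to \<open>u\<close> also
  touches \<open>u\<close>, so \<open>wn_off\<close> transfers its value to the vertex
  \<open>u\<close>.\<close>

lemma left_nbr:
  assumes Z: "simple_cycle Z n" and p: "0 < p" "p < n" and u: "unit (u - Z p)" "u \<notin> Z ` {..n}"
    and l: "tn (Z (p - 1) - Z p) (u - Z p) < tn (Z (p - 1) - Z p) (Z (Suc p) - Z p)"
  shows "wn Z n u = lside Z n 0"
proof -
  note c = Z[unfolded simple_cycle_def]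
  have c1: "Z n = Z 0" and c2: "\<forall>k<n. unit (Z (Suc k) - Z k)" using c by auto
  have "wn Z n (lface (Z p) (u - Z p)) = lside Z n p"
    by (rule side_faces(2)[OF Z p]) (use u l in auto)
  moreover have "lface u (cw (- (u - Z p))) = lface (Z p) (u - Z p)"
    using lface_opp[of "- (u - Z p)" u] u(1) unit_uminus[of "u - Z p"] by simp
  moreover have "unit (cw (- (u - Z p)))" using u(1) by (simp only: unit_cw unit_uminus)
  ultimately show ?thesis
    using wn_off[OF c1 c2 u(2)] lside_const[OF Z p(2)] by metis
qed

lemma right_nbr:
  assumes Z: "simple_cycle Z n" and p: "0 < p" "p < n" and u: "unit (u - Z p)" "u \<notin> Z ` {..n}"
    and l: "tn (Z (p - 1) - Z p) (Z (Suc p) - Z p) < tn (Z (p - 1) - Z p) (u - Z p)"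
  shows "wn Z n u = lside Z n 0 - 1"
proof -
  note c = Z[unfolded simple_cycle_def]
  have c1: "Z n = Z 0" and c2: "\<forall>k<n. unit (Z (Suc k) - Z k)" using c by auto
  have "Z (p - 1) \<in> Z ` {..n}" using p by auto
  then have "u - Z p \<noteq> Z (p - 1) - Z p" using u(2) by auto
  then have "wn Z n (lface (Z p) (u - Z p)) = lside Z n p - 1"
    by (intro side_faces(3)[OF Z p]) (use u l in auto)
  moreover have "lface u (cw (- (u - Z p))) = lface (Z p) (u - Z p)"
    using lface_opp[of "- (u - Z p)" u] u(1) unit_uminus[of "u - Z p"] by simp
  moreover have "unit (cw (- (u - Z p)))" using u(1) by (simp only: unit_cw unit_uminus)
  ultimately show ?thesis
    using wn_off[OF c1 c2 u(2)] lside_const[OF Z p(2)] by metis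
qed

text \<open>The left neighbour has winding number \<open>lside Z n 0\<close>, the right neighbour
  one less, while walking to infinity off the cycle forces both to be 0. Indices start at 1 because
  \<open>A 0\<close> and \<open>B 0\<close> lie on the cycle.\<close>

theorem two_sided_escape:
  assumes Z: "simple_cycle Z n" and p: "0 < p" "p < n" and q: "0 < q" "q < n"
    and A: "A 0 = Z p" "\<And>k. unit (A (Suc k) - A k)" "infinite (range A)" "\<And>k. 1 \<le> k \<Longrightarrow> A k \<notin> Z ` {..<n}"
    and B: "B 0 = Z q" "\<And>k. unit (B (Suc k) - B k)" "infinite (range B)" "\<And>k. 1 \<le> k \<Longrightarrow> B k \<notin> Z ` {..<n}"
    and l: "tn (Z (p - 1) - Z p) (A 1 - Z p) < tn (Z (p - 1) - Z p) (Z (Suc p) - Z p)"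
    and r: "tn (Z (q - 1) - Z q) (Z (Suc q) - Z q) < tn (Z (q - 1) - Z q) (B 1 - Z q)"
  shows False
proof -
  note im = simple_cycle_image[OF Z]
  note c = Z[unfolded simple_cycle_def]
  have c1: "Z n = Z 0" and c2: "\<forall>k<n. unit (Z (Suc k) - Z k)" using c by auto
  have "wn Z n (A 1) = lside Z n 0"
    by (rule left_nbr[OF Z p]) (use A(1) A(2)[of 0] A(4)[of 1] l im in auto)
  moreover have "wn Z n (B 1) = lside Z n 0 - 1"
    by (rule right_nbr[OF Z q]) (use B(1) B(2)[of 0] B(4)[of 1] r im in auto)
  moreover have "wn Z n (A 1) = 0" by (rule wn_escape[OF c1 c2]) (use A im in auto)
  moreover have "wn Z n (B 1) = 0" by (rule wn_escape[OF c1 c2]) (use B im in auto)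
  ultimately show False by simp
qed

section \<open>Visible points of a self-avoiding path\<close>

definition arc :: "(nat \<Rightarrow> pos) \<Rightarrow> nat \<Rightarrow> bool" where
  "arc Z n \<longleftrightarrow> inj_on Z {..n} \<and> (\<forall>k<n. unit (Z (Suc k) - Z k))"

definition cat :: "(nat \<Rightarrow> pos) \<Rightarrow> nat \<Rightarrow> (nat \<Rightarrow> pos) \<Rightarrow> nat \<Rightarrow> pos" where
  "cat Z n Z' k = (if k \<le> n then Z k else Z' (k - n))"

definition ray :: "pos \<Rightarrow> pos \<Rightarrow> nat \<Rightarrow> pos" where
  "ray u d k = (fst u + int k * fst d, snd u + int k * snd d)"

definition ipath :: "(nat \<Rightarrow> pos) \<Rightarrow> bool" where
  "ipath Y \<longleftrightarrow> inj Y \<and> (\<forall>k. unit (Y (Suc k) - Y k))"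

lemma cat_le [simp]: "k \<le> n \<Longrightarrow> cat Z n Z' k = Z k"
  by (simp add: cat_def)

lemma cat_ge: "Z' 0 = Z n \<Longrightarrow> n \<le> k \<Longrightarrow> cat Z n Z' k = Z' (k - n)"
  by (auto simp: cat_def)

lemma cat_add: "Z' 0 = Z n \<Longrightarrow> cat Z n Z' (n + k) = Z' k"
  by (simp add: cat_ge)

lemma ray_0 [simp]: "ray u d 0 = u"
  by (simp add: ray_def)

lemma fst_ray [simp]: "fst (ray u d k) = fst u + int k * fst d"
  and snd_ray [simp]: "snd (ray u d k) = snd u + int k * snd d"
  by (simp_all add: ray_def)

lemma ray_Suc [simp]: "ray u d (Suc k) - ray u d k = d"
  by (cases d) (simp add: ray_def algebra_simps)

lemma ray_1: "ray u d (Suc 0) = u + d"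
  by (cases u; cases d) (simp add: ray_def)

lemma ray_inj: "unit d \<Longrightarrow> ray u d j = ray u d k \<longleftrightarrow> j = k"
  by (auto simp: unit_def ray_def)

lemma arc_ray: "unit d \<Longrightarrow> arc (ray u d) n"
  by (auto simp: arc_def inj_on_def ray_inj)

lemma infinite_range_ray: "unit d \<Longrightarrow> infinite (range (ray u d))"
  by (rule range_inj_infinite) (auto simp: inj_on_def ray_inj)

lemma cat_steps:
  assumes "\<forall>k<n. unit (Z (Suc k) - Z k)" "\<forall>k<m. unit (Z' (Suc k) - Z' k)" "Z' 0 = Z n"
  shows "\<forall>k<n + m. unit (cat Z n Z' (Suc k) - cat Z n Z' k)"
proof (intro allI impI)
  fix k assume k: "k < n + m"
  show "unit (cat Z n Z' (Suc k) - cat Z n Z' k)"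
  proof (cases "k < n")
    case True then show ?thesis using assms(1) by simp
  next
    case False
    then have "cat Z n Z' k = Z' (k - n)" "cat Z n Z' (Suc k) = Z' (Suc (k - n))"
      using assms(3) by (auto simp: cat_ge Suc_diff_le)
    then show ?thesis using assms(2) k False by auto
  qed
qed

lemma arc_cat:
  assumes "arc Z n" "arc Z' m" "Z' 0 = Z n"
    and "\<And>i j. i \<le> n \<Longrightarrow> 1 \<le> j \<Longrightarrow> j \<le> m \<Longrightarrow> Z i \<noteq> Z' j"
  shows "arc (cat Z n Z') (n + m)"
proof -
  have "inj_on (cat Z n Z') {..n + m}"
  proof (rule inj_onI)
    have *: "i = j" if "i \<le> j" "j \<le> n + m" "cat Z n Z' i = cat Z n Z' j" for i j
    proof -
      consider "j \<le> n" | "i \<le> n" "n < j" | "n < i" using that(1) by linarith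
      then show ?thesis
      proof cases
        case 1 then show ?thesis using that assms(1) by (auto simp: arc_def inj_on_def)
      next
        case 2 then show ?thesis using that assms(4)[of i "j - n"] by (auto simp: cat_def)
      next
        case 3
        then have "Z' (i - n) = Z' (j - n)" using that by (auto simp: cat_def)
        then have "i - n = j - n" using assms(2) that 3 by (auto simp: arc_def inj_on_def)
        then show ?thesis using 3 that by linarith
      qed
    qed
    fix i j assume "i \<in> {..n + m}" "j \<in> {..n + m}" "cat Z n Z' i = cat Z n Z' j"
    then show "i = j" using *[of i j] *[of j i] by (metis atMost_iff nat_le_linear)
  qed
  then show ?thesis using cat_steps[of n Z m Z'] assms by (simp add: arc_def)
qed

lemma cycle_cat:
  assumes "arc Z n" "arc Z' m" "Z' 0 = Z n" "Z' m = Z 0" "3 \<le> n + m" "1 \<le> m"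
    and "\<And>i j. i \<le> n \<Longrightarrow> 1 \<le> j \<Longrightarrow> j < m \<Longrightarrow> Z i \<noteq> Z' j"
  shows "simple_cycle (cat Z n Z') (n + m)"
proof -
  have "arc Z' (m - 1)" using assms(2) by (auto simp: arc_def inj_on_def)
  then have "arc (cat Z n Z') (n + (m - 1))"
    by (rule arc_cat[OF assms(1)]) (use assms in auto)
  then have "inj_on (cat Z n Z') {..<n + m}"
    using assms(6) by (auto simp: arc_def inj_on_def)
  moreover have "\<forall>k<n + m. unit (cat Z n Z' (Suc k) - cat Z n Z' k)"
    using cat_steps[of n Z m Z'] assms by (simp add: arc_def)
  moreover have "cat Z n Z' (n + m) = Z 0" using assms by (simp add: cat_add)
  ultimately show ?thesis using assms by (simp add: simple_cycle_def)
qed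

lemma image_cat:
  assumes "Z' 0 = Z n"
  shows "cat Z n Z' ` {..n + m} = Z ` {..n} \<union> Z' ` {..m}"
proof -
  have "cat Z n Z' k \<in> Z ` {..n} \<union> Z' ` {..m}" if "k \<le> n + m" for k
    using that by (cases "k \<le> n") (auto simp: cat_def)
  moreover have "Z k \<in> cat Z n Z' ` {..n + m}" if "k \<le> n" for k
    using that by (auto simp: image_iff intro!: bexI[of _ k])
  moreover have "Z' k \<in> cat Z n Z' ` {..n + m}" if "k \<le> m" for k
    using that by (auto simp: image_iff cat_add[of Z' Z n, OF assms] intro!: bexI[of _ "n + k"])
  ultimately show ?thesis by blast
qed

lemma ipath_inj: "ipath Y \<Longrightarrow> Y i = Y j \<longleftrightarrow> i = j"
  by (auto simp: ipath_def dest: injD)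

lemma ipath_arc: "ipath Y \<Longrightarrow> arc (\<lambda>k. Y (a + k)) n"
  by (auto simp: ipath_def arc_def intro!: inj_onI dest: injD)

lemma ipath_step: "ipath Y \<Longrightarrow> unit (Y (Suc k) - Y k)"
  by (simp add: ipath_def)

lemma ipath_back: "ipath Y \<Longrightarrow> 0 < k \<Longrightarrow> unit (Y (k - 1) - Y k)"
  using ipath_step[of Y "k - 1"] unit_uminus[of "Y k - Y (k - 1)"] by simp

lemma ipath_tail_infinite: "ipath Y \<Longrightarrow> infinite (range (\<lambda>k. Y (b + k)))"
  by (rule range_inj_infinite) (auto simp: inj_on_def ipath_inj)

text \<open>The detour \<open>D\<close> closes up the path; the continuation of the path and the prolongation of a segment
  of the detour start on different sides of the resulting Jordan curve, but both escape to infinity.\<close>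
lemma detour_escape:
  assumes Y: "ipath Y" and ab: "a < b"
    and D: "arc D m" "D 0 = Y b" "D m = Y a" "2 \<le> m" "\<And>i j. 1 \<le> j \<Longrightarrow> j < m \<Longrightarrow> Y i \<noteq> D j"
    and q: "0 < q" "q < m"
    and B: "\<And>k. 1 \<le> k \<Longrightarrow> ray (D q) d k \<notin> D ` {..m}" "\<And>k i. 1 \<le> k \<Longrightarrow> a \<le> i \<Longrightarrow> i \<le> b \<Longrightarrow> ray (D q) d k \<noteq> Y i" "unit d"
  shows "\<lbrakk>tn (Y (b - 1) - Y b) (Y (Suc b) - Y b) < tn (Y (b - 1) - Y b) (D 1 - Y b);
      tn (D (q - 1) - D q) (D (Suc q) - D q) < tn (D (q - 1) - D q) d\<rbrakk> \<Longrightarrow> False"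
    and "\<lbrakk>tn (Y (b - 1) - Y b) (D 1 - Y b) < tn (Y (b - 1) - Y b) (Y (Suc b) - Y b);
      tn (D (q - 1) - D q) d < tn (D (q - 1) - D q) (D (Suc q) - D q)\<rbrakk> \<Longrightarrow> False"
proof -
  define n where "n = b - a"
  define Z where "Z = cat (\<lambda>k. Y (a + k)) n D"
  have n: "0 < n" "a + n = b" using ab by (auto simp: n_def)
  have D0: "D 0 = Y (a + n)" using D n by simp
  have Z: "simple_cycle Z (n + m)" unfolding Z_def
    by (rule cycle_cat) (use D n ipath_arc[OF Y] in auto)
  have im: "Z ` {..n + m} = (\<lambda>k. Y (a + k)) ` {..n} \<union> D ` {..m}"
    unfolding Z_def by (rule image_cat) (use D n in auto)
  have Zn: "Z (n - 1) = Y (b - 1)" "Z n = Y b" "Z (Suc n) = D 1"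
    using n D0 by (auto simp: Z_def cat_def Nat.add_diff_assoc)
  have Zq: "Z (n + q - 1) = D (q - 1)" "Z (n + q) = D q" "Z (Suc (n + q)) = D (Suc q)"
    using q cat_add[of D "\<lambda>k. Y (a + k)" n, OF D0, of "q - 1"] cat_add[of D "\<lambda>k. Y (a + k)" n, OF D0, of "q"]
      cat_add[of D "\<lambda>k. Y (a + k)" n, OF D0, of "Suc q"] by (auto simp: Z_def)
  have dA: "Y (b + k) \<notin> Z ` {..<n + m}" if "1 \<le> k" for k
  proof -
    have "Y (b + k) \<notin> D ` {..m}"
    proof
      assume "Y (b + k) \<in> D ` {..m}"
      then obtain j where j: "j \<le> m" "Y (b + k) = D j" by auto
      consider "j = 0" | "j = m" | "1 \<le> j" "j < m" using j by linarith
      then show False using j D that ab by cases (auto simp: ipath_inj[OF Y])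
    qed
    moreover have "Y (b + k) \<notin> (\<lambda>k. Y (a + k)) ` {..n}" using that n by (auto simp: ipath_inj[OF Y])
    ultimately have "Y (b + k) \<notin> Z ` {..n + m}" unfolding im by blast
    then show ?thesis by force
  qed
  have dB: "ray (D q) d k \<notin> Z ` {..<n + m}" if "1 \<le> k" for k
  proof -
    have "ray (D q) d k \<notin> (\<lambda>k. Y (a + k)) ` {..n}"
    proof
      assume "ray (D q) d k \<in> (\<lambda>k. Y (a + k)) ` {..n}"
      then obtain i where "i \<le> n" "ray (D q) d k = Y (a + i)" by auto
      then show False using B(2)[OF that, of "a + i"] n by auto
    qed
    then have "ray (D q) d k \<notin> Z ` {..n + m}" unfolding im using B(1)[OF that] by blast
    then show ?thesis by force
  qed
  note J = two_sided_escape[OF Z]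
  have p: "0 < n" "n < n + m" "0 < n + q" "n + q < n + m" using n q by auto
  have stA: "unit (Y (b + Suc k) - Y (b + k))" for k using ipath_step[OF Y] by simp
  have stB: "unit (ray (D q) d (Suc k) - ray (D q) d k)" for k using B(3) by simp
  have iA: "infinite (range (\<lambda>k. Y (b + k)))" by (rule ipath_tail_infinite[OF Y])
  have iB: "infinite (range (ray (D q) d))" by (rule infinite_range_ray[OF B(3)])
  have r1: "ray (D q) d 1 - D q = d" by (simp add: ray_1)
  {
    assume "tn (Y (b - 1) - Y b) (Y (Suc b) - Y b) < tn (Y (b - 1) - Y b) (D 1 - Y b)"
      "tn (D (q - 1) - D q) (D (Suc q) - D q) < tn (D (q - 1) - D q) d"
    then show False
      using J[OF p(1,2,3,4), of "\<lambda>k. Y (b + k)" "ray (D q) d"] stA stB iA iB dA dB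
      by (simp only: Zn Zq r1) simp
  }
  {
    assume "tn (Y (b - 1) - Y b) (D 1 - Y b) < tn (Y (b - 1) - Y b) (Y (Suc b) - Y b)"
      "tn (D (q - 1) - D q) d < tn (D (q - 1) - D q) (D (Suc q) - D q)"
    then show False
      using J[OF p(3,4,1,2), of "ray (D q) d" "\<lambda>k. Y (b + k)"] stA stB iA iB dA dB
      by (simp only: Zn Zq r1) simp
  }
qed

text \<open>The east ray at \<open>Y k\<close> meets the path only in \<open>Y k\<close>; \<open>leftd\<close> says that direction \<open>d\<close> leaves to the left.\<close>
definition evis :: "(nat \<Rightarrow> pos) \<Rightarrow> nat \<Rightarrow> bool" where
  "evis Y k \<longleftrightarrow> (\<forall>j. snd (Y j) = snd (Y k) \<longrightarrow> fst (Y j) \<le> fst (Y k))"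

definition leftd :: "(nat \<Rightarrow> pos) \<Rightarrow> nat \<Rightarrow> pos \<Rightarrow> bool" where
  "leftd Y k d \<longleftrightarrow> tn (Y (k - 1) - Y k) d < tn (Y (k - 1) - Y k) (Y (Suc k) - Y k)"

abbreviation "eleft Y k \<equiv> leftd Y k (1,0)"

text \<open>The direction \<open>d\<close> differs from both directions that the path uses at
  \<open>Y k\<close>, so the two turn values cannot be equal, and what is not left is strictly
  right.\<close>

lemma not_leftd:
  assumes Y: "ipath Y" and k: "0 < k" and d: "unit d" "Y k + d \<notin> range Y" and l: "\<not> leftd Y k d"
  shows "tn (Y (k - 1) - Y k) (Y (Suc k) - Y k) < tn (Y (k - 1) - Y k) d"
proof (rule ccontr)
  assume "\<not> ?thesis"
  then have eq: "tn (Y (k - 1) - Y k) d = tn (Y (k - 1) - Y k) (Y (Suc k) - Y k)"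
    using l by (simp add: leftd_def)
  have ne: "Y j - Y k \<noteq> d" for j
    using d(2) by (metis add.commute diff_add_cancel rangeI)
  have "d = Y (Suc k) - Y k"
  proof (rule tn_inj[OF ipath_back[OF Y k] d(1) ipath_step[OF Y] _ _ eq])
    show "d \<noteq> Y (k - 1) - Y k" using ne[of "k - 1"] by simp
    have "Y (Suc k) \<noteq> Y (k - 1)" using k by (simp add: ipath_inj[OF Y])
    then show "Y (Suc k) - Y k \<noteq> Y (k - 1) - Y k" by simp
  qed
  then show False using ne by metis
qed

lemma evis_next: "evis Y k \<Longrightarrow> Y k + (1,0) \<notin> range Y"
  by (auto simp: evis_def) (metis add_cancel_right_right add.commute add_le_same_cancel1 fst_add fst_conv not_one_le_zero snd_add snd_conv)

lemma evis_ray: "evis Y k \<Longrightarrow> 1 \<le> t \<Longrightarrow> snd u = snd (Y k) \<Longrightarrow> fst u = fst (Y k) + int t \<Longrightarrow> Y j \<noteq> u"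
  by (auto simp: evis_def)

lemma tn_simps:
  "tn (-1,0) (0,1) = 1" "tn (-1,0) (1,0) = 2" "tn (-1,0) (0,-1) = 3"
  "tn (0,-1) (-1,0) = 1" "tn (0,-1) (0,1) = 2" "tn (0,-1) (1,0) = 3"
  by (simp_all add: tn_def cw_def)

lemma unit_simps [simp]: "unit (1,0)" "unit (0,1)" "unit (-1,0)" "unit (0,-1)"
  by (simp_all add: unit_def)

text \<open>A vertical segment in column \<open>X\<close> joins the two visible rays and closes the
  path between \<open>a\<close> and \<open>b\<close>. At the corner on the ray of \<open>Y b\<close>
  this ray continues east to infinity, on the right of the curve if the segment turns up and on the
  left if it turns down. The path after \<open>b\<close> has to escape on the same side.\<close>

lemma visible_pair:
  assumes Y: "ipath Y" and ab: "a < b" and va: "evis Y a" and vb: "evis Y b"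
    and X: "fst (Y a) < X" "fst (Y b) < X"
    and free: "\<And>k. fst (Y k) = X \<Longrightarrow> snd (Y k) < min (snd (Y a)) (snd (Y b)) \<or> snd (Y k) > max (snd (Y a)) (snd (Y b))"
  shows "snd (Y b) < snd (Y a) \<Longrightarrow> eleft Y b" "snd (Y a) < snd (Y b) \<Longrightarrow> \<not> eleft Y b"
proof -
  define n1 where "n1 = nat (X - fst (Y b))"
  define n2 where "n2 = nat \<bar>snd (Y a) - snd (Y b)\<bar>"
  define n3 where "n3 = nat (X - fst (Y a))"
  define s where "s = sgn (snd (Y a) - snd (Y b))"
  define D1 where "D1 = ray (Y b) (1,0)"
  define D2 where "D2 = ray (X, snd (Y b)) (0,s)"
  define D3 where "D3 = ray (X, snd (Y a)) (-1,0)"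
  define D where "D = cat D1 n1 (cat D2 n2 D3)"
  have b0: "0 < b" using ab by simp
  have core: False if ne: "snd (Y a) \<noteq> snd (Y b)"
    and bad: "(snd (Y b) < snd (Y a) \<and> \<not> eleft Y b) \<or> (snd (Y a) < snd (Y b) \<and> eleft Y b)"
  proof -
    have s: "s = 1 \<or> s = -1" "unit (0,s)" using ne by (auto simp: s_def sgn_if unit_def)
    have n: "1 \<le> n1" "1 \<le> n2" "1 \<le> n3" using ne X by (auto simp: n1_def n2_def n3_def)
    have e1: "int n1 = X - fst (Y b)" "int n3 = X - fst (Y a)" using X by (auto simp: n1_def n3_def)
    have e2: "snd (Y b) + int n2 * s = snd (Y a)"
      by (auto simp: n2_def s_def sgn_if)
    have j1: "D2 0 = D1 n1" by (auto simp: D1_def D2_def e1 prod_eq_iff)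
    have j2: "D3 0 = D2 n2" by (auto simp: D3_def D2_def e2 prod_eq_iff)
    have j3: "cat D2 n2 D3 0 = D1 n1" by (simp add: j1)
    have a23: "arc (cat D2 n2 D3) (n2 + n3)"
      by (rule arc_cat) (use j2 e2 s ne in \<open>auto simp: D2_def D3_def arc_ray prod_eq_iff\<close>)
    have D23: "snd (cat D2 n2 D3 j) \<noteq> snd (Y b)" if "1 \<le> j" for j
      using that s ne by (auto simp: cat_def D2_def D3_def)
    have arcD: "arc D (n1 + (n2 + n3))"
      unfolding D_def
    proof (rule arc_cat)
      show "cat D2 n2 D3 0 = D1 n1" by (rule j3)
      show "arc (cat D2 n2 D3) (n2 + n3)" by (rule a23)
      show "arc D1 n1" by (simp add: D1_def arc_ray)
      show "D1 i \<noteq> cat D2 n2 D3 j" if "1 \<le> j" for i j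
        using D23[OF that] by (auto simp: D1_def dest!: arg_cong[of _ _ snd])
    qed
    have q: "0 < n1" "n1 < n1 + (n2 + n3)" using n by auto
    have Dm: "D (n1 + (n2 + n3)) = Y a"
      unfolding D_def by (simp add: cat_add[of "cat D2 n2 D3" D1 n1, OF j3] cat_add[of D3 D2 n2, OF j2]) (simp add: D3_def e1 prod_eq_iff)
    have Dq: "D n1 = (X, snd (Y b))" "D (n1 - 1) - D n1 = (-1,0)" "D (Suc n1) - D n1 = (0,s)" "D 1 - Y b = (1,0)"
    proof -
      show 1: "D n1 = (X, snd (Y b))" by (simp add: D_def D1_def prod_eq_iff e1)
      show "D (n1 - 1) - D n1 = (-1,0)" using n by (simp add: D_def D1_def prod_eq_iff)
      have "D (Suc n1) = D2 1" using cat_add[of "cat D2 n2 D3" D1 n1 1, OF j3] n by (simp add: D_def)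
      then show "D (Suc n1) - D n1 = (0,s)" by (simp add: 1 D2_def prod_eq_iff)
      show "D 1 - Y b = (1,0)" using n by (simp add: D_def D1_def prod_eq_iff)
    qed
    have Dpts: "fst (D j) \<le> X" for j
      using e1 by (auto simp: D_def cat_def D1_def D2_def D3_def)
    have D0: "D 0 = Y b" by (simp add: D_def D1_def)
    have dY: "Y i \<noteq> D j" if j: "1 \<le> j" "j < n1 + (n2 + n3)" for i j
    proof -
      consider "j \<le> n1" | "n1 < j" "j \<le> n1 + n2" | "n1 + n2 < j" by linarith
      then show ?thesis
      proof cases
        case 1 then show ?thesis
          using evis_ray[OF vb j(1), of "D j" i] by (simp add: D_def D1_def)
      next
        case 2
        then have Dj: "D j = ray (X, snd (Y b)) (0,s) (j - n1)" by (auto simp: D_def cat_def D2_def)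
        have k: "int (j - n1) \<le> int n2" "1 \<le> j - n1" using 2 by auto
        have "min (snd (Y a)) (snd (Y b)) \<le> snd (D j) \<and> snd (D j) \<le> max (snd (Y a)) (snd (Y b))"
          using k e2 s(1) unfolding Dj by auto
        moreover have "fst (D j) = X" by (simp add: Dj)
        ultimately show ?thesis using free[of i] by fastforce
      next
        case 3
        define t where "t = n1 + (n2 + n3) - j"
        have t: "1 \<le> t" "int (j - n1 - n2) = int n3 - int t" using j 3 by (auto simp: t_def)
        have Dj: "D j = ray (X, snd (Y a)) (-1,0) (j - n1 - n2)" using 3 by (auto simp: D_def cat_def D3_def)
        show ?thesis
          using evis_ray[OF va t(1), of "D j" i] t(2) e1 by (simp add: Dj)
      qed
    qed
    have B1: "ray (D n1) (1,0) k \<notin> D ` {..n1 + (n2 + n3)}" if "1 \<le> k" for k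
    proof
      assume "ray (D n1) (1,0) k \<in> D ` {..n1 + (n2 + n3)}"
      then obtain j where "ray (D n1) (1,0) k = D j" by auto
      then have "X + int k = fst (D j)" by (auto simp: Dq(1) dest!: arg_cong[of _ _ fst])
      then show False using Dpts[of j] that by simp
    qed
    have B2: "ray (D n1) (1,0) k \<noteq> Y i" if "1 \<le> k" for k i
      using evis_ray[OF vb, of "n1 + k" "ray (D n1) (1,0) k" i] that e1 by (auto simp: Dq(1))
    note J = detour_escape[OF Y ab arcD D0 Dm _ dY q B1 B2, unfolded Dq(2-4)]
    from bad show False
    proof
      assume "snd (Y b) < snd (Y a) \<and> \<not> eleft Y b"
      then show False using J(1) n not_leftd[OF Y b0 _ evis_next[OF vb]] by (simp add: s_def tn_simps)
    next
      assume "snd (Y a) < snd (Y b) \<and> eleft Y b"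
      then show False using J(2) n by (simp add: s_def tn_simps leftd_def)
    qed
  qed
  show "snd (Y b) < snd (Y a) \<Longrightarrow> eleft Y b" using core by auto
  show "snd (Y a) < snd (Y b) \<Longrightarrow> \<not> eleft Y b" using core by auto
qed

text \<open>Row \<open>m\<close> is free from the column of \<open>Y a\<close> eastwards. The detour
  runs from \<open>Y b\<close> east beyond the whole path, up to row \<open>m\<close>, back west,
  and down one step to \<open>Y a\<close>; the corner argument of \<open>visible_pair\<close> then
  applies. It serves for a highest point \<open>Y a\<close> of the uncut path, which may itself be
  hidden from the east.\<close>

lemma visible_under_record:
  assumes Y: "ipath Y" and ab: "a < b" and vb: "evis Y b"
    and m: "snd (Y a) = m - 1" "snd (Y b) < m - 1"
    and top: "\<And>k. m \<le> snd (Y k) \<Longrightarrow> fst (Y k) < fst (Y a)"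
    and X: "\<And>k. fst (Y k) < X"
  shows "eleft Y b"
proof (rule ccontr)
  assume nl: "\<not> eleft Y b"
  define n1 where "n1 = nat (X - fst (Y b))"
  define n2 where "n2 = nat (m - snd (Y b))"
  define n3 where "n3 = nat (X - fst (Y a))"
  define D1 where "D1 = ray (Y b) (1,0)"
  define D2 where "D2 = ray (X, snd (Y b)) (0,1)"
  define D3 where "D3 = ray (X, m) (-1,0)"
  define D4 where "D4 = ray (fst (Y a), m) (0,-1)"
  define D34 where "D34 = cat D3 n3 D4"
  define D234 where "D234 = cat D2 n2 D34"
  define D where "D = cat D1 n1 D234"
  have b0: "0 < b" using ab by simp
  have n: "1 \<le> n1" "1 \<le> n2" "1 \<le> n3" using m X[of a] X[of b] by (auto simp: n1_def n2_def n3_def)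
  have e: "int n1 = X - fst (Y b)" "int n3 = X - fst (Y a)" "int n2 = m - snd (Y b)"
    using X[of a] X[of b] m by (auto simp: n1_def n3_def n2_def)
  have j3: "D4 0 = D3 n3" by (auto simp: D3_def D4_def e prod_eq_iff)
  have j2: "D34 0 = D2 n2" by (auto simp: D34_def D3_def D2_def e prod_eq_iff)
  have j1: "D234 0 = D1 n1" by (auto simp: D234_def D1_def D2_def e prod_eq_iff)
  have a34: "arc D34 (n3 + 1)" unfolding D34_def
    by (rule arc_cat) (use j3 e in \<open>auto simp: D3_def D4_def arc_ray prod_eq_iff\<close>)
  have a234: "arc D234 (n2 + (n3 + 1))" unfolding D234_def
  proof (rule arc_cat[where Z=D2 and Z'=D34, OF _ a34 j2])
    show "arc D2 n2" by (simp add: D2_def arc_ray)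
    fix i j :: nat assume ij: "i \<le> n2" "1 \<le> j" "j \<le> n3 + 1"
    show "D2 i \<noteq> D34 j"
      using ij X[of a] e by (auto simp: D2_def D34_def cat_def D3_def D4_def prod_eq_iff)
  qed
  have D234y: "snd (D234 j) > snd (Y b)" if "1 \<le> j" "j \<le> n2 + (n3 + 1)" for j
    using that m n by (auto simp: D234_def D34_def cat_def D2_def D3_def D4_def)
  have arcD: "arc D (n1 + (n2 + (n3 + 1)))" unfolding D_def
  proof (rule arc_cat[where Z=D1 and Z'=D234, OF _ a234 j1])
    show "arc D1 n1" by (simp add: D1_def arc_ray)
    fix i j :: nat assume ij: "i \<le> n1" "1 \<le> j" "j \<le> n2 + (n3 + 1)"
    show "D1 i \<noteq> D234 j"
      using D234y[of j] ij by (auto simp: D1_def dest!: arg_cong[of _ _ snd])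
  qed
  have q: "0 < n1" "n1 < n1 + (n2 + (n3 + 1))" using n by auto
  have D0: "D 0 = Y b" by (simp add: D_def D1_def)
  have Dm: "D (n1 + (n2 + (n3 + 1))) = Y a"
    unfolding D_def by (simp only: cat_add[of D234 D1 n1, OF j1])
      (simp only: D234_def cat_add[of D34 D2 n2, OF j2], simp only: D34_def cat_add[of D4 D3 n3, OF j3],
       simp add: D4_def m prod_eq_iff)
  have Dq: "D n1 = (X, snd (Y b))" "D (n1 - 1) - D n1 = (-1,0)" "D (Suc n1) - D n1 = (0,1)" "D 1 - Y b = (1,0)"
  proof -
    show 1: "D n1 = (X, snd (Y b))" by (simp add: D_def D1_def prod_eq_iff e)
    show "D (n1 - 1) - D n1 = (-1,0)" using n by (simp add: D_def D1_def prod_eq_iff)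
    have "D (Suc n1) = D2 1" using cat_add[of D234 D1 n1 1, OF j1] n by (simp add: D_def D234_def)
    then show "D (Suc n1) - D n1 = (0,1)" by (simp add: 1 D2_def prod_eq_iff)
    show "D 1 - Y b = (1,0)" using n by (simp add: D_def D1_def prod_eq_iff)
  qed
  have Dpts: "fst (D j) \<le> X" for j
    using e X[of a] by (auto simp: D_def cat_def D1_def D234_def D34_def D2_def D3_def D4_def)
  have dY: "Y i \<noteq> D j" if j: "1 \<le> j" "j < n1 + (n2 + (n3 + 1))" for i j
  proof -
    consider "j \<le> n1" | "n1 < j" "j \<le> n1 + n2" | "n1 + n2 < j" "j \<le> n1 + n2 + n3" using j by linarith
    then show ?thesis
    proof cases
      case 1 then show ?thesis
        using evis_ray[OF vb j(1), of "D j" i] by (simp add: D_def D1_def)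
    next
      case 2
      then have "fst (D j) = X" by (auto simp: D_def cat_def D234_def D2_def)
      then show ?thesis using X[of i] by auto
    next
      case 3
      then have Dj: "D j = ray (X, m) (-1,0) (j - n1 - n2)" by (auto simp: D_def D234_def D34_def cat_def D3_def)
      have "fst (D j) \<ge> fst (Y a)" "snd (D j) = m" using 3 e unfolding Dj by auto
      then show ?thesis using top[of i] by auto
    qed
  qed
  have B1: "ray (D n1) (1,0) k \<notin> D ` {..n1 + (n2 + (n3 + 1))}" if "1 \<le> k" for k
  proof
    assume "ray (D n1) (1,0) k \<in> D ` {..n1 + (n2 + (n3 + 1))}"
    then obtain j where "ray (D n1) (1,0) k = D j" by auto
    then have "X + int k = fst (D j)" by (auto simp: Dq(1) dest!: arg_cong[of _ _ fst])
    then show False using Dpts[of j] that by simp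
  qed
  have B2: "ray (D n1) (1,0) k \<noteq> Y i" if "1 \<le> k" for k i
    using X[of i] that by (auto simp: Dq(1) dest!: arg_cong[of _ _ fst])
  show False
    using detour_escape(1)[OF Y ab arcD D0 Dm _ dY q B1 B2, unfolded Dq(2-4)] n not_leftd[OF Y b0 _ evis_next[OF vb] nl]
    by (simp add: tn_simps)
qed

text \<open>The free column above \<open>Y b\<close> leads up to the free east ray of
  \<open>Y a\<close>. The detour climbs to that ray and follows it west to \<open>Y a\<close>, while
  the eastern rest of the ray is the prolongation that escapes.\<close>

lemma visible_bent:
  assumes Y: "ipath Y" and ab: "a < b" and va: "evis Y a"
    and h: "1 \<le> h" "snd (Y a) = snd (Y b) + int h" "fst (Y a) < fst (Y b)"
    and free: "\<And>t k. 1 \<le> t \<Longrightarrow> t \<le> h \<Longrightarrow> Y k \<noteq> (fst (Y b), snd (Y b) + int t)"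
  shows "leftd Y b (0,1)"
proof (rule ccontr)
  assume nl: "\<not> leftd Y b (0,1)"
  define n2 where "n2 = nat (fst (Y b) - fst (Y a))"
  define D1 where "D1 = ray (Y b) (0,1)"
  define D2 where "D2 = ray (fst (Y b), snd (Y a)) (-1,0)"
  define D where "D = cat D1 h D2"
  have b0: "0 < b" using ab by simp
  have e: "int n2 = fst (Y b) - fst (Y a)" "1 \<le> n2" using h by (auto simp: n2_def)
  have j1: "D2 0 = D1 h" by (auto simp: D1_def D2_def h prod_eq_iff)
  have arcD: "arc D (h + n2)" unfolding D_def
    by (rule arc_cat[where Z=D1 and Z'=D2, OF _ _ j1]) (auto simp: D1_def D2_def arc_ray prod_eq_iff)
  have D0: "D 0 = Y b" by (simp add: D_def D1_def)
  have Dm: "D (h + n2) = Y a"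
    unfolding D_def by (simp only: cat_add[of D2 D1 h, OF j1]) (simp add: D2_def e prod_eq_iff)
  have Dq: "D h = (fst (Y b), snd (Y a))" "D (h - 1) - D h = (0,-1)" "D (Suc h) - D h = (-1,0)" "D 1 - Y b = (0,1)"
  proof -
    show 1: "D h = (fst (Y b), snd (Y a))" by (simp add: D_def D1_def prod_eq_iff h)
    show "D (h - 1) - D h = (0,-1)" using h(1) by (simp add: D_def D1_def prod_eq_iff)
    have "D (Suc h) = D2 1" using cat_add[of D2 D1 h 1, OF j1] by (simp add: D_def)
    then show "D (Suc h) - D h = (-1,0)" by (simp add: 1 D2_def prod_eq_iff)
    show "D 1 - Y b = (0,1)" using h(1) by (simp add: D_def D1_def prod_eq_iff)
  qed
  have q: "0 < h" "h < h + n2" using h e by auto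
  have dY: "Y i \<noteq> D j" if j: "1 \<le> j" "j < h + n2" for i j
  proof (cases "j \<le> h")
    case True
    then have "D j = (fst (Y b), snd (Y b) + int j)" by (simp add: D_def D1_def prod_eq_iff)
    then show ?thesis using free[of j i] j True by simp
  next
    case False
    define t where "t = h + n2 - j"
    have t: "1 \<le> t" "int (j - h) = int n2 - int t" using j False by (auto simp: t_def)
    have Dj: "D j = ray (fst (Y b), snd (Y a)) (-1,0) (j - h)" using False by (auto simp: D_def cat_def D2_def)
    show ?thesis using evis_ray[OF va t(1), of "D j" i] t(2) e by (simp add: Dj)
  qed
  have B1: "ray (D h) (1,0) k \<notin> D ` {..h + n2}" if "1 \<le> k" for k
  proof
    assume "ray (D h) (1,0) k \<in> D ` {..h + n2}"
    then obtain j where "ray (D h) (1,0) k = D j" by auto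
    moreover have "fst (D j) \<le> fst (Y b)" by (auto simp: D_def cat_def D1_def D2_def)
    ultimately show False using that by (auto simp: Dq(1) dest!: arg_cong[of _ _ fst])
  qed
  have B2: "ray (D h) (1,0) k \<noteq> Y i" if "1 \<le> k" for k i
    using evis_ray[OF va, of "n2 + k" "ray (D h) (1,0) k" i] that e by (auto simp: Dq(1))
  have "Y b + (0,1) \<notin> range Y"
  proof
    assume "Y b + (0,1) \<in> range Y"
    then obtain k where "Y k = Y b + (0,1)" by auto
    then show False using free[of 1 k] h(1) by (simp add: prod_eq_iff)
  qed
  then show False
    using detour_escape(1)[OF Y ab arcD D0 Dm _ dY q B1 B2, unfolded Dq(2-4)] e h(1) not_leftd[OF Y b0 _ _ nl]
    by (simp add: tn_simps)
qed

text \<open>\<open>Y w\<close> and \<open>Y u\<close> are the extreme points of row \<open>r\<close>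
  visited up to \<open>u\<close>. The path from \<open>w\<close> to \<open>u\<close>, closed by an
  arc around the upper half of a large box, is a Jordan curve. Until \<open>v\<close> the path meets
  row \<open>r\<close> only strictly between the extremes and so cannot cross this curve. A point
  above all of the old path lies inside, a point below all of it lies outside.\<close>

lemma no_crossing_between:
  assumes Y: "ipath Y" and wu: "w < u" and row: "snd (Y w) = r" "snd (Y u) = r"
    and old: "\<And>k. k \<le> u \<Longrightarrow> snd (Y k) = r \<Longrightarrow> fst (Y w) \<le> fst (Y k) \<and> fst (Y k) \<le> fst (Y u)"
    and new: "\<And>k. u < k \<Longrightarrow> k < v \<Longrightarrow> snd (Y k) = r \<Longrightarrow> fst (Y w) < fst (Y k) \<and> fst (Y k) < fst (Y u)"
    and a: "u < a" "a < v" "\<And>k. k \<le> u \<Longrightarrow> snd (Y k) < snd (Y a)"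
    and b: "u < b" "b < v" "\<And>k. k \<le> u \<Longrightarrow> snd (Y b) < snd (Y k)"
  shows False
proof -
  obtain B where B0: "\<forall>p\<in>Y ` {..v}. \<bar>fst p\<bar> < B \<and> \<bar>snd p\<bar> < B"
    using finite_bound_pos[of "Y ` {..v}"] by auto
  have B: "-B < fst (Y k)" "fst (Y k) < B" "-B < snd (Y k)" "snd (Y k) < B" if "k \<le> v" for k
    using B0 that by (auto simp: abs_less_iff) (force simp: abs_less_iff)+
  have uv: "u \<le> v" "w \<le> v" "a \<le> v" "b \<le> v" using wu a b by auto
  note Bu = B[OF uv(1)] and Bw = B[OF uv(2)] and Ba = B[OF uv(3)] and Bb = B[OF uv(4)]
  have rB: "-B < r" "r < B" using Bu row by auto
  have Bpos: "0 < B" using rB by auto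
  have xwu: "fst (Y w) < fst (Y u)"
  proof -
    have "fst (Y w) \<le> fst (Y u)" using old[of u] row by simp
    moreover have "Y w \<noteq> Y u" using wu by (simp add: ipath_inj[OF Y])
    ultimately show ?thesis using row by (auto simp: prod_eq_iff)
  qed
  have ra: "r < snd (Y a)" using a(3)[of u] row by simp
  have rb: "snd (Y b) < r" using b(3)[of u] row by simp
  define n1 where "n1 = nat (B - fst (Y u))"
  define n2 where "n2 = nat (B - r)"
  define n3 where "n3 = nat (2 * B)"
  define n4 where "n4 = nat (B - r)"
  define n5 where "n5 = nat (fst (Y w) + B)"
  define D1 where "D1 = ray (Y u) (1,0)"
  define D2 where "D2 = ray (B, r) (0,1)"
  define D3 where "D3 = ray (B, B) (-1,0)"
  define D4 where "D4 = ray (-B, B) (0,-1)"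
  define D5 where "D5 = ray (-B, r) (1,0)"
  define D45 where "D45 = cat D4 n4 D5"
  define D345 where "D345 = cat D3 n3 D45"
  define D2345 where "D2345 = cat D2 n2 D345"
  define D where "D = cat D1 n1 D2345"
  define m where "m = n1 + (n2 + (n3 + (n4 + n5)))"
  have e: "int n1 = B - fst (Y u)" "int n2 = B - r" "int n3 = 2 * B" "int n4 = B - r" "int n5 = fst (Y w) + B"
    using Bu Bw rB Bpos by (auto simp: n1_def n2_def n3_def n4_def n5_def)
  have pos: "1 \<le> n1" "1 \<le> n2" "1 \<le> n3" "1 \<le> n4" "1 \<le> n5" using e Bu Bw rB Bpos by linarith+
  have j4: "D5 0 = D4 n4" by (auto simp: D4_def D5_def e prod_eq_iff)
  have j3: "D45 0 = D3 n3" by (auto simp: D45_def D3_def D4_def e prod_eq_iff)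
  have j2: "D345 0 = D2 n2" by (auto simp: D345_def D3_def D2_def e prod_eq_iff)
  have j1: "D2345 0 = D1 n1" by (auto simp: D2345_def D1_def D2_def e row prod_eq_iff)
  have a45: "arc D45 (n4 + n5)" unfolding D45_def
    by (rule arc_cat[where Z=D4 and Z'=D5, OF _ _ j4]) (auto simp: D4_def D5_def arc_ray prod_eq_iff)
  have a345: "arc D345 (n3 + (n4 + n5))" unfolding D345_def
  proof (rule arc_cat[where Z=D3 and Z'=D45, OF _ a45 j3])
    show "arc D3 n3" by (simp add: D3_def arc_ray)
    fix i j :: nat assume "i \<le> n3" "1 \<le> j"
    then have "snd (D45 j) < B" using rB by (auto simp: D45_def cat_def D4_def D5_def)
    then show "D3 i \<noteq> D45 j" by (auto simp: D3_def dest!: arg_cong[of _ _ snd])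
  qed
  have a2345: "arc D2345 (n2 + (n3 + (n4 + n5)))" unfolding D2345_def
  proof (rule arc_cat[where Z=D2 and Z'=D345, OF _ a345 j2])
    show "arc D2 n2" by (simp add: D2_def arc_ray)
    fix i j :: nat assume "1 \<le> j" "j \<le> n3 + (n4 + n5)"
    then have "fst (D345 j) < B" using e Bw Bpos by (auto simp: D345_def D45_def cat_def D3_def D4_def D5_def)
    then show "D2 i \<noteq> D345 j" by (auto simp: D2_def dest!: arg_cong[of _ _ fst])
  qed
  have arcD: "arc D m" unfolding D_def m_def
  proof (rule arc_cat[where Z=D1 and Z'=D2345, OF _ a2345 j1])
    show "arc D1 n1" by (simp add: D1_def arc_ray)
    fix i j :: nat assume "1 \<le> j" "j \<le> n2 + (n3 + (n4 + n5))"
    then have "snd (D2345 j) > r \<or> fst (D2345 j) < fst (Y u)"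
      using e xwu rB Bu by (auto simp: D2345_def D345_def D45_def cat_def D2_def D3_def D4_def D5_def)
    moreover have "snd (D1 i) = r" "fst (Y u) \<le> fst (D1 i)" by (auto simp: D1_def row)
    ultimately show "D1 i \<noteq> D2345 j" by auto
  qed
  have D0: "D 0 = Y u" by (simp add: D_def D1_def)
  have Dm: "D m = Y w" unfolding D_def m_def
    by (simp only: cat_add[of D2345 D1 n1, OF j1])
      (simp only: D2345_def cat_add[of D345 D2 n2, OF j2], simp only: D345_def cat_add[of D45 D3 n3, OF j3],
       simp only: D45_def cat_add[of D5 D4 n4, OF j4], simp add: D5_def e row prod_eq_iff)
  have Dcase: "fst (D j) = B \<and> r \<le> snd (D j) \<or> snd (D j) = B \<or> fst (D j) = -B \<and> r \<le> snd (D j)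
      \<or> snd (D j) = r \<and> (fst (Y u) \<le> fst (D j) \<or> fst (D j) \<le> fst (Y w))" if "j \<le> m" for j
    using that e by (auto simp: m_def D_def D2345_def D345_def D45_def cat_def D1_def D2_def D3_def D4_def D5_def row)
  have Dbox: "snd (D j) \<le> B" if "j \<le> m" for j
    using that e rB by (auto simp: m_def D_def D2345_def D345_def D45_def cat_def D1_def D2_def D3_def D4_def D5_def row)
  define n where "n = u - w"
  define Z where "Z = cat (\<lambda>k. Y (w + k)) n D"
  have n: "0 < n" "w + n = u" using wu by (auto simp: n_def)
  have DYn: "D 0 = Y (w + n)" using D0 n by simp
  have dYold: "Y i \<noteq> D j" if "w \<le> i" "i \<le> u" "1 \<le> j" "j < m" for i j
  proof
    assume eq: "Y i = D j"
    have i: "i \<le> v" using that wu a by auto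
    have "snd (D j) = r \<and> (fst (Y u) \<le> fst (D j) \<or> fst (D j) \<le> fst (Y w))"
      using Dcase[of j] B[OF i] that eq by auto
    then have "fst (Y i) = fst (Y u) \<or> fst (Y i) = fst (Y w)" "snd (Y i) = r"
      using old[OF that(2)] eq by auto
    then have "Y i = Y u \<or> Y i = Y w" using row by (auto simp: prod_eq_iff)
    then have "D j = D 0 \<or> D j = D m" using eq D0 Dm by auto
    then show False using arcD that by (auto simp: arc_def inj_on_def)
  qed
  have m2: "2 \<le> m" using pos by (simp add: m_def)
  have Z: "simple_cycle Z (n + m)" unfolding Z_def
    by (rule cycle_cat) (use arcD m2 n DYn Dm ipath_arc[OF Y] dYold in auto)
  have im: "Z ` {..n + m} = (\<lambda>k. Y (w + k)) ` {..n} \<union> D ` {..m}"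
    unfolding Z_def by (rule image_cat) (use DYn in auto)
  have offZ: "p \<notin> Z ` {..n + m}" if old_ne: "\<And>k. w \<le> k \<Longrightarrow> k \<le> u \<Longrightarrow> p \<noteq> Y k" and D_ne: "\<And>j. j \<le> m \<Longrightarrow> p \<noteq> D j" for p
  proof -
    have "p \<noteq> Y (w + k)" if "k \<le> n" for k by (rule old_ne) (use \<open>k \<le> n\<close> n in auto)
    then show ?thesis unfolding im using D_ne by auto
  qed
  have c1: "Z (n + m) = Z 0" and c2: "\<forall>k<n + m. unit (Z (Suc k) - Z k)" using Z by (auto simp: simple_cycle_def)
  have nD: "p \<noteq> D j" if "j \<le> m" "-B < fst p" "fst p < B" "snd p < B" "snd p \<noteq> r \<or> fst (Y w) < fst p \<and> fst p < fst (Y u)" for p j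
    using Dcase[OF that(1)] that by auto
  have Ynew: "Y k \<notin> Z ` {..n + m}" if "u < k" "k < v" for k
  proof (rule offZ)
    show "Y k \<noteq> Y i" if "i \<le> u" for i using that \<open>u < k\<close> by (simp add: ipath_inj[OF Y])
    show "Y k \<noteq> D j" if "j \<le> m" for j
      by (rule nD[OF that]) (use B[of k] new[OF \<open>u < k\<close> \<open>k < v\<close>] \<open>k < v\<close> in auto)
  qed
  have up: "ray (Y a) (0,1) k \<notin> Z ` {..n + m}" if "int k < B - snd (Y a)" for k
  proof (rule offZ)
    show "ray (Y a) (0,1) k \<noteq> Y i" if "i \<le> u" for i
      using a(3)[OF that] by (auto dest!: arg_cong[of _ _ snd])
    show "ray (Y a) (0,1) k \<noteq> D j" if "j \<le> m" for j
      by (rule nD[OF that]) (use Ba ra \<open>int k < B - snd (Y a)\<close> in auto)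
  qed
  have down: "ray (Y b) (0,-1) k \<notin> Z ` {..n + m}" for k
  proof (rule offZ)
    show "ray (Y b) (0,-1) k \<noteq> Y i" if "i \<le> u" for i
      using b(3)[OF that] by (auto dest!: arg_cong[of _ _ snd])
    show "ray (Y b) (0,-1) k \<noteq> D j" if "j \<le> m" for j
      by (rule nD[OF that]) (use Bb rb rB in auto)
  qed
  have ab_eq: "wn Z (n + m) (Y a) = wn Z (n + m) (Y b)"
  proof (cases "a \<le> b")
    case True
    show ?thesis by (rule wn_walk[OF c1 c2, symmetric, of a b Y]) (use True Ynew a b ipath_step[OF Y] in auto)
  next
    case False
    show ?thesis by (rule wn_walk[OF c1 c2, of b a Y]) (use False Ynew a b ipath_step[OF Y] in auto)
  qed
  have b0: "wn Z (n + m) (Y b) = 0"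
  proof -
    \<comment> \<open>\<open>wn_escape\<close> speaks of index 1 of the walk, so the ray going south
      starts one step above \<open>Y b\<close>.\<close>
    have "ray (Y b + (0,1)) (0,-1) k = ray (Y b) (0,-1) (k - 1)" if "1 \<le> k" for k
      using that by (simp add: prod_eq_iff)
    then have "ray (Y b + (0,1)) (0,-1) k \<notin> Z ` {..n + m}" if "1 \<le> k" for k
      using that down by simp
    from wn_escape[OF c1 c2, of "ray (Y b + (0,1)) (0,-1)", OF this] show ?thesis
      by (simp add: ray_1 infinite_range_ray add.assoc) (simp flip: zero_prod_def)
  qed
  \<comment> \<open>The index at which the top side of the box passes over \<open>Y a\<close>. That
    side runs west, so the point below it is a left neighbour and the point above it a right
    neighbour.\<close>
  define q where "q = n + (n1 + (n2 + nat (B - fst (Y a))))"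
  have q3: "nat (B - fst (Y a)) < n3" "1 \<le> nat (B - fst (Y a))" using Ba e by auto
  have q: "0 < q" "q < n + m" using q3 pos n by (auto simp: q_def m_def)
  have Zseg: "Z (n + (n1 + (n2 + k))) = (B - int k, B)" if "k \<le> n3" for k
    unfolding Z_def cat_add[of D "\<lambda>k. Y (w + k)" n, OF DYn]
    unfolding D_def cat_add[of D2345 D1 n1, OF j1]
    unfolding D2345_def cat_add[of D345 D2 n2, OF j2]
    using that by (simp add: D345_def D3_def prod_eq_iff)
  have Zq: "Z q = (fst (Y a), B)" using Zseg[of "nat (B - fst (Y a))"] q3 Ba by (simp add: q_def)
  have Zq1: "Z (q - 1) = (fst (Y a) + 1, B)"
    using Zseg[of "nat (B - fst (Y a)) - 1"] q3 Ba by (simp add: q_def)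
  have Zq2: "Z (Suc q) = (fst (Y a) - 1, B)"
    using Zseg[of "Suc (nat (B - fst (Y a)))"] q3 Ba by (simp add: q_def)
  have tns: "tn (1,0) (0,-1) = 1" "tn (1,0) (-1,0) = 2" "tn (1,0) (0,1) = 3" by (simp_all add: tn_def cw_def)
  have upl: "wn Z (n + m) (fst (Y a), B - 1) = wn Z (n + m) (Y a)"
  proof -
    define K where "K = nat (B - 1 - snd (Y a))"
    have K: "int K = B - 1 - snd (Y a)" using Ba by (simp add: K_def)
    have "wn Z (n + m) (ray (Y a) (0,1) K) = wn Z (n + m) (ray (Y a) (0,1) 0)"
      by (rule wn_walk[OF c1 c2]) (use up K in auto)
    moreover have "ray (Y a) (0,1) K = (fst (Y a), B - 1)" by (simp add: prod_eq_iff K)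
    ultimately show ?thesis by simp
  qed
  have left: "wn Z (n + m) (fst (Y a), B - 1) = lside Z (n + m) 0"
  proof (rule left_nbr[OF Z q])
    have "(fst (Y a), B - 1) = ray (Y a) (0,1) (nat (B - 1 - snd (Y a)))" using Ba by (simp add: prod_eq_iff)
    then show "(fst (Y a), B - 1) \<notin> Z ` {..n + m}" using up[of "nat (B - 1 - snd (Y a))"] Ba by simp
  qed (simp_all add: Zq Zq1[unfolded One_nat_def] Zq2 tns)
  have above: "ray (fst (Y a), B) (0,1) k \<notin> Z ` {..n + m}" if k: "1 \<le> k" for k
  proof (rule offZ)
    show "ray (fst (Y a), B) (0,1) k \<noteq> Y i" if "i \<le> u" for i
      using B(4)[of i] that uv k by (auto dest!: arg_cong[of _ _ snd])
    show "ray (fst (Y a), B) (0,1) k \<noteq> D j" if "j \<le> m" for j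
      using Dbox[OF that] k by (auto dest!: arg_cong[of _ _ snd])
  qed
  have "wn Z (n + m) (fst (Y a), B + 1) = lside Z (n + m) 0 - 1"
  proof (rule right_nbr[OF Z q])
    show "(fst (Y a), B + 1) \<notin> Z ` {..n + m}" using above[of 1] by (simp add: ray_1)
  qed (simp_all add: Zq Zq1[unfolded One_nat_def] Zq2 tns)
  moreover have "wn Z (n + m) (fst (Y a), B + 1) = 0"
    using wn_escape[OF c1 c2, of "ray (fst (Y a), B) (0,1)"] above by (simp add: ray_1 infinite_range_ray)
  ultimately show False using left upl ab_eq b0 by simp
qed

section \<open>Confluent transition systems on the grid\<close>

text \<open>An abstract growing path with positions \<open>P\<close> and states \<open>s\<close>.
  Keeping the displacement as an argument of \<open>stp\<close> lets the symmetries of the grid act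
  on the relation alone.\<close>

definition run :: "('q \<Rightarrow> pos \<Rightarrow> 'q \<Rightarrow> bool) \<Rightarrow> 'q \<Rightarrow> (nat \<Rightarrow> pos) \<Rightarrow> (nat \<Rightarrow> 'q) \<Rightarrow> nat \<Rightarrow> bool" where
  "run stp q0 P s n \<longleftrightarrow> P 0 = (0,0) \<and> s 0 = q0 \<and> inj_on P {..n} \<and>
     (\<forall>k<n. stp (s k) (P (Suc k) - P k) (s (Suc k)))"

definition irun :: "('q \<Rightarrow> pos \<Rightarrow> 'q \<Rightarrow> bool) \<Rightarrow> 'q \<Rightarrow> (nat \<Rightarrow> pos) \<Rightarrow> (nat \<Rightarrow> 'q) \<Rightarrow> bool" where
  "irun stp q0 P s \<longleftrightarrow> (\<forall>n. run stp q0 P s n)"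

text \<open>States repeat exactly and positions up to a translation. Non-consecutive points may
  still bind; these chords are removed only after the return to tiles.\<close>

definition up_run :: "('q \<Rightarrow> pos \<Rightarrow> 'q \<Rightarrow> bool) \<Rightarrow> 'q \<Rightarrow> bool" where
  "up_run stp q0 \<longleftrightarrow> (\<exists>P s i j. irun stp q0 P s \<and> i < j \<and>
     (\<forall>k. P (j + k) - P j = P (i + k) - P i \<and> s (j + k) = s (i + k)))"

lemma inj_on_shift:
  assumes "inj_on R {..m}" "a + n \<le> m"
  shows "inj_on (\<lambda>k. R (a + k)) {..n :: nat}"
proof (rule inj_onI)
  fix x y assume "x \<in> {..n}" "y \<in> {..n}" "R (a + x) = R (a + y)"
  then have "a + x = a + y" using inj_onD[OF assms(1), of "a + x" "a + y"] assms(2) by auto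
  then show "x = y" by simp
qed

lemma finite_units: "finite {v. unit v}"
  by (simp add: unit_def)

lemma run_prefix: "run stp q0 P s n \<Longrightarrow> k \<le> n \<Longrightarrow> run stp q0 P s k"
  by (auto simp: run_def inj_on_def)

locale tsys =
  fixes stp :: "'q \<Rightarrow> pos \<Rightarrow> 'q \<Rightarrow> bool" and q0 :: 'q and Q :: "'q set"
  assumes finQ: "finite Q" and q0Q: "q0 \<in> Q"
    and stp_unit: "stp q v q' \<Longrightarrow> unit v"
    and stp_Q: "stp q v q' \<Longrightarrow> q \<in> Q \<and> q' \<in> Q"
    and conf: "run stp q0 P s n \<Longrightarrow> run stp q0 P' s' n' \<Longrightarrow> P n = P' n' \<Longrightarrow> s n = s' n'"
begin

text \<open>By \<open>conf\<close> the state does not depend on the run chosen; at positions that no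
  run reaches the value is arbitrary.\<close>

definition lab :: "pos \<Rightarrow> 'q" where
  "lab u = (SOME q. \<exists>P s n. run stp q0 P s n \<and> P n = u \<and> s n = q)"

lemma run_lab:
  assumes "run stp q0 P s n" "k \<le> n"
  shows "s k = lab (P k)"
proof -
  note r = run_prefix[OF assms]
  have "\<exists>P' s' n'. run stp q0 P' s' n' \<and> P' n' = P k \<and> s' n' = lab (P k)"
    unfolding lab_def by (rule someI_ex) (use r in blast)
  then show ?thesis using conf[OF r] by metis
qed

lemma irun_lab: "irun stp q0 P s \<Longrightarrow> s k = lab (P k)"
  using run_lab[of P s k k] by (simp add: irun_def)

lemma irun_ipath: "irun stp q0 P s \<Longrightarrow> ipath P"
  by (auto simp: irun_def run_def ipath_def inj_on_def intro!: injI intro: stp_unit)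
    (metis atMost_iff nat_le_linear, meson lessI stp_unit)

lemma lab_0: "lab (0,0) = q0"
  using run_lab[of "\<lambda>_. (0,0)" "\<lambda>_. q0" 0 0] by (auto simp: run_def)

text \<open>Competitors: they share the prefix of \<open>P0\<close> up to \<open>e0\<close>, avoid the east ray at \<open>P0 e\<close>, obey the
  system inside the region \<open>F\<close> and go straight north once outside of it.\<close>
definition mem :: "(nat \<Rightarrow> pos) \<Rightarrow> nat \<Rightarrow> nat \<Rightarrow> (pos \<Rightarrow> bool) \<Rightarrow> (nat \<Rightarrow> pos) \<Rightarrow> bool" where
  "mem P0 e0 e F Y \<longleftrightarrow> Y 0 = (0,0) \<and> (\<forall>k\<le>e0. Y k = P0 k) \<and> inj Y
     \<and> (\<forall>k t. 1 \<le> t \<longrightarrow> Y k \<noteq> ray (P0 e) (1,0) t)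
     \<and> (\<forall>k. F (Y k) \<longrightarrow> stp (lab (Y k)) (Y (Suc k) - Y k) (lab (Y (Suc k))))
     \<and> (\<forall>k. \<not> F (Y k) \<longrightarrow> Y (Suc k) = Y k + (0,1))"

abbreviation "tt Y b \<equiv> tn (Y (b - 1) - Y b) (Y (Suc b) - Y b)"

text \<open>Turns are compared only at an index up to which the competitor agrees with
  \<open>Y\<close>. All competitors share the prefix up to \<open>e0\<close>, hence the restriction
  to \<open>b \<ge> e0\<close>.\<close>

definition leftmost :: "(nat \<Rightarrow> pos) \<Rightarrow> nat \<Rightarrow> nat \<Rightarrow> (pos \<Rightarrow> bool) \<Rightarrow> (nat \<Rightarrow> pos) \<Rightarrow> bool" where
  "leftmost P0 e0 e F Y \<longleftrightarrow> mem P0 e0 e F Y \<and>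
     (\<forall>Y' b. mem P0 e0 e F Y' \<longrightarrow> e0 \<le> b \<longrightarrow> (\<forall>k\<le>b. Y' k = Y k) \<longrightarrow> tt Y b \<le> tt Y' b)"

lemma mem_ipath: "mem P0 e0 e F Y \<Longrightarrow> ipath Y"
  unfolding mem_def ipath_def
  by (metis add_diff_cancel_left' stp_unit unit_simps(2))

text \<open>Every instance of a clause of \<open>mem\<close> looks at finitely many positions, so
  the family is closed under pointwise limits.\<close>

lemma mem_closed:
  assumes "\<And>n. \<exists>Y. mem P0 e0 e F Y \<and> (\<forall>k\<le>n. Y k = X k)"
  shows "mem P0 e0 e F X"
proof -
  have *: "\<exists>Y. mem P0 e0 e F Y \<and> Y i = X i \<and> Y j = X j \<and> Y (Suc i) = X (Suc i)" for i j
    using assms[of "i + j + 1"] by auto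
  show ?thesis unfolding mem_def
  proof (intro conjI allI impI)
    show "X 0 = (0,0)" using *[of 0 0] by (metis mem_def)
    show "X k = P0 k" if "k \<le> e0" for k using *[of k k] that by (metis mem_def)
    show "inj X" by (rule injI) (metis * mem_def injD)
    show "X k \<noteq> ray (P0 e) (1,0) t" if "1 \<le> t" for k t using *[of k k] that by (metis mem_def)
    show "stp (lab (X k)) (X (Suc k) - X k) (lab (X (Suc k)))" if "F (X k)" for k
      using *[of k k] that by (metis mem_def)
    show "X (Suc k) = X k + (0,1)" if "\<not> F (X k)" for k using *[of k k] that by (metis mem_def)
  qed
qed

text \<open>The turns are minimised one after the other: \<open>f (Suc n)\<close> agrees with
  \<open>f n\<close> up to index \<open>e0 + n\<close> and takes the leftmost turn possible there.
  The diagonal \<open>X\<close> agrees with \<open>f n\<close> up to that index and is a member by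
  \<open>mem_closed\<close>.\<close>

lemma leftmost_exists:
  assumes "mem P0 e0 e F Y0"
  shows "\<exists>Y. leftmost P0 e0 e F Y"
proof -
  define M where "M = mem P0 e0 e F"
  define next_ok where "next_ok n Y Y' \<longleftrightarrow> M Y' \<and> (\<forall>k\<le>e0 + n. Y' k = Y k) \<and>
     (\<forall>Z. M Z \<longrightarrow> (\<forall>k\<le>e0 + n. Z k = Y k) \<longrightarrow> tt Y' (e0 + n) \<le> tt Z (e0 + n))" for n Y Y'
  have ex: "\<exists>Y'. next_ok n Y Y'" if "M Y" for n Y
  proof -
    have "\<exists>Y'. (M Y' \<and> (\<forall>k\<le>e0 + n. Y' k = Y k)) \<and>
       (\<forall>Z. (M Z \<and> (\<forall>k\<le>e0 + n. Z k = Y k)) \<longrightarrow> tt Y' (e0 + n) \<le> tt Z (e0 + n))"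
      by (rule ex_has_least_nat[of "\<lambda>Z. M Z \<and> (\<forall>k\<le>e0 + n. Z k = Y k)" Y "\<lambda>Z. tt Z (e0 + n)"]) (use that in auto)
    then show ?thesis unfolding next_ok_def by blast
  qed
  define f where "f = rec_nat Y0 (\<lambda>n Y. SOME Y'. next_ok n Y Y')"
  have f0: "f 0 = Y0" and fS: "f (Suc n) = (SOME Y'. next_ok n (f n) Y')" for n
    by (simp_all add: f_def)
  have Mf: "M (f n)" and ok: "next_ok n (f n) (f (Suc n))" for n
  proof -
    have step: "M (f n) \<Longrightarrow> next_ok n (f n) (f (Suc n))" for n
      using someI_ex[OF ex[of "f n" n]] by (simp add: fS)
    show "M (f n)" by (induction n) (use assms step in \<open>auto simp: f0 M_def next_ok_def\<close>)
    then show "next_ok n (f n) (f (Suc n))" by (rule step)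
  qed
  have agree: "f m k = f n k" if "n \<le> m" "k \<le> e0 + n" for m n k
    using that(1)
  proof (induction m rule: dec_induct)
    case (step m)
    then show ?case using ok[of m] that unfolding next_ok_def by auto
  qed simp
  define X where "X k = f k k" for k
  have X: "X k = f n k" if "k \<le> e0 + n" for k n
    using agree[of k n k] agree[of n k k] that by (cases "k \<le> n") (auto simp: X_def)
  have "mem P0 e0 e F X"
    by (rule mem_closed) (metis Mf M_def X add.commute trans_le_add1)
  moreover have "tt X b \<le> tt Z b" if Z: "mem P0 e0 e F Z" "e0 \<le> b" "\<forall>k\<le>b. Z k = X k" for Z b
  proof -
    obtain n where b: "b = e0 + n" using Z(2) le_Suc_ex by blast
    have "tt X b = tt (f (Suc n)) b" using X[of "b - 1" "Suc n"] X[of b "Suc n"] X[of "Suc b" "Suc n"] b by simp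
    moreover have "\<forall>k\<le>e0 + n. Z k = f n k" using Z(3) X b by simp
    then have "tt (f (Suc n)) b \<le> tt Z b"
      using ok[of n] Z(1) unfolding next_ok_def M_def b by blast
    ultimately show ?thesis by simp
  qed
  ultimately show ?thesis unfolding leftmost_def by blast
qed

text \<open>Competitors arise from a finite run inside \<open>F\<close> and an infinite tail, which
  is either the tail of another competitor or a straight climb outside of \<open>F\<close>.\<close>

lemma mem_splice:
  assumes R: "run stp q0 R r M" "\<And>k. k < M \<Longrightarrow> F (R k)" "\<And>k. k \<le> e0 \<Longrightarrow> R k = P0 k" "e0 \<le> M"
    and tau: "\<And>k t. k \<le> M \<Longrightarrow> 1 \<le> t \<Longrightarrow> R k \<noteq> ray (P0 e) (1,0) t" "\<And>k t. 1 \<le> t \<Longrightarrow> T k \<noteq> ray (P0 e) (1,0) t"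
    and T: "T 0 = R M" "inj T" "\<And>k i. i < M \<Longrightarrow> T k \<noteq> R i"
      "\<And>k. F (T k) \<Longrightarrow> stp (lab (T k)) (T (Suc k) - T k) (lab (T (Suc k)))"
      "\<And>k. \<not> F (T k) \<Longrightarrow> T (Suc k) = T k + (0,1)"
  shows "mem P0 e0 e F (cat R M T)"
proof -
  have lab: "r k = lab (R k)" if "k \<le> M" for k using run_lab[OF R(1) that] .
  have ge: "cat R M T k = T (k - M)" if "M \<le> k" for k using cat_ge[of T R M, OF T(1) that] .
  show ?thesis unfolding mem_def
  proof (intro conjI allI impI)
    show "cat R M T 0 = (0,0)" using R(1) by (simp add: run_def)
    show "cat R M T k = P0 k" if "k \<le> e0" for k using that R by simp
    show "inj (cat R M T)"
    proof (rule injI)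
      have *: "i = j" if "i \<le> j" "cat R M T i = cat R M T j" for i j
      proof -
        consider "j \<le> M" | "i < M" "M < j" | "M \<le> i" using that(1) by linarith
        then show ?thesis
        proof cases
          case 1 then show ?thesis using that R(1) by (auto simp: run_def inj_on_def)
        next
          case 2 then show ?thesis using that T(3)[of i "j - M"] by (auto simp: cat_def)
        next
          case 3
          then have "T (i - M) = T (j - M)" using that ge by simp
          then show ?thesis using T(2) 3 that(1) by (auto dest!: injD)
        qed
      qed
      fix i j assume "cat R M T i = cat R M T j"
      then show "i = j" using *[of i j] *[of j i] by (metis nat_le_linear)
    qed
    show "cat R M T k \<noteq> ray (P0 e) (1,0) t" if "1 \<le> t" for k t
      using tau that by (cases "k \<le> M") (auto simp: cat_def)
    show "stp (lab (cat R M T k)) (cat R M T (Suc k) - cat R M T k) (lab (cat R M T (Suc k)))"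
      if "F (cat R M T k)" for k
    proof (cases "k < M")
      case True
      then have "stp (r k) (R (Suc k) - R k) (r (Suc k))" using R(1) by (simp add: run_def)
      then show ?thesis using True by (simp add: lab[symmetric])
    next
      case False
      then show ?thesis using T(4)[of "k - M"] that ge[of k] ge[of "Suc k"] by (simp add: Suc_diff_le)
    qed
    show "cat R M T (Suc k) = cat R M T k + (0,1)" if "\<not> F (cat R M T k)" for k
    proof (cases "k < M")
      case True then show ?thesis using R(2) that by simp
    next
      case False
      then show ?thesis using T(5)[of "k - M"] that ge[of k] ge[of "Suc k"] by (simp add: Suc_diff_le)
    qed
  qed
qed

end

text \<open>\<open>F\<close> will be the whole plane or the half plane below a row.
  \<open>F_up\<close> makes leaving \<open>F\<close> final, and \<open>F_tau\<close> keeps the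
  climbing tails off the forbidden ray.\<close>

locale leftmost_path = tsys +
  fixes P0 :: "nat \<Rightarrow> pos" and e0 e :: nat and F :: "pos \<Rightarrow> bool" and Y :: "nat \<Rightarrow> pos"
  assumes lm: "leftmost P0 e0 e F Y"
    and e_less: "e < e0"
    and F_up: "\<not> F u \<Longrightarrow> \<not> F (u + (0,1))"
    and F_tau: "1 \<le> t \<Longrightarrow> F (ray (P0 e) (1,0) t)"
begin

lemma memY: "mem P0 e0 e F Y"
  using lm by (simp add: leftmost_def)

lemma Yip: "ipath Y"
  by (rule mem_ipath[OF memY])

lemma Ye: "P0 e = Y e"
  using memY e_less by (simp add: mem_def)

lemma Y_tau: "1 \<le> t \<Longrightarrow> Y k \<noteq> ray (Y e) (1,0) t"
  using memY by (simp add: mem_def Ye)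

lemma Y_stp: "F (Y k) \<Longrightarrow> stp (lab (Y k)) (Y (Suc k) - Y k) (lab (Y (Suc k)))"
  using memY by (simp add: mem_def)

lemma Y_out: "\<not> F (Y k) \<Longrightarrow> Y (Suc k) = Y k + (0,1)"
  using memY by (simp add: mem_def)

lemma F_before: "F (Y b) \<Longrightarrow> k \<le> b \<Longrightarrow> F (Y k)"
proof (rule ccontr)
  assume "F (Y b)" "k \<le> b" "\<not> F (Y k)"
  have "\<not> F (Y b)" using \<open>k \<le> b\<close>
    by (induction b rule: dec_induct) (use \<open>\<not> F (Y k)\<close> Y_out F_up in auto)
  then show False using \<open>F (Y b)\<close> by simp
qed

lemma F_ray_up: "\<not> F u \<Longrightarrow> \<not> F (ray u (0,1) k)"
proof (induction k)
  case (Suc k)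
  moreover have "ray u (0,1) (Suc k) = ray u (0,1) k + (0,1)" by (simp add: prod_eq_iff)
  ultimately show ?case using F_up[of "ray u (0,1) k"] by simp
qed simp

lemma no_left_mem:
  assumes "mem P0 e0 e F X" "e0 \<le> b" "\<And>k. k \<le> b \<Longrightarrow> X k = Y k" "tt X b < tt Y b"
  shows False
  using lm assms unfolding leftmost_def by (meson not_less)

lemma tn_self: "unit a \<Longrightarrow> tn a a = 3"
  by (auto simp: unit_def tn_def cw_def)

text \<open>A path \<open>R\<close> that leaves the leftmost path \<open>Y\<close> to the left stays free of everything: otherwise the
  first obstacle it meets closes a Jordan curve through \<open>L\<close>, or gives a competitor to the left of \<open>Y\<close>.\<close>
lemma growth_free:
  assumes j: "e0 \<le> j" "j \<le> b" and b: "b \<le> M"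
    and Rb: "\<And>k. k \<le> b \<Longrightarrow> R k = Y k" and left: "tt R b < tt Y b" and Fb: "F (Y b)"
    and r0: "r 0 = q0" and r: "\<And>k. k < M \<Longrightarrow> F (R k) \<Longrightarrow> stp (r k) (R (Suc k) - R k) (r (Suc k))"
    and injR: "inj_on R {j..M}"
    and L: "L 0 = Y j" "\<And>k. unit (L (Suc k) - L k)" "infinite (range L)" "\<And>k i. 1 \<le> k \<Longrightarrow> L k \<noteq> Y i"
      "\<And>k i. 1 \<le> k \<Longrightarrow> b < i \<Longrightarrow> i \<le> M \<Longrightarrow> R i \<noteq> L k"
    and Lleft: "tn (Y (j - 1) - Y j) (L 1 - Y j) < tn (Y (j - 1) - Y j) (R (Suc j) - Y j)"
    and Ltau: "\<And>k t t'. 1 \<le> k \<Longrightarrow> 1 \<le> t \<Longrightarrow> L k = ray (Y e) (1,0) t \<Longrightarrow> t \<le> t' \<Longrightarrow> \<exists>k'\<ge>1. L k' = ray (Y e) (1,0) t'"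
  shows "inj_on R {..M} \<and> (\<forall>k\<le>M. F (R k)) \<and> (\<forall>k\<le>M. \<forall>t\<ge>1. R k \<noteq> ray (Y e) (1,0) t)
     \<and> (\<forall>k q. b < k \<longrightarrow> k \<le> M \<longrightarrow> b < q \<longrightarrow> R k \<noteq> Y q)"
  using b injR r L(5)
proof (induction M rule: dec_induct)
  case base
  show ?case using Rb F_before[OF Fb] Y_tau by (auto simp: inj_on_def ipath_inj[OF Yip])
next
  case (step M)
  have bM: "b \<le> M" by fact
  have "inj_on R {..M} \<and> (\<forall>k\<le>M. F (R k)) \<and> (\<forall>k\<le>M. \<forall>t\<ge>1. R k \<noteq> ray (Y e) (1,0) t)
     \<and> (\<forall>k q. b < k \<longrightarrow> k \<le> M \<longrightarrow> b < q \<longrightarrow> R k \<noteq> Y q)"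
    by (rule step.IH) (use step.prems in \<open>auto intro: inj_on_subset\<close>)
  then have inj: "inj_on R {..M}" and FR: "\<And>k. k \<le> M \<Longrightarrow> F (R k)"
    and tau: "\<And>k t. k \<le> M \<Longrightarrow> 1 \<le> t \<Longrightarrow> R k \<noteq> ray (Y e) (1,0) t"
    and off: "\<And>k q. b < k \<Longrightarrow> k \<le> M \<Longrightarrow> b < q \<Longrightarrow> R k \<noteq> Y q" by auto
  have stR: "stp (r k) (R (Suc k) - R k) (r (Suc k))" if "k \<le> M" for k
    using step.prems(2)[of k] FR[OF that] that by simp
  have unR: "unit (R (Suc k) - R k)" if "k \<le> M" for k using stp_unit[OF stR[OF that]] .
  have j0: "0 < j" "e < j" using j e_less by auto
  have offL: "L k \<noteq> R i" if "1 \<le> k" "i \<le> Suc M" for k i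
    using Rb[of i] L(4)[OF that(1)] step.prems(3)[of k i] that by (metis not_le)
  have offY: "Y (b + k) \<noteq> R i" if "1 \<le> k" "i \<le> M" for k i
    using Rb[of i] off[of i "b + k"] that by (cases "i \<le> b") (auto simp: ipath_inj[OF Yip])
  have offL': "L k \<notin> R ` {..Suc M}" if "1 \<le> k" for k using offL[OF that] by blast
  have offY': "Y (b + k) \<notin> R ` {..M}" if "1 \<le> k" for k using offY[OF that] by blast
  have tailY: "infinite (range (\<lambda>k. Y (b + k)))" "\<And>k. unit (Y (b + Suc k) - Y (b + k))"
    using ipath_tail_infinite[OF Yip] ipath_step[OF Yip] by auto
  \<comment> \<open>A step straight back has turn value 3, the largest one, so a turn to the left of
    \<open>Y\<close> is not a step back.\<close>
  have nb: "R (Suc b) \<noteq> Y (b - 1)"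
    using left tn_self[OF ipath_back[OF Yip, of b]] tn_le(1)[of "Y (b - 1) - Y b" "Y (Suc b) - Y b"] Rb[of b] Rb[of "b - 1"] j j0
    by auto
  \<comment> \<open>By \<open>injR\<close> only a point before \<open>j\<close> can be hit. This
    closes a cycle through \<open>Y j\<close> and \<open>Y b\<close> that \<open>L\<close> leaves on
    the left at \<open>Y j\<close> and the rest of \<open>Y\<close> on the right at
    \<open>Y b\<close>.\<close>
  have fresh: "R (Suc M) \<noteq> R i" if i: "i \<le> M" for i
  proof
    assume eq: "R (Suc M) = R i"
    have ij: "i < j"
    proof (rule ccontr)
      assume "\<not> i < j"
      then have "Suc M = i" using step.prems(1) eq i j bM by (auto simp: inj_on_def)
      then show False using i by simp
    qed
    define n where "n = Suc M - i"
    define Z where "Z k = R (i + k)" for k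
    have n2: "2 \<le> n" using ij j bM by (simp add: n_def)
    have "n \<noteq> 2"
    proof
      assume "n = 2"
      then have "i = b - 1" "M = b" using ij j bM by (auto simp: n_def)
      then show False using eq nb Rb[of "b - 1"] by simp
    qed
    then have n3: "3 \<le> n" using n2 by simp
    have Zc: "simple_cycle Z n"
      unfolding simple_cycle_def
    proof (intro conjI allI impI)
      show "Z n = Z 0" using eq i by (simp add: Z_def n_def)
      show "inj_on Z {..<n}"
      proof (rule inj_onI)
        fix x y assume "x \<in> {..<n}" "y \<in> {..<n}" "Z x = Z y"
        then have "i + x = i + y" using inj_onD[OF inj, of "i + x" "i + y"] by (simp add: Z_def n_def)
        then show "x = y" by simp
      qed
      show "unit (Z (Suc k) - Z k)" if "k < n" for k using unR[of "i + k"] that by (simp add: Z_def n_def)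
    qed (rule n3)
    have idx: "0 < j - i" "j - i < n" "0 < b - i" "b - i < n" using ij j bM by (auto simp: n_def)
    have Zj: "Z (j - i - 1) = Y (j - 1)" "Z (j - i) = Y j" "Z (Suc (j - i)) = R (Suc j)"
      using ij j Rb[of "j - 1"] Rb[of j] by (auto simp: Z_def)
    have Zb: "Z (b - i - 1) = Y (b - 1)" "Z (b - i) = Y b" "Z (Suc (b - i)) = R (Suc b)"
      using ij j Rb[of "b - 1"] Rb[of b] by (auto simp: Z_def)
    have right: "tn (Y (b - 1) - Y b) (R (Suc b) - Y b) < tn (Y (b - 1) - Y b) (Y (Suc b) - Y b)"
      using left Rb[of b] Rb[of "b - 1"] by simp
    show False
    proof (rule two_sided_escape[OF Zc idx, of L "\<lambda>k. Y (b + k)"])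
      have sub: "Z ` {..<n} \<subseteq> R ` {..M}" by (auto simp: Z_def n_def)
      then show "L k \<notin> Z ` {..<n}" if "1 \<le> k" for k using offL'[OF that] by fastforce
      show "Y (b + k) \<notin> Z ` {..<n}" if "1 \<le> k" for k using offY'[OF that] sub by blast
    qed (use L Lleft tailY right in \<open>simp_all only: Zj Zb\<close>, simp_all)
  qed
  have inj': "inj_on R {..Suc M}"
    using inj fresh by (auto simp: atMost_Suc)
  \<comment> \<open>A hit of the forbidden ray closes a cycle with the segment of the ray back to
    \<open>Y e\<close>. If \<open>L\<close> met this segment, it would by \<open>Ltau\<close> also
    contain \<open>R (Suc M)\<close>.\<close>
  have tau': "R (Suc M) \<noteq> ray (Y e) (1,0) t" if t: "1 \<le> t" for t
  proof
    assume eq: "R (Suc M) = ray (Y e) (1,0) t"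
    define n where "n = Suc M - e"
    define Z1 where "Z1 = (\<lambda>k. R (e + k))"
    define D where "D = ray (R (Suc M)) (-1,0)"
    define Z where "Z = cat Z1 n D"
    have en: "e + n = Suc M" using j0 j bM by (simp add: n_def)
    have D: "D i = ray (Y e) (1,0) (t - i)" if "i \<le> t" for i
      using that by (auto simp: D_def eq prod_eq_iff of_nat_diff)
    have D0: "D 0 = Z1 n" by (simp add: D_def Z1_def en)
    have Zc: "simple_cycle Z (n + t)" unfolding Z_def
    proof (rule cycle_cat)
      show "arc Z1 n" using inj_on_shift[OF inj', of e n] unR en by (simp add: arc_def Z1_def)
      show "arc D t" by (simp add: D_def arc_ray)
      show "D 0 = Z1 n" by (rule D0)
      show "D t = Z1 0" using D[of t] Rb[of e] j0 j by (simp add: Z1_def)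
      show "3 \<le> n + t" using t j0 j bM by (simp add: n_def)
      show "1 \<le> t" by (rule t)
      show "Z1 i \<noteq> D k" if "i \<le> n" "1 \<le> k" "k < t" for i k
      proof (cases "e + i \<le> M")
        case True then show ?thesis using tau[of "e + i" "t - k"] D[of k] that by (auto simp: Z1_def)
      next
        case False
        then have "e + i = Suc M" using that en by simp
        then show ?thesis using eq D[of k] that by (auto simp: Z1_def ray_inj)
      qed
    qed
    have im: "Z ` {..n + t} = Z1 ` {..n} \<union> D ` {..t}"
      unfolding Z_def by (rule image_cat) (rule D0)
    have Dpts: "D i = Y e \<or> (\<exists>s. 1 \<le> s \<and> s \<le> t \<and> D i = ray (Y e) (1,0) s)" if "i \<le> t" for i
    proof (cases "i = t")
      case False
      then have "1 \<le> t - i" "t - i \<le> t" using that by auto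
      then show ?thesis using D[OF that] by blast
    qed (use D[OF that] in simp)
    have idx: "0 < j - e" "j - e < n + t" "0 < b - e" "b - e < n + t" using j0 j bM by (auto simp: n_def)
    have Zj: "Z (j - e - 1) = Y (j - 1)" "Z (j - e) = Y j" "Z (Suc (j - e)) = R (Suc j)"
      using j0 j bM Rb[of "j - 1"] Rb[of j] by (auto simp: Z_def Z1_def n_def)
    have Zb: "Z (b - e - 1) = Y (b - 1)" "Z (b - e) = Y b" "Z (Suc (b - e)) = R (Suc b)"
      using j0 j bM Rb[of "b - 1"] Rb[of b] by (auto simp: Z_def Z1_def n_def)
    have right: "tn (Y (b - 1) - Y b) (R (Suc b) - Y b) < tn (Y (b - 1) - Y b) (Y (Suc b) - Y b)"
      using left Rb[of b] Rb[of "b - 1"] by simp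
    show False
    proof (rule two_sided_escape[OF Zc idx, of L "\<lambda>k. Y (b + k)"])
      have sub: "Z1 ` {..n} \<subseteq> R ` {..Suc M}" using en by (auto simp: Z1_def)
      have "L k \<notin> D ` {..t}" if k: "1 \<le> k" for k
      proof
        assume "L k \<in> D ` {..t}"
        then obtain i where i: "i \<le> t" "L k = D i" by auto
        from Dpts[OF i(1)] consider "L k = Y e" | s where "1 \<le> s" "s \<le> t" "L k = ray (Y e) (1,0) s"
          unfolding i(2)[symmetric] by (elim disjE exE conjE)
        then show False
        proof cases
          case 1 then show False using L(4)[OF k, of e] by contradiction
        next
          case 2
          then obtain k' where "1 \<le> k'" "L k' = ray (Y e) (1,0) t" using Ltau[OF k] by blast
          then show False using offL[of k' "Suc M"] eq by simp
        qed
      qed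
      then have "L k \<notin> Z ` {..n + t}" if "1 \<le> k" for k
        unfolding im using that offL'[OF that] sub by blast
      then show "L k \<notin> Z ` {..<n + t}" if "1 \<le> k" for k using that by force
      have "Y (b + k) \<notin> D ` {..t}" if k: "1 \<le> k" for k
      proof
        assume "Y (b + k) \<in> D ` {..t}"
        then obtain i where i: "i \<le> t" "Y (b + k) = D i" by auto
        from Dpts[OF i(1)] consider "Y (b + k) = Y e" | s where "1 \<le> s" "Y (b + k) = ray (Y e) (1,0) s"
          unfolding i(2)[symmetric] by (elim disjE exE conjE)
        then show False
        proof cases
          case 1 then show False using k j0 j by (simp add: ipath_inj[OF Yip])
        next
          case 2 then show False using Y_tau by blast
        qed
      qed
      moreover have "Y (b + k) \<notin> R ` {..Suc M}" if "1 \<le> k" for k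
      proof -
        have "Y (b + k) \<noteq> R i" if "i \<le> Suc M" for i
          using offY[OF \<open>1 \<le> k\<close>, of i] that eq Y_tau[OF t] by (cases "i = Suc M") auto
        then show ?thesis by blast
      qed
      ultimately have "Y (b + k) \<notin> Z ` {..n + t}" if "1 \<le> k" for k
        unfolding im using that sub by blast
      then show "Y (b + k) \<notin> Z ` {..<n + t}" if "1 \<le> k" for k using that by force
    qed (use L Lleft tailY right in \<open>simp_all only: Zj Zb\<close>, simp_all)
  qed
  have R0: "R 0 = (0,0)" using Rb[of 0] memY by (simp add: mem_def)
  have runR: "run stp q0 R r (Suc M)"
    unfolding run_def using R0 r0 inj' stR by auto
  have tauall: "R k \<noteq> ray (P0 e) (1,0) t" if "k \<le> Suc M" "1 \<le> t" for k t
    using that tau[of k t] tau'[OF that(2)] by (cases "k = Suc M") (auto simp: Ye)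
  have pre: "R k = P0 k" if "k \<le> e0" for k
    using that Rb[of k] j memY by (simp add: mem_def)
  \<comment> \<open>Any admissible tail attached to \<open>R\<close> at \<open>Suc M\<close> gives a
    competitor that turns left of \<open>Y\<close> at \<open>b\<close>. This excludes both leaving
    \<open>F\<close>, where the tail climbs, and returning to \<open>Y\<close>, where the tail is
    that of \<open>Y\<close>.\<close>
  have splice: False if "T 0 = R (Suc M)" "inj T" "\<And>k i. i \<le> M \<Longrightarrow> T k \<noteq> R i"
      "\<And>k. F (T k) \<Longrightarrow> stp (lab (T k)) (T (Suc k) - T k) (lab (T (Suc k)))"
      "\<And>k. \<not> F (T k) \<Longrightarrow> T (Suc k) = T k + (0,1)"
      "\<And>k t. 1 \<le> t \<Longrightarrow> T k \<noteq> ray (P0 e) (1,0) t" for T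
  proof (rule no_left_mem[of "cat R (Suc M) T" b])
    show "mem P0 e0 e F (cat R (Suc M) T)"
      by (rule mem_splice[OF runR]) (use that FR pre tauall j bM in auto)
  qed (use j bM Rb left in auto)
  have FM: "F (R (Suc M))"
  proof (rule ccontr)
    assume nF: "\<not> F (R (Suc M))"
    note up = F_ray_up[OF nF]
    show False
    proof (rule splice[of "ray (R (Suc M)) (0,1)"])
      show "inj (ray (R (Suc M)) (0,1))" by (auto simp: inj_on_def ray_inj)
      show "ray (R (Suc M)) (0,1) k \<noteq> R i" if "i \<le> M" for k i using up[of k] FR[OF that] by auto
      show "ray (R (Suc M)) (0,1) k \<noteq> ray (P0 e) (1,0) t" if "1 \<le> t" for k t
        using F_tau[OF that] up[of k] by auto
      show "ray (R (Suc M)) (0,1) (Suc k) = ray (R (Suc M)) (0,1) k + (0,1)" for k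
        by (simp add: prod_eq_iff)
    qed (use up in auto)
  qed
  have "R (Suc M) \<noteq> Y q" if q: "b < q" for q
  proof
    assume eq: "R (Suc M) = Y q"
    show False
    proof (rule splice[of "\<lambda>k. Y (q + k)"])
      show "inj (\<lambda>k. Y (q + k))" by (rule injI) (simp add: ipath_inj[OF Yip])
      show "Y (q + k) \<noteq> R i" if "i \<le> M" for k i using offY[of "q + k - b" i] that q by simp
      show "Y (q + k) \<noteq> ray (P0 e) (1,0) t" if "1 \<le> t" for k t using Y_tau[OF that] by (simp add: Ye)
    qed (use eq Y_stp Y_out in auto)
  qed
  then show ?case using inj' FR FM tau tau' off by (metis le_Suc_eq)
qed

text \<open>If \<open>R\<close> stays free at every length, then \<open>R\<close> itself is a
  competitor turning left of \<open>Y\<close> at \<open>b\<close>.\<close>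

lemma growth_impossible:
  assumes j: "e0 \<le> j" "j \<le> b"
    and Rb: "\<And>k. k \<le> b \<Longrightarrow> R k = Y k" and left: "tt R b < tt Y b" and Fb: "F (Y b)"
    and r0: "r 0 = q0" and r: "\<And>k. F (R k) \<Longrightarrow> stp (r k) (R (Suc k) - R k) (r (Suc k))"
    and injR: "inj_on R {j..}"
    and L: "L 0 = Y j" "\<And>k. unit (L (Suc k) - L k)" "infinite (range L)" "\<And>k i. 1 \<le> k \<Longrightarrow> L k \<noteq> Y i"
      "\<And>k i. 1 \<le> k \<Longrightarrow> b < i \<Longrightarrow> R i \<noteq> L k"
    and Lleft: "tn (Y (j - 1) - Y j) (L 1 - Y j) < tn (Y (j - 1) - Y j) (R (Suc j) - Y j)"
    and Ltau: "\<And>k t t'. 1 \<le> k \<Longrightarrow> 1 \<le> t \<Longrightarrow> L k = ray (Y e) (1,0) t \<Longrightarrow> t \<le> t' \<Longrightarrow> \<exists>k'\<ge>1. L k' = ray (Y e) (1,0) t'"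
  shows False
proof -
  have all: "inj_on R {..M} \<and> (\<forall>k\<le>M. F (R k)) \<and> (\<forall>k\<le>M. \<forall>t\<ge>1. R k \<noteq> ray (Y e) (1,0) t)" if bM: "b \<le> M" for M
  proof -
    have "inj_on R {j..M}" by (rule inj_on_subset[OF injR]) auto
    have "inj_on R {..M} \<and> (\<forall>k\<le>M. F (R k)) \<and> (\<forall>k\<le>M. \<forall>t\<ge>1. R k \<noteq> ray (Y e) (1,0) t)
       \<and> (\<forall>k q. b < k \<longrightarrow> k \<le> M \<longrightarrow> b < q \<longrightarrow> R k \<noteq> Y q)"
    proof (rule growth_free[where r = r and L = L])
      show "inj_on R {j..M}" by fact
      show "stp (r k) (R (Suc k) - R k) (r (Suc k))" if "F (R k)" for k by (rule r[OF that])
      show "R i \<noteq> L k" if "1 \<le> k" "b < i" for k i by (rule L(5)[OF that])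
      show "\<exists>k'\<ge>1. L k' = ray (Y e) (1,0) t'" if "1 \<le> k" "1 \<le> t" "L k = ray (Y e) (1,0) t" "t \<le> t'" for k t t'
        by (rule Ltau[OF that])
    qed (use j bM Rb left Fb r0 L Lleft in auto)
    then show ?thesis by blast
  qed
  have FR: "F (R k)" and tau: "1 \<le> t \<Longrightarrow> R k \<noteq> ray (Y e) (1,0) t" for k t
    using all[of "max b k"] by auto
  have "inj R"
  proof (rule injI)
    fix i k assume "R i = R k"
    then show "i = k" using all[of "max b (max i k)"] by (auto simp: inj_on_def)
  qed
  have R0: "R 0 = (0,0)" using Rb[of 0] memY by (simp add: mem_def)
  have run: "run stp q0 R r n" for n
    unfolding run_def using R0 r0 r FR inj_on_subset[OF \<open>inj R\<close>] by auto
  have "r k = lab (R k)" for k using run_lab[OF run, of k k] by simp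
  then have "mem P0 e0 e F R"
    unfolding mem_def using R0 \<open>inj R\<close> tau FR r[OF FR] Rb j memY by (auto simp: mem_def Ye)
  then show False using no_left_mem[of R b] Rb left j by auto
qed

text \<open>The last clause covers a translate that merges with the forbidden ray: once on the ray
  it must contain all later points of it. This is the hypothesis \<open>Ltau\<close> of
  \<open>growth_free\<close>.\<close>

definition free_left :: "(nat \<Rightarrow> pos) \<Rightarrow> nat \<Rightarrow> bool" where
  "free_left lam x \<longleftrightarrow> e0 \<le> x \<and> (\<forall>k i. 1 \<le> k \<longrightarrow> Y x + lam k \<noteq> Y i) \<and> leftd Y x (lam 1) \<and>
     (\<forall>k t t'. 1 \<le> k \<longrightarrow> 1 \<le> t \<longrightarrow> Y x + lam k = ray (Y e) (1,0) t \<longrightarrow> t \<le> t' \<longrightarrow>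
        (\<exists>k'\<ge>1. Y x + lam k' = ray (Y e) (1,0) t'))"

definition shape :: "(nat \<Rightarrow> pos) \<Rightarrow> bool" where
  "shape lam \<longleftrightarrow> lam 0 = 0 \<and> inj lam \<and> (\<forall>k. unit (lam (Suc k) - lam k))"

section \<open>Translating the path between two points of the same type\<close>

definition same_type :: "nat \<Rightarrow> nat \<Rightarrow> bool" where
  "same_type x y \<longleftrightarrow> lab (Y x) = lab (Y y) \<and> Y (x - 1) - Y x = Y (y - 1) - Y y"

lemma step_agree:
  assumes "\<And>t. t \<le> k \<Longrightarrow> Y (y + t) - Y y = Y (x + t) - Y x" "same_type x y"
  shows "Y (y + k - 1) - Y (y + k) = Y (x + k - 1) - Y (x + k)"
proof (cases k)
  case 0 then show ?thesis using assms(2) by (simp add: same_type_def)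
next
  case (Suc n)
  have "Y (y + n) - Y (y + k) = (Y (y + n) - Y y) - (Y (y + k) - Y y)" by simp
  also have "\<dots> = (Y (x + n) - Y x) - (Y (x + k) - Y x)" using assms(1)[of n] assms(1)[of k] Suc by simp
  finally show ?thesis using Suc by simp
qed

text \<open>At the last common index the incoming directions still agree, so different next steps
  mean different turn values, and one of the two points turns further left.\<close>

lemma first_difference:
  assumes "0 < x" "0 < y" "same_type x y" "\<exists>t. Y (y + t) - Y y \<noteq> Y (x + t) - Y x"
  shows "\<exists>k. (\<forall>t\<le>k. Y (y + t) - Y y = Y (x + t) - Y x) \<and> tt Y (x + k) \<noteq> tt Y (y + k)"
proof -
  define T where "T = (LEAST t. Y (y + t) - Y y \<noteq> Y (x + t) - Y x)"
  have T: "Y (y + T) - Y y \<noteq> Y (x + T) - Y x" unfolding T_def using assms(4) by (rule LeastI_ex)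
  have lt: "Y (y + t) - Y y = Y (x + t) - Y x" if "t < T" for t
    using not_less_Least[of t "\<lambda>t. Y (y + t) - Y y \<noteq> Y (x + t) - Y x"] that by (simp add: T_def)
  have "T \<noteq> 0" using T by (metis add_0_right diff_self)
  then obtain k where k: "T = Suc k" using not0_implies_Suc by blast
  have ag: "Y (y + t) - Y y = Y (x + t) - Y x" if "t \<le> k" for t using lt k that by simp
  have bk: "Y (y + k - 1) - Y (y + k) = Y (x + k - 1) - Y (x + k)" by (rule step_agree[OF ag assms(3)])
  have "tt Y (x + k) \<noteq> tt Y (y + k)"
  proof
    assume eq: "tt Y (x + k) = tt Y (y + k)"
    have "Y (Suc (x + k)) - Y (x + k) = Y (Suc (y + k)) - Y (y + k)"
    proof (rule tn_inj[OF ipath_back[OF Yip] ipath_step[OF Yip] ipath_step[OF Yip]])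
      show "0 < x + k" using assms by simp
      show "tn (Y (x + k - 1) - Y (x + k)) (Y (Suc (x + k)) - Y (x + k)) = tn (Y (x + k - 1) - Y (x + k)) (Y (Suc (y + k)) - Y (y + k))"
        using eq by (simp only: bk)
      show "Y (Suc (x + k)) - Y (x + k) \<noteq> Y (x + k - 1) - Y (x + k)"
        using assms by (simp add: ipath_inj[OF Yip])
      show "Y (Suc (y + k)) - Y (y + k) \<noteq> Y (x + k - 1) - Y (x + k)"
      proof -
        have "Y (Suc (y + k)) - Y (y + k) \<noteq> Y (y + k - 1) - Y (y + k)" using assms by (simp add: ipath_inj[OF Yip])
        then show ?thesis unfolding bk .
      qed
    qed
    moreover have "Y (y + T) - Y y = (Y (Suc (y + k)) - Y (y + k)) + (Y (y + k) - Y y)" by (simp add: k)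
    moreover have "Y (x + T) - Y x = (Y (Suc (x + k)) - Y (x + k)) + (Y (x + k) - Y x)" by (simp add: k)
    ultimately show False using T ag[of k] by simp
  qed
  then show ?thesis using ag by blast
qed

text \<open>\<open>R\<close> follows \<open>Y\<close> up to \<open>x\<close> and then the translated
  continuation of \<open>Y\<close> after \<open>y\<close>. By \<open>FV\<close> the original step
  starts in \<open>F\<close> whenever the translated one does, so every step of \<open>R\<close> in
  \<open>F\<close> is allowed. The guard on the left is the translate of \<open>lam\<close> at
  \<open>x\<close>: \<open>R\<close> avoids it because \<open>Y\<close> avoids the translate at
  \<open>y\<close>.\<close>

lemma no_left_turn:
  assumes xy: "x \<noteq> y" and st: "same_type x y" and lam: "shape lam"
    and fx: "free_left lam x" and fy: "free_left lam y"
    and FV: "\<And>u. F u \<Longrightarrow> F (u + (Y y - Y x))"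
    and ag: "\<And>t. t \<le> k \<Longrightarrow> Y (y + t) - Y y = Y (x + t) - Y x"
    and Fb: "F (Y (x + k))"
  shows "\<not> tt Y (y + k) < tt Y (x + k)"
proof
  assume less: "tt Y (y + k) < tt Y (x + k)"
  define v where "v = Y y - Y x"
  define R where "R t = (if t \<le> x then Y t else Y (y + (t - x)) - v)" for t
  define r where "r t = (if t \<le> x then lab (Y t) else lab (Y (y + (t - x))))" for t
  have x0: "0 < x" "e0 \<le> x" using fx e_less by (auto simp: free_left_def)
  have Rx: "R (x + t) = Y (y + t) - v" for t by (cases t) (auto simp: R_def v_def)
  have Rx': "R t = Y (y + (t - x)) - v" if "x \<le> t" for t using Rx[of "t - x"] that by simp
  have rx: "r t = lab (Y (y + (t - x)))" if "x \<le> t" for t using that st by (cases "t = x") (auto simp: r_def same_type_def)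
  have Rag: "R (x + t) = Y (x + t)" if "t \<le> k" for t
  proof -
    have "Y (y + t) - v = (Y (y + t) - Y y) + Y x" by (simp add: v_def)
    then show ?thesis using ag[OF that] by (simp add: Rx)
  qed
  have Rb: "R t = Y t" if "t \<le> x + k" for t
  proof (cases "t \<le> x")
    case False then show ?thesis using Rag[of "t - x"] that by simp
  qed (simp add: R_def)
  have "R (x + k - 1) - R (x + k) = Y (y + k - 1) - Y (y + k)"
    using Rb[of "x + k - 1"] Rb[of "x + k"] step_agree[OF ag st] by simp
  moreover have "R (Suc (x + k)) - R (x + k) = Y (Suc (y + k)) - Y (y + k)"
    using Rx[of "Suc k"] Rx[of k] by simp
  ultimately have less': "tt R (x + k) < tt Y (x + k)" using less by (simp only:)
  show False
  proof (rule growth_impossible[where j = x and b = "x + k" and R = R and r = r and L = "\<lambda>t. Y x + lam t"])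
    show "e0 \<le> x" "x \<le> x + k" using x0 by auto
    show "R t = Y t" if "t \<le> x + k" for t by (rule Rb[OF that])
    show "tt R (x + k) < tt Y (x + k)" by (rule less')
    show "F (Y (x + k))" by (rule Fb)
    show "r 0 = q0" using memY lab_0 by (simp add: r_def mem_def)
    show "stp (r t) (R (Suc t) - R t) (r (Suc t))" if Ft: "F (R t)" for t
    proof (cases "t < x")
      case True then show ?thesis using Y_stp[of t] Ft by (simp add: R_def r_def)
    next
      case False
      have "F (R t + v)" using FV[OF Ft] by (simp add: v_def)
      then have "F (Y (y + (t - x)))" using False by (simp add: Rx')
      from Y_stp[OF this] show ?thesis using False by (simp add: Rx' rx Suc_diff_le)
    qed
    show "inj_on R {x..}"
    proof (rule inj_onI)
      fix i j assume "i \<in> {x..}" "j \<in> {x..}" "R i = R j"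
      then show "i = j" by (auto simp: Rx' ipath_inj[OF Yip])
    qed
    show "R i \<noteq> Y x + lam t" if "1 \<le> t" "x + k < i" for t i
    proof
      assume "R i = Y x + lam t"
      then have "Y (y + (i - x)) = Y y + lam t" using that by (simp add: Rx' v_def algebra_simps)
      then show False using fy that unfolding free_left_def by metis
    qed
    have "R (Suc x) - Y x = Y (Suc y) - Y y" using Rx[of 1] by (simp add: v_def)
    then show "tn (Y (x - 1) - Y x) (Y x + lam 1 - Y x) < tn (Y (x - 1) - Y x) (R (Suc x) - Y x)"
      using fy st by (simp add: free_left_def leftd_def same_type_def)
    show "infinite (range (\<lambda>t. Y x + lam t))"
      using lam by (intro range_inj_infinite) (auto simp: shape_def inj_on_def)
    show "Y x + lam 0 = Y x" "unit (Y x + lam (Suc t) - (Y x + lam t))" for t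
      using lam by (auto simp: shape_def)
    show "Y x + lam t \<noteq> Y i" if "1 \<le> t" for t i using fx that by (simp add: free_left_def)
    show "\<exists>k'\<ge>1. Y x + lam k' = ray (Y e) (1,0) t'"
      if "1 \<le> i" "1 \<le> t" "Y x + lam i = ray (Y e) (1,0) t" "t \<le> t'" for i t t'
      using fx that unfolding free_left_def by blast
  qed
qed

text \<open>Positions that repeat do not yet give states that repeat. The labels of the tail at
  \<open>y\<close>, moved to \<open>x\<close>, form a second run along \<open>Y\<close>, and
  confluence identifies them with \<open>lab\<close>.\<close>

lemma periodic_if_agree:
  assumes F: "\<And>u. F u" and xy: "x < y" and st: "same_type x y"
    and ag: "\<And>t. Y (y + t) - Y y = Y (x + t) - Y x"
  shows "up_run stp q0"
proof -
  define r where "r t = (if t \<le> x then lab (Y t) else lab (Y (y + (t - x))))" for t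
  have rx: "r t = lab (Y (y + (t - x)))" if "x \<le> t" for t using that st by (cases "t = x") (auto simp: r_def same_type_def)
  have inj: "inj_on Y A" for A using Yip by (auto simp: ipath_def inj_on_def)
  have Y0: "Y 0 = (0,0)" using memY by (simp add: mem_def)
  have "run stp q0 Y r n" for n
    unfolding run_def
  proof (intro conjI allI impI)
    show "r 0 = q0" using Y0 lab_0 by (simp add: r_def)
    show "stp (r k) (Y (Suc k) - Y k) (r (Suc k))" for k
    proof (cases "k < x")
      case True then show ?thesis using Y_stp[OF F, of k] by (simp add: r_def)
    next
      case False
      define t where "t = k - x"
      have k: "k = x + t" using False by (simp add: t_def)
      have "Y (Suc k) - Y k = (Y (x + Suc t) - Y x) - (Y (x + t) - Y x)" by (simp add: k)
      also have "\<dots> = (Y (y + Suc t) - Y y) - (Y (y + t) - Y y)" by (simp only: ag)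
      also have "\<dots> = Y (Suc (y + t)) - Y (y + t)" by simp
      finally show ?thesis using Y_stp[OF F, of "y + t"] by (simp add: rx k)
    qed
  qed (use Y0 inj in auto)
  then have rl: "r t = lab (Y t)" for t using run_lab[of Y r t t] by simp
  have "irun stp q0 Y (\<lambda>k. lab (Y k))"
    using Y0 inj lab_0 Y_stp[OF F] by (simp add: irun_def run_def)
  moreover have "lab (Y (y + k)) = lab (Y (x + k))" for k using rl[of "x + k"] rx[of "x + k"] by simp
  ultimately show ?thesis unfolding up_run_def using ag xy by blast
qed

lemma lab_Q: "F (Y k) \<Longrightarrow> lab (Y k) \<in> Q"
  using Y_stp stp_Q by blast

lemma same_type_in_infinite:
  assumes "infinite I" "\<And>i. i \<in> I \<Longrightarrow> F (Y i) \<and> 0 < i"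
  shows "\<exists>x\<in>I. \<exists>y\<in>I. x < y \<and> same_type x y"
proof -
  let ?f = "\<lambda>i. (lab (Y i), Y (i - 1) - Y i)"
  have "?f ` I \<subseteq> Q \<times> {v. unit v}" using assms(2) lab_Q ipath_back[OF Yip] by auto
  then have "finite (?f ` I)" using finQ finite_units finite_subset by blast
  then obtain x where x: "x \<in> I" "infinite {y \<in> I. ?f y = ?f x}"
    using pigeonhole_infinite[OF assms(1)] by blast
  then obtain y where y: "y \<in> I" "?f y = ?f x" "x < y"
    by (metis (mono_tags, lifting) infinite_nat_iff_unbounded mem_Collect_eq)
  then have "same_type x y" by (simp add: same_type_def)
  then show ?thesis using x(1) y by blast
qed

text \<open>With \<open>F\<close> the whole plane \<open>no_left_turn\<close> applies in both
  directions, so neither continuation can turn further left than the other.\<close>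

theorem periodic_if_visible:
  assumes F: "\<And>u. F u" and lam: "shape lam" and I: "infinite I" "\<And>i. i \<in> I \<Longrightarrow> free_left lam i"
  shows "up_run stp q0"
proof -
  have "F (Y i) \<and> 0 < i" if "i \<in> I" for i using F I(2)[OF that] e_less by (auto simp: free_left_def)
  from same_type_in_infinite[OF I(1) this] obtain x y where xy: "x \<in> I" "y \<in> I" "x < y" "same_type x y"
    by blast
  have st': "same_type y x" using xy by (auto simp: same_type_def)
  have p: "0 < x" "0 < y" using I(2)[OF xy(1)] I(2)[OF xy(2)] e_less by (auto simp: free_left_def)
  show ?thesis
  proof (cases "\<exists>t. Y (y + t) - Y y \<noteq> Y (x + t) - Y x")
    case False then show ?thesis using periodic_if_agree[OF F xy(3,4)] by blast
  next
    case True
    from first_difference[OF p xy(4) True] obtain k where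
      k: "\<And>t. t \<le> k \<Longrightarrow> Y (y + t) - Y y = Y (x + t) - Y x" "tt Y (x + k) \<noteq> tt Y (y + k)" by blast
    have "\<not> tt Y (y + k) < tt Y (x + k)"
      by (rule no_left_turn[OF _ xy(4) lam I(2)[OF xy(1)] I(2)[OF xy(2)]]) (use xy k F in auto)
    moreover have "\<not> tt Y (x + k) < tt Y (y + k)"
      by (rule no_left_turn[OF _ st' lam I(2)[OF xy(2)] I(2)[OF xy(1)]]) (use xy k F in auto)
    ultimately show ?thesis using k(2) by linarith
  qed
qed

end

section \<open>A path with a free axis ray\<close>

definition grid_iso :: "(pos \<Rightarrow> pos) \<Rightarrow> bool" where
  "grid_iso f \<longleftrightarrow> bij f \<and> (\<forall>u v. f (u - v) = f u - f v) \<and> (\<forall>v. unit (f v) = unit v)"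

lemma iso_diff: "grid_iso f \<Longrightarrow> f (u - v) = f u - f v"
  and iso_unit: "grid_iso f \<Longrightarrow> unit (f v) = unit v"
  and iso_bij: "grid_iso f \<Longrightarrow> bij f"
  unfolding grid_iso_def by blast+

lemma iso_zero: "grid_iso f \<Longrightarrow> f (0,0) = (0,0)"
  unfolding grid_iso_def by (metis diff_self zero_prod_def)

lemma iso_add: "grid_iso f \<Longrightarrow> f (u + v) = f u + f v"
  unfolding grid_iso_def by (metis add_diff_cancel diff_add_cancel)

lemma iso_eq: "grid_iso f \<Longrightarrow> f u = f v \<longleftrightarrow> u = v"
  by (auto simp: grid_iso_def bij_def dest: injD)

lemma iso_ray: "grid_iso f \<Longrightarrow> f (ray u d k) = ray (f u) (f d) k"
proof (induction k)
  case (Suc k)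
  have S: "ray v w (Suc k) = ray v w k + w" for v w by (simp add: prod_eq_iff algebra_simps)
  show ?case unfolding S using Suc iso_add[OF Suc.prems, of "ray u d k" d] by simp
qed simp

lemma iso_cw: "grid_iso cw"
proof -
  have "bij cw"
    by (rule o_bij[of "\<lambda>v. (- snd v, fst v)"]) (auto simp: cw_def fun_eq_iff)
  then show ?thesis by (auto simp: grid_iso_def cw_def unit_def)
qed

lemma iso_comp: "grid_iso f \<Longrightarrow> grid_iso g \<Longrightarrow> grid_iso (f \<circ> g)"
  unfolding grid_iso_def by (simp add: bij_comp del: split_paired_All)

lemma iso_id: "grid_iso id"
  by (simp add: grid_iso_def)

lemma iso_cw_pow: "grid_iso (cw ^^ j)"
  by (induction j) (simp_all only: funpow.simps iso_comp iso_cw iso_id)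

lemma iso_mirror: "grid_iso (\<lambda>v. (- fst v, snd v))" "grid_iso (\<lambda>v. (fst v, - snd v))"
proof -
  have "bij (\<lambda>v::pos. (- fst v, snd v))" by (rule o_bij[of "\<lambda>v. (- fst v, snd v)"]) (auto simp: fun_eq_iff)
  then show "grid_iso (\<lambda>v. (- fst v, snd v))" by (auto simp: grid_iso_def unit_def)
  have "bij (\<lambda>v::pos. (fst v, - snd v))" by (rule o_bij[of "\<lambda>v. (fst v, - snd v)"]) (auto simp: fun_eq_iff)
  then show "grid_iso (\<lambda>v. (fst v, - snd v))" by (auto simp: grid_iso_def unit_def)
qed

lemma tn_cw: "tn (cw a) (cw b) = tn a b"
  by (simp add: tn_def iso_eq[OF iso_cw])

lemma tn_cw_pow: "tn ((cw ^^ j) a) ((cw ^^ j) b) = tn a b"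
  by (induction j) (simp_all add: tn_cw)

text \<open>A symmetry acts on the step relation and leaves the states alone, so one finite set
  \<open>Q\<close> serves all rotations and mirrors.\<close>

lemma run_iso:
  assumes "grid_iso f"
  shows "run (\<lambda>q v. stp q (f v)) q0 P s n \<longleftrightarrow> run stp q0 (f \<circ> P) s n"
proof -
  have "P 0 = (0,0) \<longleftrightarrow> f (P 0) = (0,0)" using iso_eq[OF assms, of "P 0" "(0,0)"] iso_zero[OF assms] by simp
  moreover have "inj_on P {..n} \<longleftrightarrow> inj_on (f \<circ> P) {..n}" by (simp add: inj_on_def iso_eq[OF assms])
  moreover have "f (u - v) = f u - f v" for u v by (rule iso_diff[OF assms])
  ultimately show ?thesis by (simp add: run_def)
qed

lemma irun_iso:
  "grid_iso f \<Longrightarrow> irun (\<lambda>q v. stp q (f v)) q0 P s \<longleftrightarrow> irun stp q0 (f \<circ> P) s"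
  by (simp add: irun_def run_iso)

lemma up_run_iso:
  assumes f: "grid_iso f" and up: "up_run (\<lambda>q v. stp q (f v)) q0"
  shows "up_run stp q0"
proof -
  obtain P s i j where P: "irun (\<lambda>q v. stp q (f v)) q0 P s" "i < j"
      "\<And>k. P (j + k) - P j = P (i + k) - P i" "\<And>k. s (j + k) = s (i + k)"
    using up unfolding up_run_def by blast
  have "irun stp q0 (f \<circ> P) s" using P(1) irun_iso[OF f] by metis
  moreover have "(f \<circ> P) (j + k) - (f \<circ> P) j = (f \<circ> P) (i + k) - (f \<circ> P) i" for k
    using P(3)[of k] iso_diff[OF f] by (metis comp_apply)
  ultimately show ?thesis unfolding up_run_def using P(2,4) by blast
qed

lemma tsys_iso:
  assumes f: "grid_iso f" and t: "tsys stp q0 Q"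
  shows "tsys (\<lambda>q v. stp q (f v)) q0 Q"
proof -
  interpret tsys stp q0 Q by (rule t)
  show ?thesis
  proof
    show "unit v" if "stp q (f v) q'" for q v q' using stp_unit[OF that] iso_unit[OF f] by simp
    show "q \<in> Q \<and> q' \<in> Q" if "stp q (f v) q'" for q v q' by (rule stp_Q[OF that])
    show "s n = s' n'" if "run (\<lambda>q v. stp q (f v)) q0 P s n" "run (\<lambda>q v. stp q (f v)) q0 P' s' n'" "P n = P' n'"
      for P s n P' s' n'
      using conf[of "f \<circ> P" s n "f \<circ> P'" s' n'] that run_iso[OF f, of stp q0] by (metis comp_apply)
  qed (auto simp: finQ q0Q)
qed

lemma finite_common_bound:
  assumes "finite A" "\<And>r. r \<in> A \<Longrightarrow> \<exists>X::int. \<forall>k. T r k \<longrightarrow> g k \<le> X"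
  shows "\<exists>X. \<forall>r\<in>A. \<forall>k. T r k \<longrightarrow> g k \<le> X"
  using assms
proof (induction A rule: finite_induct)
  case (insert a A)
  then obtain X where X: "\<forall>r\<in>A. \<forall>k. T r k \<longrightarrow> g k \<le> X" by blast
  obtain X' where "\<forall>k. T a k \<longrightarrow> g k \<le> X'" using insert.prems by blast
  then have "\<forall>r\<in>insert a A. \<forall>k. T r k \<longrightarrow> g k \<le> max X X'" using X by (auto simp: le_max_iff_disj)
  then show ?case by blast
qed simp

lemma unbounded_infinite:
  fixes g :: "nat \<Rightarrow> int"
  assumes "\<And>X. \<exists>k. T k \<and> g k > X"
  shows "infinite {k. T k \<and> g k > X \<and> n \<le> k}"
proof
  assume fin: "finite {k. T k \<and> g k > X \<and> n \<le> k}"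
  have "\<exists>B. \<forall>k\<in>{k. T k \<and> g k > X \<and> n \<le> k} \<union> {..<n}. g k \<le> B"
    using finite_common_bound[of "{k. T k \<and> g k > X \<and> n \<le> k} \<union> {..<n}" "\<lambda>r k. k = r" g] fin by auto
  then obtain B where B: "\<And>k. (T k \<and> g k > X \<and> n \<le> k) \<or> k < n \<Longrightarrow> g k \<le> B" by auto
  obtain k where "T k" "g k > max X B" using assms by blast
  then show False using B[of k] by (cases "n \<le> k") auto
qed

lemma evis_exists:
  assumes "snd (Y k0) = r" "\<And>k. snd (Y k) = r \<Longrightarrow> fst (Y k) \<le> X"
  shows "\<exists>k. evis Y k \<and> snd (Y k) = r"
proof -
  obtain k where k: "snd (Y k) = r" "\<And>j. snd (Y j) = r \<Longrightarrow> nat (X - fst (Y k)) \<le> nat (X - fst (Y j))"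
    using ex_has_least_nat[of "\<lambda>k. snd (Y k) = r" k0 "\<lambda>k. nat (X - fst (Y k))"] assms(1) by blast
  have "fst (Y j) \<le> fst (Y k)" if "snd (Y j) = r" for j
    using k(2)[OF that] assms(2)[OF that] assms(2)[OF k(1)] by linarith
  then show ?thesis using k(1) by (auto simp: evis_def)
qed

lemma row_visited:
  assumes Y: "ipath Y" and "snd (Y k) \<le> r" "r \<le> snd (Y 0)"
  shows "\<exists>j\<le>k. snd (Y j) = r"
  using assms(2)
proof (induction k)
  case 0 then show ?case using assms(3) by auto
next
  case (Suc k)
  have "snd (Y (Suc k)) = snd (Y k) \<or> snd (Y (Suc k)) = snd (Y k) + 1 \<or> snd (Y (Suc k)) = snd (Y k) - 1"
    using ipath_step[OF Y, of k] by (cases "Y k"; cases "Y (Suc k)") (auto simp: unit_def)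
  then consider "snd (Y k) \<le> r" | "snd (Y (Suc k)) = r" using Suc.prems by linarith
  then show ?case
  proof cases
    case 1 then show ?thesis using Suc.IH le_SucI by blast
  qed auto
qed

lemma ipath_iso: "grid_iso f \<Longrightarrow> ipath Y \<Longrightarrow> ipath (f \<circ> Y)"
  unfolding ipath_def by (simp add: iso_diff[symmetric] iso_unit inj_compose[OF bij_is_inj[OF iso_bij], unfolded comp_def] comp_def)

context leftmost_path
begin

lemma evis_e: "evis Y e"
  unfolding evis_def
proof (intro allI impI leI notI)
  fix j assume "snd (Y j) = snd (Y e)" "fst (Y e) < fst (Y j)"
  then have "Y j = ray (Y e) (1,0) (nat (fst (Y j) - fst (Y e)))" by (simp add: prod_eq_iff)
  then show False using Y_tau[of "nat (fst (Y j) - fst (Y e))" j] \<open>fst (Y e) < fst (Y j)\<close> by simp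
qed

text \<open>Far east on the row \<open>h\<close> below \<open>Y e\<close>, climbing \<open>h\<close>
  steps meets nothing: the rows in between are bounded to the east, and the row of
  \<open>Y e\<close> is free beyond \<open>Y e\<close>. So \<open>lam\<close> climbs
  \<open>h\<close> steps and then runs along the forbidden ray, which is why
  \<open>free_left\<close> admits merging with that ray.\<close>

lemma periodic_if_bent:
  assumes F: "\<And>u. F u" and h: "1 \<le> (h::nat)"
    and unb: "\<And>X. \<exists>k. snd (Y k) = snd (Y e) - int h \<and> fst (Y k) > X"
    and bd: "\<And>h'. 1 \<le> h' \<Longrightarrow> h' < h \<Longrightarrow> \<exists>X. \<forall>k. snd (Y k) = snd (Y e) - int h' \<longrightarrow> fst (Y k) \<le> X"
  shows "up_run stp q0"
proof -
  obtain X where X: "\<And>h' k. 1 \<le> h' \<Longrightarrow> h' < h \<Longrightarrow> snd (Y k) = snd (Y e) - int h' \<Longrightarrow> fst (Y k) \<le> X"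
    using finite_common_bound[of "{1..<h}" "\<lambda>h' k. snd (Y k) = snd (Y e) - int h'" "\<lambda>k. fst (Y k)"] bd
    by (metis atLeastLessThan_iff finite_atLeastLessThan)
  define I where "I = {k. snd (Y k) = snd (Y e) - int h \<and> fst (Y k) > max X (fst (Y e)) \<and> max e0 (Suc e) \<le> k}"
  define lam where "lam = cat (ray 0 (0,1)) h (ray (0, int h) (1,0))"
  have lamv: "lam t = (if t \<le> h then (0, int t) else (int t - int h, int h))" for t
    by (auto simp: lam_def cat_def prod_eq_iff of_nat_diff)
  show ?thesis
  proof (rule periodic_if_visible[of lam I])
    show "F u" for u by (rule F)
    show "infinite I" unfolding I_def by (rule unbounded_infinite[OF unb])
    have "inj lam" by (rule injI) (auto simp: lamv split: if_splits)
    moreover have "unit (lam (Suc k) - lam k)" for k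
      by (cases "k < h"; cases "k = h") (auto simp: lamv unit_def)
    ultimately show "shape lam" by (simp add: shape_def lamv zero_prod_def)
    fix i assume i: "i \<in> I"
    then have ir: "snd (Y i) = snd (Y e) - int h" "fst (Y i) > X" "fst (Y i) > fst (Y e)" "e0 \<le> i" "e < i"
      by (auto simp: I_def)
    have free: "Y j \<noteq> (fst (Y i), snd (Y i) + int t)" if "1 \<le> t" "t \<le> h" for t j
    proof
      assume eq: "Y j = (fst (Y i), snd (Y i) + int t)"
      show False
      proof (cases "t = h")
        case True
        then show False using evis_e[unfolded evis_def, rule_format, of j] eq ir by simp
      next
        case False
        then have "1 \<le> h - t" "h - t < h" "int (h - t) = int h - int t" using that by auto
        then have "fst (Y j) \<le> X" using X[of "h - t" j] eq ir by simp
        then show False using eq ir by simp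
      qed
    qed
    have free2: "Y i + lam k \<noteq> Y j" if "1 \<le> k" for k j
    proof (cases "k \<le> h")
      case True
      then have "Y i + lam k = (fst (Y i), snd (Y i) + int k)" by (simp add: lamv prod_eq_iff)
      then show ?thesis using free[OF that True, of j] by metis
    next
      case False
      show ?thesis
      proof
        assume "Y i + lam k = Y j"
        then have "snd (Y j) = snd (Y e)" "fst (Y j) = fst (Y i) + (int k - int h)"
          using ir False by (auto simp: lamv prod_eq_iff)
        then show False using evis_e[unfolded evis_def, rule_format, of j] ir False by simp
      qed
    qed
    have "leftd Y i (0,1)"
      by (rule visible_bent[OF Yip ir(5) evis_e h _ ir(3)]) (use ir free in auto)
    moreover have "lam 1 = (0,1)" using h by (simp add: lamv)
    moreover have "\<exists>k'\<ge>1. Y i + lam k' = ray (Y e) (1,0) t'"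
      if "1 \<le> k" "1 \<le> t" "Y i + lam k = ray (Y e) (1,0) t" "t \<le> t'" for k t t'
    proof -
      have "snd (Y i) + snd (lam k) = snd (Y e)" "fst (Y i) + fst (lam k) = fst (Y e) + int t"
        using that(3) by (auto simp: prod_eq_iff)
      then have "h \<le> k" "fst (Y i) + (int k - int h) = fst (Y e) + int t" using ir by (auto simp: lamv split: if_splits)
      then have "Y i + lam (k + (t' - t)) = ray (Y e) (1,0) t'"
        using that(4) ir by (auto simp: lamv prod_eq_iff of_nat_diff)
      then show ?thesis using that(1) by (intro exI[of _ "k + (t' - t)"]) auto
    qed
    ultimately show "free_left lam i" using ir free2 unfolding free_left_def by auto
  qed
qed

text \<open>After the rotation \<open>f\<close> every row below \<open>r1\<close> is visited and
  bounded to the east, so it holds a visible point. The point \<open>a\<close> in the highest of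
  these rows is the reference: every later visible point is lower than \<open>a\<close> and hence
  left by \<open>visible_pair\<close>.\<close>

lemma periodic_if_rows:
  assumes F: "\<And>u. F u" and f: "f = cw ^^ j" and d: "unit d" "f d = (1,0)"
    and bd: "\<And>r. r < r0 \<Longrightarrow> \<exists>X. \<forall>k. snd (f (Y k)) = r \<longrightarrow> fst (f (Y k)) \<le> X"
    and low: "\<And>r. \<exists>k. snd (f (Y k)) < r"
    and tau: "\<And>k t t'. snd (f (Y k)) < r0 \<Longrightarrow> 1 \<le> t \<Longrightarrow> 1 \<le> t' \<Longrightarrow> ray (Y k) d t \<noteq> ray (Y e) (1,0) t'"
  shows "up_run stp q0"
proof -
  have isof: "grid_iso f" unfolding f by (rule iso_cw_pow)
  define Y' where "Y' = f \<circ> Y"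
  have ip: "ipath Y'" unfolding Y'_def by (rule ipath_iso[OF isof Yip])
  \<comment> \<open>The rows considered are also below the start, so that a path going down without
    bound passes through each of them.\<close>
  define r1 where "r1 = min r0 (snd (Y' 0))"
  have vis: "\<exists>k. evis Y' k \<and> snd (Y' k) = r" if rr: "r < r1" for r
  proof -
    obtain k where "snd (Y' k) < r" using low[of r] by (auto simp: Y'_def)
    moreover have "r \<le> snd (Y' 0)" using that by (simp add: r1_def)
    ultimately obtain k0 where "snd (Y' k0) = r" using row_visited[OF ip, of k r] by auto
    moreover obtain X where "\<And>k. snd (Y' k) = r \<Longrightarrow> fst (Y' k) \<le> X"
      using bd[of r] rr unfolding r1_def Y'_def comp_def by auto
    ultimately show ?thesis by (rule evis_exists)
  qed
  define i where "i r = (SOME k. evis Y' k \<and> snd (Y' k) = r)" for r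
  have i: "evis Y' (i r)" "snd (Y' (i r)) = r" if "r < r1" for r
    using someI_ex[OF vis[OF that]] by (auto simp: i_def)
  define a where "a = i (r1 - 1)"
  have a: "evis Y' a" "snd (Y' a) = r1 - 1" using i[of "r1 - 1"] by (auto simp: a_def)
  define I where "I = i ` {..<r1 - 1} - {..max a (max e0 e)}"
  have "inj_on i {..<r1 - 1}"
    by (rule inj_on_inverseI[of _ "\<lambda>k. snd (Y' k)"]) (use i in auto)
  then have "infinite (i ` {..<r1 - 1})" using infinite_Iio finite_image_iff by blast
  then have infI: "infinite I" by (simp add: I_def)
  have ray: "ray 0 d k = ray (0,0) d k" for k by (simp add: zero_prod_def)
  have raya: "Y x + ray 0 d k = ray (Y x) d k" for x k by (simp add: prod_eq_iff)
  show ?thesis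
  proof (rule periodic_if_visible[of "ray 0 d" I])
    show "F u" for u by (rule F)
    show "infinite I" by (rule infI)
    show "shape (ray 0 d)" using d by (auto simp: shape_def inj_on_def ray_inj)
    fix x assume x: "x \<in> I"
    then obtain r where r: "x = i r" "r < r1 - 1" by (auto simp: I_def)
    have x1: "a < x" "e0 \<le> x" "e < x" using x by (auto simp: I_def)
    have vx: "evis Y' x" "snd (Y' x) = r" using i[of r] r by auto
    have r0: "r < r0" using r by (simp add: r1_def)
    have bd': "\<exists>X. \<forall>k. snd (Y' k) = s \<longrightarrow> fst (Y' k) \<le> X" if "s \<in> {r..r1 - 1}" for s
      using bd[of s] that unfolding r1_def Y'_def comp_def by auto
    obtain X where "\<forall>s\<in>{r..r1 - 1}. \<forall>k. snd (Y' k) = s \<longrightarrow> fst (Y' k) \<le> X"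
      using finite_common_bound[of "{r..r1 - 1}" "\<lambda>s k. snd (Y' k) = s" "\<lambda>k. fst (Y' k)"] bd'
      by (metis finite_atLeastAtMost_int)
    then have X: "fst (Y' k) \<le> X" if "r \<le> s" "s \<le> r1 - 1" "snd (Y' k) = s" for s k
      using that by auto
    have "eleft Y' x"
    proof (rule visible_pair(1)[OF ip x1(1) a(1) vx(1), of "X + 1"])
      show "fst (Y' a) < X + 1" "fst (Y' x) < X + 1" using X[of "r1 - 1" a] X[of r x] a vx r by auto
      show "snd (Y' k) < min (snd (Y' a)) (snd (Y' x)) \<or> max (snd (Y' a)) (snd (Y' x)) < snd (Y' k)"
        if "fst (Y' k) = X + 1" for k
        using X[of "snd (Y' k)" k] that a vx r(2) by linarith
      show "snd (Y' x) < snd (Y' a)" using a vx r by simp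
    qed
    then have "leftd Y x d"
    proof -
      have "f (u - v) = f u - f v" for u v by (rule iso_diff[OF isof])
      then have "tn (Y' k - Y' x) (Y' m - Y' x) = tn (Y k - Y x) (Y m - Y x)" for k m
        unfolding Y'_def f by (metis comp_apply f tn_cw_pow)
      moreover have "tn (Y' k - Y' x) (1,0) = tn (Y k - Y x) d" for k
        using \<open>\<And>u v. f (u - v) = f u - f v\<close> d(2) unfolding Y'_def f by (metis comp_apply f tn_cw_pow)
      ultimately show ?thesis using \<open>eleft Y' x\<close> by (simp add: leftd_def)
    qed
    moreover have "Y x + ray 0 d k \<noteq> Y m" if "1 \<le> k" for k m
    proof
      assume "Y x + ray 0 d k = Y m"
      then have "f (ray (Y x) d k) = Y' m" by (simp add: raya Y'_def)
      then have "Y' m = ray (Y' x) (1,0) k" by (simp add: iso_ray[OF isof] d Y'_def)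
      then show False using evis_ray[OF vx(1) that, of "Y' m" m] by simp
    qed
    moreover have "ray 0 d 1 = d" by (simp add: prod_eq_iff)
    moreover have "ray (Y x) d k \<noteq> ray (Y e) (1,0) t" if "1 \<le> k" "1 \<le> t" for k t
      by (rule tau[OF _ that]) (use vx r0 in \<open>simp add: Y'_def\<close>)
    ultimately show "free_left (ray 0 d) x" using x1 unfolding free_left_def raya by auto
  qed
qed

lemma cw_pows: "(cw ^^ 1) v = (snd v, - fst v)" "(cw ^^ 2) v = (- fst v, - snd v)" "(cw ^^ 3) v = (- snd v, fst v)"
  by (simp_all add: cw_def numeral_2_eq_2 numeral_3_eq_3)

text \<open>Otherwise the path is confined to the south, west, north and east in turn, each bound
  supplying the one-sided row bound that \<open>periodic_if_rows\<close> needs for the next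
  direction. An infinite self-avoiding path cannot stay in a box.\<close>

theorem periodic:
  assumes F: "\<And>u. F u"
  shows "up_run stp q0"
proof (rule ccontr)
  assume no: "\<not> up_run stp q0"
  let ?x0 = "fst (Y e)" and ?y0 = "snd (Y e)"
  have rows: "\<exists>X. \<forall>k. snd (Y k) = r \<longrightarrow> fst (Y k) \<le> X" if r: "r < ?y0" for r
  proof (rule ccontr)
    assume neg: "\<not> ?thesis"
    \<comment> \<open>The least \<open>h\<close> with an unbounded row makes all rows between it and
      \<open>Y e\<close> bounded, as \<open>periodic_if_bent\<close> demands.\<close>
    define T where "T h \<longleftrightarrow> 1 \<le> h \<and> (\<forall>X. \<exists>k. snd (Y k) = ?y0 - int h \<and> fst (Y k) > X)" for h :: nat
    have "T (nat (?y0 - r))" unfolding T_def using neg r by (auto simp: not_le)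
    then have least: "T (LEAST h. T h)" by (rule LeastI)
    have "up_run stp q0"
    proof (rule periodic_if_bent[OF F, of "LEAST h. T h"])
      show "\<exists>X. \<forall>k. snd (Y k) = ?y0 - int h' \<longrightarrow> fst (Y k) \<le> X" if "1 \<le> h'" "h' < (LEAST h. T h)" for h'
        using not_less_Least[OF that(2)] that(1) by (auto simp: T_def not_less)
    qed (use least in \<open>auto simp: T_def\<close>)
    then show False using no by simp
  qed
  have "\<exists>yb. \<forall>k. yb \<le> snd (Y k)"
  proof (rule ccontr)
    assume "\<not> ?thesis"
    then have "\<exists>k. snd (Y k) < r" for r by (meson not_le)
    then have "up_run stp q0"
      by (intro periodic_if_rows[OF F, of "cw ^^ 0" 0 "(1,0)" ?y0]) (use rows in \<open>auto simp: prod_eq_iff\<close>)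
    then show False using no by simp
  qed
  then obtain yb where yb: "\<And>k. yb \<le> snd (Y k)" by blast
  \<comment> \<open>East of column \<open>X1\<close> the path stays on or above the row of
    \<open>Y e\<close>, so the north rays used for the last direction miss the forbidden
    ray.\<close>
  obtain X1 where X1: "\<And>k. snd (Y k) < ?y0 \<Longrightarrow> fst (Y k) \<le> X1"
    using finite_common_bound[of "{yb..<?y0}" "\<lambda>r k. snd (Y k) = r" "\<lambda>k. fst (Y k)"] rows yb
    by (metis atLeastLessThan_iff finite_atLeastLessThan_int)
  have "\<exists>xb. \<forall>k. xb \<le> fst (Y k)"
  proof (rule ccontr)
    assume "\<not> ?thesis"
    then have low: "\<exists>k. fst (Y k) < r" for r by (meson not_le)
    have "up_run stp q0"
    proof (rule periodic_if_rows[OF F, of "cw ^^ 3" 3 "(0,-1)" ?x0])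
      show "\<exists>X. \<forall>k. snd ((cw ^^ 3) (Y k)) = r \<longrightarrow> fst ((cw ^^ 3) (Y k)) \<le> X" for r
        using yb by (intro exI[of _ "- yb"]) (simp add: cw_pows)
    qed (use low in \<open>auto simp: cw_pows prod_eq_iff\<close>)
    then show False using no by simp
  qed
  then obtain xb where xb: "\<And>k. xb \<le> fst (Y k)" by blast
  have "\<exists>yt. \<forall>k. snd (Y k) \<le> yt"
  proof (rule ccontr)
    assume "\<not> ?thesis"
    then have low: "\<exists>k. - snd (Y k) < r" for r by (metis minus_less_iff not_le)
    have "up_run stp q0"
    proof (rule periodic_if_rows[OF F, of "cw ^^ 2" 2 "(-1,0)" "- ?y0"])
      show "\<exists>X. \<forall>k. snd ((cw ^^ 2) (Y k)) = r \<longrightarrow> fst ((cw ^^ 2) (Y k)) \<le> X" for r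
        using xb by (intro exI[of _ "- xb"]) (simp add: cw_pows)
    qed (use low in \<open>auto simp: cw_pows prod_eq_iff\<close>)
    then show False using no by simp
  qed
  then obtain yt where yt: "\<And>k. snd (Y k) \<le> yt" by blast
  have "\<exists>xt. \<forall>k. fst (Y k) \<le> xt"
  proof (rule ccontr)
    assume "\<not> ?thesis"
    then have low: "\<exists>k. - fst (Y k) < r" for r by (metis minus_less_iff not_le)
    have "up_run stp q0"
    proof (rule periodic_if_rows[OF F, of "cw ^^ 1" 1 "(0,1)" "- max X1 ?x0"])
      show "\<exists>X. \<forall>k. snd ((cw ^^ 1) (Y k)) = r \<longrightarrow> fst ((cw ^^ 1) (Y k)) \<le> X" for r
        unfolding cw_pows using yt by auto
      show "ray (Y k) (0,1) t \<noteq> ray (Y e) (1,0) t'" if "snd ((cw ^^ 1) (Y k)) < - max X1 ?x0" "1 \<le> t" for k t t'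
      proof -
        have x: "fst (Y k) > X1" "fst (Y k) > ?x0" using that(1) unfolding cw_pows by auto
        have "snd (Y k) \<ge> ?y0" using X1[of k] x by force
        then show ?thesis using that(2) by (auto simp: prod_eq_iff)
      qed
    qed (use low in \<open>auto simp: cw_def unit_def\<close>)
    then show False using no by simp
  qed
  then obtain xt where xt: "\<And>k. fst (Y k) \<le> xt" by blast
  have "Y k \<in> {xb..xt} \<times> {yb..yt}" for k using xb[of k] xt[of k] yb[of k] yt[of k] by (simp add: mem_Times_iff)
  then have "range Y \<subseteq> {xb..xt} \<times> {yb..yt}" by blast
  then have "finite (range Y)" using finite_subset by blast
  then show False using Yip range_inj_infinite by (auto simp: ipath_def)
qed

end

context tsys
begin

lemma mem_irun:
  assumes "irun stp q0 P s" "\<And>k t. 1 \<le> t \<Longrightarrow> P k \<noteq> ray (P e) (1,0) t" "\<And>u. F u"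
  shows "mem P e0 e F P"
  unfolding mem_def
proof (intro conjI allI impI)
  show "stp (lab (P k)) (P (Suc k) - P k) (lab (P (Suc k)))" for k
    using assms(1)[unfolded irun_def run_def, rule_format, of "Suc k"] irun_lab[OF assms(1)] by auto
  show "inj P" using irun_ipath[OF assms(1)] by (simp add: ipath_def)
  show "P 0 = (0,0)" using assms(1) by (simp add: irun_def run_def)
qed (use assms in auto)

lemma periodic_if_free_east:
  assumes "irun stp q0 P s" "\<And>k t. 1 \<le> t \<Longrightarrow> P k \<noteq> ray (P e) (1,0) t"
  shows "up_run stp q0"
proof -
  define F :: "pos \<Rightarrow> bool" where "F = (\<lambda>_. True)"
  obtain Y where "leftmost P (Suc e) e F Y"
    using leftmost_exists[OF mem_irun[OF assms, of F "Suc e"]] by (auto simp: F_def)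
  then interpret leftmost_path stp q0 Q P "Suc e" e F Y
    by unfold_locales (auto simp: F_def)
  show ?thesis by (rule periodic) (simp add: F_def)
qed

end

theorem periodic_if_free_ray:
  assumes t: "tsys stp q0 Q" and P: "irun stp q0 P s" and d: "unit d"
    and free: "\<And>k t. 1 \<le> t \<Longrightarrow> P k \<noteq> ray (P e) d t"
  shows "up_run stp q0"
proof -
  have "\<exists>j. (cw ^^ j) (1,0) = d"
  proof -
    have "(cw ^^ 0) (1,0) = (1,0)" "(cw ^^ 1) (1,0) = (0,-1)" "(cw ^^ 2) (1,0) = (-1,0)" "(cw ^^ 3) (1,0) = (0,1)"
      by (simp_all add: cw_def numeral_2_eq_2 numeral_3_eq_3)
    then show ?thesis using d unfolding unit_def by metis
  qed
  then obtain j where j: "(cw ^^ j) (1,0) = d" by blast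
  define f where "f = cw ^^ j"
  have f: "grid_iso f" unfolding f_def by (rule iso_cw_pow)
  define P' where "P' k = inv f (P k)" for k
  have fP: "f (P' k) = P k" for k unfolding P'_def by (rule surj_f_inv_f[OF bij_is_surj[OF iso_bij[OF f]]])
  have P': "irun (\<lambda>q v. stp q (f v)) q0 P' s"
    using irun_iso[OF f, of stp q0 P' s] P fP by (simp add: comp_def)
  interpret tsys "\<lambda>q v. stp q (f v)" q0 Q by (rule tsys_iso[OF f t])
  have "P' k \<noteq> ray (P' e) (1,0) t" if "1 \<le> t" for k t
  proof
    assume "P' k = ray (P' e) (1,0) t"
    then have "P k = ray (P e) d t" using iso_ray[OF f, of "P' e" "(1,0)" t] fP[of k] fP[of e] j by (simp add: f_def)
    then show False using free[OF that] by simp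
  qed
  from periodic_if_free_east[OF P' this] show ?thesis by (rule up_run_iso[OF f])
qed

section \<open>Descending pairs below a horizontal cut\<close>

context leftmost_path
begin

lemma Y_climbs: "\<not> F (Y k) \<Longrightarrow> \<not> F (Y (k + n)) \<and> Y (k + n) = ray (Y k) (0,1) n"
proof (induction n)
  case (Suc n)
  have nF: "\<not> F (Y (k + n))" using Suc by blast
  then have "Y (k + Suc n) = Y (k + n) + (0,1)" using Y_out[OF nF] by simp
  moreover have "ray (Y k) (0,1) (Suc n) = ray (Y k) (0,1) n + (0,1)" by (simp add: prod_eq_iff)
  ultimately show ?case using Suc F_up[OF nF] by metis
qed simp

text \<open>Otherwise the segment between the two points can be pumped forever, to the left of \<open>Y\<close>.\<close>
lemma no_descending_pair:
  assumes F: "\<And>u. F u \<longleftrightarrow> snd u < m" and leaves: "\<exists>k. \<not> F (Y k)"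
    and xy: "x < y" "e0 \<le> x" and st: "same_type x y"
    and vx: "evis Y x" "eleft Y x" and vy: "evis Y y" "eleft Y y"
    and rows: "snd (Y y) < snd (Y x)" "snd (Y x) < snd (Y e)"
  shows False
proof -
  define q where "q = y - x"
  define v where "v = Y y - Y x"
  have q: "1 \<le> q" "x + q = y" using xy by (auto simp: q_def)
  have v: "snd v < 0" "Y x + v = Y y" using rows by (auto simp: v_def)
  have x0: "0 < x" using xy e_less by simp
  have Fe: "snd (Y e) < m" using F_tau[of 1] F Ye by simp
  have Fy: "F (Y y)" using rows Fe F by simp
  have raya: "Y k + ray 0 (1,0) t = ray (Y k) (1,0) t" for k t by (simp add: prod_eq_iff)
  have free: "free_left (ray 0 (1,0)) k" if "evis Y k" "eleft Y k" "snd (Y k) < snd (Y e)" "e0 \<le> k" for k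
    unfolding free_left_def raya
  proof (intro conjI allI impI)
    show "ray (Y k) (1,0) t \<noteq> Y i" if "1 \<le> t" for t i
      using evis_ray[OF \<open>evis Y k\<close> that, of "ray (Y k) (1,0) t" i] by simp
    show "leftd Y k (ray 0 (1,0) 1)" using that(2) by (simp add: ray_def zero_prod_def)
    show "\<exists>k'\<ge>1. ray (Y k) (1,0) k' = ray (Y e) (1,0) t'" if "ray (Y k) (1,0) i = ray (Y e) (1,0) t" for i t t'
      using that \<open>snd (Y k) < snd (Y e)\<close> by (auto simp: prod_eq_iff)
  qed (rule that(4))
  have fx: "free_left (ray 0 (1,0)) x" and fy: "free_left (ray 0 (1,0)) y"
    using free vx vy rows xy by auto
  have sh: "shape (ray 0 (1,0))" by (auto simp: shape_def inj_on_def ray_inj)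
  \<comment> \<open>Outside of \<open>F\<close> the path climbs, so \<open>q\<close> steps later it
    would be higher, whereas agreement moves it by \<open>v\<close>, which points down.\<close>
  have inF: "F (Y (x + t))" if "Y (y + t) - Y y = Y (x + t) - Y x" for t
  proof (rule ccontr)
    assume "\<not> F (Y (x + t))"
    then have "Y (x + t + q) = ray (Y (x + t)) (0,1) q" using Y_climbs by blast
    moreover have "x + t + q = y + t" using q by simp
    ultimately have "snd (Y (y + t)) = snd (Y (x + t)) + int q" by simp
    moreover have "snd (Y (y + t)) - snd (Y y) = snd (Y (x + t)) - snd (Y x)"
      using that by (metis snd_diff)
    ultimately show False using rows by simp
  qed
  have "\<exists>t. Y (y + t) - Y y \<noteq> Y (x + t) - Y x"
  proof -
    obtain T where T: "\<not> F (Y T)" using leaves by blast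
    then have "\<not> F (Y (x + T))" using Y_climbs[OF T, of x] by (metis add.commute)
    then show ?thesis using inF by blast
  qed
  from first_difference[OF x0 _ st this] xy obtain k where
    ag: "\<And>t. t \<le> k \<Longrightarrow> Y (y + t) - Y y = Y (x + t) - Y x" and ne: "tt Y (x + k) \<noteq> tt Y (y + k)" by auto
  have Fxk: "F (Y (x + k))" by (rule inF) (rule ag, simp)
  \<comment> \<open>Translation by \<open>v\<close> maps \<open>F\<close> into itself, so this
    comparison is available. The reverse one would need translation by \<open>- v\<close>, under
    which \<open>F\<close> is not stable.\<close>
  have "\<not> tt Y (y + k) < tt Y (x + k)"
    by (rule no_left_turn[OF _ st sh fx fy _ ag Fxk]) (use xy v F in \<open>auto simp: v_def\<close>)
  then have less: "tt Y (x + k) < tt Y (y + k)" using ne by simp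
  have agv: "Y (y + t) = Y (x + t) + v" if "t \<le> k" for t
    using ag[OF that] by (simp add: v_def algebra_simps)
  define b where "b = y + k"
  have Fb: "F (Y b)" using Fxk agv[of k] v F by (simp add: b_def)
  have FY: "F (Y t)" if "t \<le> y" for t by (rule F_before[OF Fy that])
  \<comment> \<open>The segment from \<open>x\<close> to \<open>y\<close> is repeated under
    multiples of \<open>v\<close>. Up to \<open>b\<close> this is \<open>Y\<close> itself because
    the continuations agree; at \<open>b\<close> it turns as \<open>Y\<close> does at
    \<open>x + k\<close>, hence further left.\<close>
  define R where "R t = (if t < x then Y t else ray (Y (x + (t - x) mod q)) v ((t - x) div q))" for t
  define r where "r t = (if t < x then lab (Y t) else lab (Y (x + (t - x) mod q)))" for t
  have Rq: "R (t + q) = R t + v" if "x \<le> t" for t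
  proof -
    have eq: "t + q - x = (t - x) + q" using that by simp
    have dm: "(t + q - x) div q = Suc ((t - x) div q)" "(t + q - x) mod q = (t - x) mod q"
      unfolding eq using q(1) div_add_self2[of q "t - x"] by simp_all
    have "R (t + q) = ray (Y (x + (t - x) mod q)) v (Suc ((t - x) div q))" using that by (simp add: R_def dm)
    also have "\<dots> = R t + v" using that by (simp add: R_def prod_eq_iff algebra_simps)
    finally show ?thesis .
  qed
  have Rx: "R t = Y t" if "t < y" for t using that q by (auto simp: R_def)
  have Rb: "R t = Y t" if "t \<le> b" for t
    using that
  proof (induction t rule: less_induct)
    case (less t)
    show ?case
    proof (cases "t < y")
      case False
      have "R t = R (t - q) + v" using Rq[of "t - q"] False q by simp
      also have "R (t - q) = Y (t - q)" by (rule less.IH) (use less.prems False q in auto)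
      also have "Y (t - q) + v = Y t"
      proof -
        have "x + (t - y) = t - q" "y + (t - y) = t" "t - y \<le> k" using less.prems False q by (auto simp: b_def)
        then show ?thesis using agv[of "t - y"] by metis
      qed
      finally show ?thesis .
    qed (rule Rx)
  qed
  have Rnext: "R (Suc b) - R b = Y (Suc (x + k)) - Y (x + k)"
  proof -
    have "R (Suc b) = R (Suc (x + k)) + v" using Rq[of "Suc (x + k)"] q by (simp add: b_def add.commute add.left_commute)
    moreover have "R (Suc (x + k)) = Y (Suc (x + k))" by (rule Rb) (use q in \<open>simp add: b_def\<close>)
    moreover have "R b = Y (x + k) + v" using Rb[of b] agv[of k] by (simp add: b_def)
    ultimately show ?thesis by simp
  qed
  have Rback: "R (b - 1) - R b = Y (x + k - 1) - Y (x + k)"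
    using step_agree[OF ag st] Rb[of b] Rb[of "b - 1"] by (simp add: b_def)
  have left: "tt R b < tt Y b"
    using less unfolding Rnext Rback by (simp add: b_def)
  have r0: "r 0 = q0" using x0 memY lab_0 by (simp add: r_def mem_def)
  have rstp: "stp (r t) (R (Suc t) - R t) (r (Suc t))" for t
  proof (cases "t < x")
    case True
    then have "R (Suc t) = Y (Suc t)" "R t = Y t" using Rx[of t] Rb[of "Suc t"] q by (auto simp: b_def)
    moreover have "r t = lab (Y t)" "r (Suc t) = lab (Y (Suc t))"
      using True by (auto simp: r_def less_Suc_eq)
         (metis Suc_lessI add_0_right diff_self_eq_0 mod_0)
    ultimately show ?thesis using Y_stp[OF FY, of t] True q by simp
  next
    case False
    define d where "d = (t - x) div q"
    define s where "s = (t - x) mod q"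
    have sq: "s < q" using q by (simp add: s_def)
    have Rt: "R t = ray (Y (x + s)) v d" "r t = lab (Y (x + s))" using False by (auto simp: R_def r_def d_def s_def)
    have St: "Suc t - x = Suc (t - x)" using False by simp
    show ?thesis
    proof (cases "Suc s = q")
      case True
      then have "Suc (t - x) mod q = 0" by (simp add: mod_Suc s_def)
      moreover have "Suc (t - x) div q = Suc d" using \<open>Suc (t - x) mod q = 0\<close> by (simp add: div_Suc d_def)
      ultimately have "R (Suc t) = ray (Y x) v (Suc d)" "r (Suc t) = lab (Y x)" using False by (auto simp: R_def r_def St)
      moreover have "ray (Y x) v (Suc d) = ray (Y y) v d" using v(2) by (auto simp: prod_eq_iff algebra_simps)
      moreover have "lab (Y x) = lab (Y y)" using st by (simp add: same_type_def)
      moreover have "Suc (x + s) = y" using True q by simp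
      ultimately show ?thesis using Y_stp[OF FY, of "x + s"] Rt by (simp add: ray_def prod_eq_iff minus_prod_def)
    next
      case False2: False
      then have "Suc (t - x) mod q = Suc s" by (simp add: mod_Suc s_def)
      moreover have "Suc (t - x) div q = d" using \<open>Suc (t - x) mod q = Suc s\<close> by (simp add: div_Suc d_def)
      ultimately have "R (Suc t) = ray (Y (Suc (x + s))) v d" "r (Suc t) = lab (Y (Suc (x + s)))"
        using False by (auto simp: R_def r_def St)
      moreover have "x + s \<le> y" using sq q by simp
      ultimately show ?thesis using Y_stp[OF FY, of "x + s"] Rt by (simp add: ray_def minus_prod_def)
    qed
  qed
  have Lleft: "tn (Y (y - 1) - Y y) (ray (Y y) (1,0) 1 - Y y) < tn (Y (y - 1) - Y y) (R (Suc y) - Y y)"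
  proof -
    have "R (Suc y) = R (Suc x) + v" using Rq[of "Suc x"] q by (simp add: add.commute)
    moreover have "R (Suc x) = Y (Suc x)" by (rule Rb) (use q in \<open>simp add: b_def\<close>)
    ultimately have "R (Suc y) - Y y = Y (Suc x) - Y x" by (simp add: v_def)
    moreover have "ray (Y y) (1,0) 1 - Y y = (1,0)" by (simp add: prod_eq_iff)
    ultimately show ?thesis using vx(2) st by (simp add: leftd_def same_type_def)
  qed
  have offx: "ray (Y x) (1,0) t \<noteq> Y i" "ray (Y y) (1,0) t \<noteq> Y i" if "1 \<le> t" for t i
    using evis_ray[OF vx(1) that, of "ray (Y x) (1,0) t" i] evis_ray[OF vy(1) that, of "ray (Y y) (1,0) t" i] by auto
  have Ltau: "ray (Y y) (1,0) i \<noteq> ray (Y e) (1,0) t" for i t using rows by (auto simp: prod_eq_iff)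
  have grow: "inj_on R {..M} \<and> (\<forall>i\<le>M. F (R i)) \<and> (\<forall>i\<le>M. \<forall>t\<ge>1. R i \<noteq> ray (Y e) (1,0) t)
     \<and> (\<forall>i s. b < i \<longrightarrow> i \<le> M \<longrightarrow> b < s \<longrightarrow> R i \<noteq> Y s)"
    if "b \<le> M" "inj_on R {y..M}" "\<And>i t. 1 \<le> t \<Longrightarrow> b < i \<Longrightarrow> i \<le> M \<Longrightarrow> R i \<noteq> ray (Y y) (1,0) t" for M
  proof (rule growth_free[where j = y and r = r and L = "ray (Y y) (1,0)"])
    show "e0 \<le> y" "y \<le> b" "b \<le> M" using xy that by (auto simp: b_def)
    show "R t = Y t" if "t \<le> b" for t by (rule Rb[OF that])
    show "\<exists>k'\<ge>1. ray (Y y) (1,0) k' = ray (Y e) (1,0) t'" if "ray (Y y) (1,0) i = ray (Y e) (1,0) t" for i t t'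
      using that Ltau by blast
  qed (use that left Fb r0 rstp Lleft offx infinite_range_ray in auto)
  \<comment> \<open>Both rays belong in the induction. A hit of the ray at \<open>Y y\<close> moves
    back by one period to a hit of the ray at \<open>Y x\<close>; a hit of the latter closes a cycle
    that the ray at \<open>Y y\<close> leaves on the left and the rest of \<open>Y\<close> on the
    right.\<close>
  have main: "inj_on R {x..M} \<and> (\<forall>t i. 1 \<le> t \<longrightarrow> b < i \<longrightarrow> i \<le> M \<longrightarrow>
      R i \<noteq> ray (Y x) (1,0) t \<and> R i \<noteq> ray (Y y) (1,0) t)" if "b \<le> M" for M
    using that
  proof (induction M rule: dec_induct)
    case base
    have "inj_on R {x..b}" using Rb by (auto simp: inj_on_def ipath_inj[OF Yip])
    then show ?case by simp
  next
    case (step M)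
    then have IHinj: "inj_on R {x..M}" and IHoff: "\<And>t i. 1 \<le> t \<Longrightarrow> b < i \<Longrightarrow> i \<le> M \<Longrightarrow>
      R i \<noteq> ray (Y x) (1,0) t \<and> R i \<noteq> ray (Y y) (1,0) t" by auto
    have offl: "R i \<noteq> ray (Y x) (1,0) t" "R i \<noteq> ray (Y y) (1,0) t" if "1 \<le> t" "i \<le> M" for t i
      using IHoff[OF that(1), of i] offx[OF that(1), of i] Rb[of i] that(2) by (cases "i \<le> b"; force)+
    have Mq: "R (Suc M) = R (Suc M - q) + v" "x \<le> Suc M - q" "Suc M - q \<le> M"
      using Rq[of "Suc M - q"] step.hyps q by (auto simp: b_def)
    have newy: "R (Suc M) \<noteq> ray (Y y) (1,0) t" if t: "1 \<le> t" for t
    proof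
      assume "R (Suc M) = ray (Y y) (1,0) t"
      then have "R (Suc M - q) = ray (Y x) (1,0) t"
        using Mq(1) v(2) by (auto simp: prod_eq_iff)
      then show False using offl(1)[OF t Mq(3)] by simp
    qed
    \<comment> \<open>Equal points from \<open>y\<close> on move back by one period to equal points
      from \<open>x\<close> on.\<close>
    have "inj_on R {y..Suc M}"
    proof -
      have "R (Suc M) \<noteq> R s" if s: "y \<le> s" "s \<le> M" for s
      proof
        assume "R (Suc M) = R s"
        moreover have "R s = R (s - q) + v" using Rq[of "s - q"] s q by simp
        ultimately have "R (Suc M - q) = R (s - q)" using Mq(1) by simp
        moreover have "s - q \<in> {x..M}" "Suc M - q \<in> {x..M}" using Mq s q by auto
        ultimately have "Suc M - q = s - q" using inj_onD[OF IHinj] by blast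
        then show False using s q step.hyps by (auto simp: b_def)
      qed
      moreover have "inj_on R {y..M}" by (rule inj_on_subset[OF IHinj]) (use xy in auto)
      moreover have "{y..Suc M} = insert (Suc M) {y..M}" using step.hyps by (auto simp: b_def)
      moreover have "R (Suc M) \<notin> R ` {y..M}" using \<open>\<And>s. y \<le> s \<Longrightarrow> s \<le> M \<Longrightarrow> R (Suc M) \<noteq> R s\<close>
        by (metis atLeastAtMost_iff imageE)
      then have "R (Suc M) \<notin> R ` ({y..M} - {Suc M})" by blast
      ultimately show ?thesis by (simp only: inj_on_insert simp_thms)
    qed
    moreover have "R i \<noteq> ray (Y y) (1,0) t" if "1 \<le> t" "i \<le> Suc M" for i t
      using that newy offl(2)[of t i] by (cases "i = Suc M") auto
    ultimately have G: "inj_on R {..Suc M}" "\<And>i s. b < i \<Longrightarrow> i \<le> Suc M \<Longrightarrow> b < s \<Longrightarrow> R i \<noteq> Y s"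
      using grow[of "Suc M"] step.hyps by auto
    have newx: "R (Suc M) \<noteq> ray (Y x) (1,0) t" if t: "1 \<le> t" for t
    proof
      assume eq: "R (Suc M) = ray (Y x) (1,0) t"
      define n where "n = Suc M - x"
      define Z1 where "Z1 = (\<lambda>k. R (x + k))"
      define D where "D = ray (R (Suc M)) (-1,0)"
      define Z where "Z = cat Z1 n D"
      have xn: "x + n = Suc M" "2 \<le> n" using step.hyps q by (auto simp: n_def b_def)
      have D: "D i = ray (Y x) (1,0) (t - i)" if "i \<le> t" for i
        using that by (auto simp: D_def eq prod_eq_iff)
      have D0: "D 0 = Z1 n" by (simp add: D_def Z1_def xn)
      have Zc: "simple_cycle Z (n + t)" unfolding Z_def
      proof (rule cycle_cat)
        show "arc Z1 n" using inj_on_shift[OF G(1), of x n] stp_unit[OF rstp] xn by (simp add: arc_def Z1_def)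
        show "arc D t" by (simp add: D_def arc_ray)
        show "D 0 = Z1 n" by (rule D0)
        show "D t = Z1 0" using D[of t] Rx[of x] xy by (simp add: Z1_def)
        show "3 \<le> n + t" using t xn by simp
        show "Z1 i \<noteq> D j" if "i \<le> n" "1 \<le> j" "j < t" for i j
        proof (cases "x + i \<le> M")
          case True then show ?thesis using offl(1)[of "t - j" "x + i"] D[of j] that by (auto simp: Z1_def)
        next
          case False
          then have "x + i = Suc M" using that xn by simp
          then show ?thesis using eq D[of j] that by (auto simp: Z1_def ray_inj)
        qed
      qed (rule t)
      have im: "Z ` {..n + t} = Z1 ` {..n} \<union> D ` {..t}"
        unfolding Z_def by (rule image_cat) (rule D0)
      have sub: "Z1 ` {..n} \<subseteq> R ` {..Suc M}" using xn by (auto simp: Z1_def)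
      have idx: "0 < y - x" "y - x < n + t" "0 < b - x" "b - x < n + t" using step.hyps q xn by (auto simp: b_def)
      have Zy: "Z (y - x - 1) = Y (y - 1)" "Z (y - x) = Y y" "Z (Suc (y - x)) = R (Suc y)"
        using step.hyps q xn Rb[of "y - 1"] Rb[of y] by (auto simp: Z_def Z1_def b_def)
      have Zb: "Z (b - x - 1) = Y (b - 1)" "Z (b - x) = Y b" "Z (Suc (b - x)) = R (Suc b)"
        using step.hyps q xn Rb[of "b - 1"] Rb[of b] by (auto simp: Z_def Z1_def b_def)
      have right: "tn (Y (b - 1) - Y b) (R (Suc b) - Y b) < tn (Y (b - 1) - Y b) (Y (Suc b) - Y b)"
        using left Rb[of b] Rb[of "b - 1"] by simp
      have offA: "ray (Y y) (1,0) j \<notin> Z ` {..n + t}" if j: "1 \<le> j" for j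
      proof -
        have "ray (Y y) (1,0) j \<notin> R ` {..Suc M}"
        proof
          assume "ray (Y y) (1,0) j \<in> R ` {..Suc M}"
          then obtain i where i: "i \<le> Suc M" "R i = ray (Y y) (1,0) j" by auto
          then show False using newy[OF j] offl(2)[OF j, of i] by (cases "i = Suc M") auto
        qed
        moreover have "ray (Y y) (1,0) j \<notin> D ` {..t}"
        proof
          assume "ray (Y y) (1,0) j \<in> D ` {..t}"
          then obtain i where "ray (Y y) (1,0) j = D i" by auto
          then have "snd (ray (Y y) (1,0) j) = snd (Y x)" by (simp only: D_def eq) simp
          then show False using rows by simp
        qed
        ultimately show ?thesis unfolding im using sub by blast
      qed
      have offB: "Y (b + j) \<notin> Z ` {..n + t}" if j: "1 \<le> j" for j
      proof -
        have "Y (b + j) \<notin> R ` {..Suc M}"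
        proof
          assume "Y (b + j) \<in> R ` {..Suc M}"
          then obtain i where i: "i \<le> Suc M" "R i = Y (b + j)" by auto
          show False
          proof (cases "i \<le> b")
            case True then show False using i Rb[of i] j by (simp add: ipath_inj[OF Yip])
          next
            case False then show False using G(2)[of i "b + j"] i j by simp
          qed
        qed
        moreover have "Y (b + j) \<notin> D ` {..t}"
        proof
          assume "Y (b + j) \<in> D ` {..t}"
          then obtain i where i: "i \<le> t" "Y (b + j) = D i" by auto
          show False
          proof (cases "i = t")
            case True then show False using D[of t] i j q by (simp add: ipath_inj[OF Yip] b_def)
          next
            case False
            then have "1 \<le> t - i" using i(1) by simp
            then show False using D[of i] i offx(1)[of "t - i" "b + j"] by simp
          qed
        qed
        ultimately show ?thesis unfolding im using sub by blast
      qed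
      show False
      proof (rule two_sided_escape[OF Zc idx, of "ray (Y y) (1,0)" "\<lambda>k. Y (b + k)"])
        show "ray (Y y) (1,0) j \<notin> Z ` {..<n + t}" if "1 \<le> j" for j using offA[OF that] by force
        show "Y (b + j) \<notin> Z ` {..<n + t}" if "1 \<le> j" for j using offB[OF that] by force
        show "infinite (range (ray (Y y) (1,0)))" by (rule infinite_range_ray) simp
        show "infinite (range (\<lambda>k. Y (b + k)))" by (rule ipath_tail_infinite[OF Yip])
        show "unit (Y (b + Suc k) - Y (b + k))" for k using ipath_step[OF Yip] by simp
      qed (use Lleft right in \<open>simp_all only: Zy Zb\<close>, simp_all)
    qed
    have "R i \<noteq> ray (Y x) (1,0) t \<and> R i \<noteq> ray (Y y) (1,0) t" if "1 \<le> t" "i \<le> Suc M" for i t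
      using that newx newy offl[of t i] by (cases "i = Suc M") auto
    then show ?case using inj_on_subset[OF G(1), of "{x..Suc M}"] by auto
  qed
  show False
  proof (rule growth_impossible[where j = y and b = b and R = R and r = r and L = "ray (Y y) (1,0)"])
    show "R t = Y t" if "t \<le> b" for t by (rule Rb[OF that])
    show "inj_on R {y..}"
    proof (rule inj_onI)
      fix i j assume "i \<in> {y..}" "j \<in> {y..}" "R i = R j"
      moreover have "inj_on R {x..max b (max i j)}" using main[of "max b (max i j)"] by auto
      ultimately show "i = j" using xy by (auto dest!: inj_onD)
    qed
    show "R i \<noteq> ray (Y y) (1,0) t" if "1 \<le> t" "b < i" for t i using main[of i] that by auto
    show "\<exists>k'\<ge>1. ray (Y y) (1,0) k' = ray (Y e) (1,0) t'" if "ray (Y y) (1,0) i = ray (Y e) (1,0) t" for i t t'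
      using that Ltau by blast
    show "e0 \<le> y" "y \<le> b" using xy by (auto simp: b_def)
  qed (use left Fb r0 rstp Lleft offx infinite_range_ray in auto)
qed

end

section \<open>Paths without a free axis ray\<close>

text \<open>Records on the row of the origin separate the laps: the path starts on this row and,
  without a free axis ray, visits it arbitrarily far out in both directions.\<close>

definition erec :: "(nat \<Rightarrow> pos) \<Rightarrow> nat \<Rightarrow> bool" where
  "erec P k \<longleftrightarrow> snd (P k) = 0 \<and> (\<forall>j<k. snd (P j) = 0 \<longrightarrow> fst (P j) < fst (P k))"

definition wrec :: "(nat \<Rightarrow> pos) \<Rightarrow> nat \<Rightarrow> bool" where
  "wrec P k \<longleftrightarrow> snd (P k) = 0 \<and> (\<forall>j<k. snd (P j) = 0 \<longrightarrow> fst (P k) < fst (P j))"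

lemma erec_above:
  assumes "ipath P" "snd (P k) = 0"
  shows "\<exists>j\<le>k. erec P j \<and> fst (P k) \<le> fst (P j)"
  using assms(2)
proof (induction k rule: less_induct)
  case (less k)
  show ?case
  proof (cases "erec P k")
    case False
    then obtain j where j: "j < k" "snd (P j) = 0" "fst (P k) \<le> fst (P j)"
      using less.prems by (auto simp: erec_def not_less)
    from less.IH[OF j(1,2)] show ?thesis using j by (metis less_imp_le order_trans)
  qed auto
qed

lemma wrec_below:
  assumes "ipath P" "snd (P k) = 0"
  shows "\<exists>j\<le>k. wrec P j \<and> fst (P j) \<le> fst (P k)"
  using assms(2)
proof (induction k rule: less_induct)
  case (less k)
  show ?case
  proof (cases "wrec P k")
    case False
    then obtain j where j: "j < k" "snd (P j) = 0" "fst (P j) \<le> fst (P k)"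
      using less.prems by (auto simp: wrec_def not_less)
    from less.IH[OF j(1,2)] show ?thesis using j by (metis less_imp_le order_trans)
  qed auto
qed

lemma erec_mono: "erec P i \<Longrightarrow> erec P j \<Longrightarrow> i \<le> j \<Longrightarrow> fst (P i) \<le> fst (P j)"
  unfolding erec_def by (metis le_neq_implies_less less_imp_le order_refl)

lemma wrec_mono: "wrec P i \<Longrightarrow> wrec P j \<Longrightarrow> i \<le> j \<Longrightarrow> fst (P j) \<le> fst (P i)"
  unfolding wrec_def by (metis le_neq_implies_less less_imp_le order_refl)

lemma finite_prefix_bound: "\<exists>B. \<forall>k\<le>(n::nat). \<bar>fst (P k :: pos)\<bar> < B \<and> \<bar>snd (P k)\<bar> < B"
  using finite_bound_pos[of "P ` {..n}"] by auto

context tsys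
begin

text \<open>One more than the number of pairs of a state and an incoming direction, so
  \<open>depth\<close> visible points contain two of the same type.\<close>

definition depth :: nat where
  "depth = card (Q \<times> {v. unit v}) + 1"

text \<open>From its first visit \<open>T\<close> to height \<open>m\<close> on, the path is
  replaced by a climb. As the climb is west of the top point \<open>P s\<close>, the visible point
  \<open>e\<close> on the axis row has the east ray on its left. The leftmost path with this prefix
  has visible points in \<open>depth\<close> rows below the axis, all of them after \<open>e\<close>
  and left; two of the same type form a descending pair.\<close>

lemma lap_impossible:
  assumes no: "\<not> up_run stp q0" and P: "irun stp q0 P st"
    and idx: "s < u" "u < T" and rs: "snd (P s) = m - 1" and rT: "snd (P T) = m"
    and below: "\<And>k. k < T \<Longrightarrow> snd (P k) < m" and m: "1 < m"
    and west: "fst (P T) < fst (P s)" and u: "erec P u"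
    and deep: "\<exists>k\<le>u. snd (P k) \<le> - int depth"
  shows False
proof -
  note ip = irun_ipath[OF P]
  define X where "X = cat P T (ray (P T) (0,1))"
  have X1: "X k = P k" if "k \<le> T" for k using that by (simp add: X_def)
  have X2: "X k = (fst (P T), m + int (k - T))" if "T \<le> k" for k
    using that rT by (auto simp: X_def cat_def prod_eq_iff)
  obtain B where B: "\<And>k. k \<le> T \<Longrightarrow> \<bar>fst (P k)\<bar> < B" using finite_prefix_bound[of T P] by blast
  have XB: "fst (X k) < B" for k
    using B[of k] B[of T] X1[of k] X2[of k] by (cases "k \<le> T") auto
  have u0: "snd (P u) = 0" using u by (simp add: erec_def)
  have "snd (X u) = 0" using idx u0 by (simp add: X1)
  then obtain e where e: "evis X e" "snd (X e) = 0"
    using evis_exists[of X u 0 B] XB less_imp_le by metis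
  have eT: "e < T"
  proof (rule ccontr)
    assume "\<not> e < T"
    then have "snd (X e) \<ge> m" using X2[of e] by simp
    then show False using e m by simp
  qed
  have ue: "u \<le> e"
  proof (rule ccontr)
    assume "\<not> u \<le> e"
    then have "fst (P e) < fst (P u)" using u e X1[of e] eT by (simp add: erec_def)
    moreover have "fst (X u) \<le> fst (X e)" using e \<open>snd (X u) = 0\<close> unfolding evis_def by metis
    ultimately show False using X1[of u] X1[of e] idx eT by simp
  qed
  define F where "F = (\<lambda>v::pos. snd v < m)"
  have runP: "run stp q0 P st T" using P by (simp add: irun_def)
  \<comment> \<open>The common prefix ends at \<open>Suc e\<close>: it fixes the step out of
    \<open>e\<close>, so the side of the east ray at \<open>e\<close> carries over from
    \<open>X\<close> to every member.\<close>
  have memX: "mem P (Suc e) e F X" unfolding X_def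
  proof (rule mem_splice[OF runP])
    show "F (P k)" if "k < T" for k using below[OF that] by (simp add: F_def)
    show "P k \<noteq> ray (P e) (1,0) t" if "k \<le> T" "1 \<le> t" for k t
      using evis_ray[OF e(1) that(2), of "ray (P e) (1,0) t" k] X1[of e] X1[of k] eT that by auto
    show "ray (P T) (0,1) k \<noteq> ray (P e) (1,0) t" for k t
      using e(2) X1[of e] eT rT m by (auto simp: prod_eq_iff)
    show "inj (ray (P T) (0,1))" by (auto simp: inj_on_def ray_inj)
    show "ray (P T) (0,1) k \<noteq> P i" if "i < T" for k i using below[OF that] rT by (auto simp: ray_def prod_eq_iff)
    show "ray (P T) (0,1) (Suc k) = ray (P T) (0,1) k + (0,1)" for k by (simp add: prod_eq_iff)
    show "stp (lab (ray (P T) (0,1) k)) (ray (P T) (0,1) (Suc k) - ray (P T) (0,1) k) (lab (ray (P T) (0,1) (Suc k)))"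
      if "F (ray (P T) (0,1) k)" for k using that rT by (simp add: F_def)
  qed (use eT in auto)
  note ipX = mem_ipath[OF memX]
  have leftX: "eleft X e"
  proof (rule visible_under_record[OF ipX _ e(1)])
    show "s < e" using idx ue by simp
    show "snd (X s) = m - 1" using rs X1[of s] idx by simp
    show "snd (X e) < m - 1" using e m by simp
    show "fst (X k) < fst (X s)" if "m \<le> snd (X k)" for k
    proof -
      have "T \<le> k"
      proof (rule ccontr)
        assume "\<not> T \<le> k"
        then show False using that below[of k] X1[of k] by simp
      qed
      then show ?thesis using X2[of k] X1[of s] west idx by simp
    qed
    show "fst (X k) < B" for k by (rule XB)
  qed
  obtain Y where lm: "leftmost P (Suc e) e F Y" using leftmost_exists[OF memX] by blast
  interpret leftmost_path stp q0 Q P "Suc e" e F Y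
  proof
    show "leftmost P (Suc e) e F Y" by (rule lm)
    show "F (ray (P e) (1,0) t)" for t using e(2) X1[of e] eT m by (simp add: F_def)
  qed (auto simp: F_def)
  have YP: "Y k = P k" if "k \<le> Suc e" for k using memY that by (simp add: mem_def)
  have Ye0: "snd (Y e) = 0" using YP[of e] X1[of e] e eT by simp
  have leftY: "eleft Y e"
    using leftX X1[of e] X1[of "e - 1"] X1[of "Suc e"] YP[of e] YP[of "e - 1"] YP[of "Suc e"] eT
    by (simp add: leftd_def)
  \<comment> \<open>A member staying in \<open>F\<close> forever would be an infinite run that
    avoids an east ray, which already yields periodicity.\<close>
  have leaves: "\<exists>k. \<not> F (Y k)"
  proof (rule ccontr)
    assume "\<not> ?thesis"
    then have "stp (lab (Y k)) (Y (Suc k) - Y k) (lab (Y (Suc k)))" for k using Y_stp by blast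
    then have "irun stp q0 Y (\<lambda>k. lab (Y k))"
      using memY lab_0 inj_on_subset[of Y UNIV] by (auto simp: irun_def run_def mem_def)
    then have "up_run stp q0" by (rule periodic_if_free_east) (rule Y_tau)
    then show False using no by simp
  qed
  then obtain T' where T': "\<not> F (Y T')" by blast
  have climb: "snd (Y k) \<ge> m \<and> fst (Y k) = fst (Y T')" if "T' \<le> k" for k
    using Y_climbs[OF T', of "k - T'"] that T' by (auto simp: F_def)
  obtain C where C: "\<And>k. k \<le> T' \<Longrightarrow> \<bar>fst (Y k)\<bar> < C" using finite_prefix_bound[of T' Y] by blast
  have YC: "fst (Y k) < C" for k
    using C[of k] C[of T'] climb[of k] by (cases "k \<le> T'") auto
  \<comment> \<open>In the end \<open>Y\<close> climbs in one column, so it is bounded to the east,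
    and a column beyond it joins the rays of any two visible points.\<close>
  have pair: "snd (Y b) < snd (Y a) \<longleftrightarrow> eleft Y b" if "a < b" "evis Y a" "evis Y b" "snd (Y a) \<noteq> snd (Y b)" for a b
  proof -
    have "snd (Y b) < snd (Y a) \<Longrightarrow> eleft Y b"
      by (rule visible_pair(1)[OF Yip that(1-3) YC YC]) (use YC less_irrefl in \<open>metis\<close>)
    moreover have "snd (Y a) < snd (Y b) \<Longrightarrow> \<not> eleft Y b"
      by (rule visible_pair(2)[OF Yip that(1-3) YC YC]) (use YC less_irrefl in \<open>metis\<close>)
    ultimately show ?thesis using that(4) by linarith
  qed
  have vis: "\<exists>k. evis Y k \<and> snd (Y k) = r" if r: "- int depth \<le> r" "r \<le> 0" for r
  proof -
    obtain k where k: "k \<le> u" "snd (P k) \<le> - int depth" using deep by blast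
    have "Y k = P k" using YP[of k] k ue by simp
    moreover have "snd (Y 0) = 0" using memY by (simp add: mem_def)
    ultimately obtain j where "snd (Y j) = r" using row_visited[OF Yip, of k r] k r by auto
    then show ?thesis using evis_exists[of Y j r C] YC less_imp_le by metis
  qed
  define i where "i r = (SOME k. evis Y k \<and> snd (Y k) = - int (Suc r))" for r :: nat
  have i: "evis Y (i r)" "snd (Y (i r)) = - int (Suc r)" if "r < depth" for r
    using someI_ex[OF vis[of "- int (Suc r)"]] that by (auto simp: i_def)
  \<comment> \<open>If the lower point came first, \<open>e\<close> would be a later and higher
    visible point and could not be left.\<close>
  have ie: "e < i r" "eleft Y (i r)" if r: "r < depth" for r
  proof -
    have "\<not> i r < e" using pair[of "i r" e] i[OF r] evis_e leftY Ye0 by auto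
    moreover have "i r \<noteq> e" using i(2)[OF r] Ye0 by auto
    ultimately show *: "e < i r" by simp
    show "eleft Y (i r)" using pair[OF *] i[OF r] evis_e Ye0 by auto
  qed
  let ?f = "\<lambda>r. (lab (Y (i r)), Y (i r - 1) - Y (i r))"
  have "?f r \<in> Q \<times> {v. unit v}" if "r < depth" for r
  proof -
    have "F (Y (i r))" using i(2)[OF that] m by (simp add: F_def)
    then show ?thesis using lab_Q ipath_back[OF Yip, of "i r"] ie(1)[OF that] by auto
  qed
  then have "?f ` {..<depth} \<subseteq> Q \<times> {v. unit v}" by blast
  then have "card (?f ` {..<depth}) \<le> card (Q \<times> {v. unit v})"
    using finQ finite_units by (intro card_mono) auto
  then have "\<not> inj_on ?f {..<depth}"
    using card_image[of ?f "{..<depth}"] by (auto simp: depth_def)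
  then obtain r1 r2 where r: "r1 < depth" "r2 < depth" "r1 \<noteq> r2" "?f r1 = ?f r2"
    unfolding inj_on_def by blast
  have contra: False if r: "r1 < depth" "r2 < depth" "?f r1 = ?f r2" and lt: "i r1 < i r2" and ne: "r1 \<noteq> r2" for r1 r2
  proof (rule no_descending_pair[of m "i r1" "i r2"])
    show "F w \<longleftrightarrow> snd w < m" for w by (simp add: F_def)
    show "same_type (i r1) (i r2)" using r(3) by (simp add: same_type_def)
    show "snd (Y (i r2)) < snd (Y (i r1))"
      using pair[OF lt] i[OF r(1)] i[OF r(2)] ie(2)[OF r(2)] ne by auto
    show "Suc e \<le> i r1" using ie(1)[OF r(1)] by simp
  qed (use leaves lt i r ie Ye0 in auto)
  have "i r1 \<noteq> i r2" using i(2)[OF r(1)] i(2)[OF r(2)] r(3) by auto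
  then show False using contra[of r1 r2] contra[of r2 r1] r by (metis nat_neq_iff)
qed

end

text \<open>By \<open>quiet\<close> the path exceeds its old maximal height only after
  \<open>v\<close>, so both records are available. If it does so west of the old top point,
  \<open>lap_impossible\<close> applies with the east record \<open>u\<close>; if east of it, the
  mirror image turns the west record \<open>v\<close> into an east record.\<close>

lemma lap_contradiction:
  assumes t: "tsys stp q0 Q" and no: "\<not> up_run stp q0" and P: "irun stp q0 P st"
    and uv: "u < v" and u: "erec P u" and v: "wrec P v"
    and quiet: "\<And>k. u < k \<Longrightarrow> k < v \<Longrightarrow> \<exists>j\<le>u. snd (P k) \<le> snd (P j)"
    and deep: "\<exists>k\<le>u. snd (P k) \<le> - int (tsys.depth Q)" and high: "\<exists>k\<le>u. 1 < snd (P k)"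
    and unb: "\<And>X. \<exists>k. X < snd (P k)"
  shows False
proof -
  interpret tsys stp q0 Q by (rule t)
  note ip = irun_ipath[OF P]
  have fin: "finite ((\<lambda>k. snd (P k)) ` {..u})" "(\<lambda>k. snd (P k)) ` {..u} \<noteq> {}" by auto
  define m where "m = Max ((\<lambda>k. snd (P k)) ` {..u}) + 1"
  have "m - 1 \<in> (\<lambda>k. snd (P k)) ` {..u}" using Max_in[OF fin] by (simp add: m_def)
  then obtain s where s: "s \<le> u" "snd (P s) = m - 1" by auto
  have le: "snd (P k) < m" if "k \<le> u" for k
    using Max_ge[OF fin(1), of "snd (P k)"] that by (force simp: m_def)
  have le': "snd (P k) < m" if kv: "k < v" for k
  proof (cases "k \<le> u")
    case False
    then obtain j where "j \<le> u" "snd (P k) \<le> snd (P j)" using quiet[of k] kv by auto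
    then show ?thesis using le[of j] by simp
  qed (rule le)
  have m1: "2 < m" using high le by force
  have rows: "snd (P u) = 0" "snd (P v) = 0" using u v by (auto simp: erec_def wrec_def)
  define T where "T = (LEAST k. m \<le> snd (P k))"
  have "\<exists>k. m \<le> snd (P k)" using unb[of m] less_imp_le by blast
  then have T: "m \<le> snd (P T)" unfolding T_def by (rule LeastI_ex)
  have T2: "snd (P k) < m" if "k < T" for k
    using not_less_Least[of k "\<lambda>k. m \<le> snd (P k)"] that by (simp add: T_def not_le)
  have vT: "v < T"
  proof (rule ccontr)
    assume "\<not> v < T"
    then show False using le'[of T] T rows m1 by (cases "T = v") auto
  qed
  then obtain T0 where T0: "T = Suc T0" using not0_implies_Suc by (metis not_less_zero)
  have step: "unit (P T - P T0)" using ipath_step[OF ip, of T0] T0 by simp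
  have rT: "snd (P T) = m" "P T0 = (fst (P T), m - 1)"
  proof -
    have "snd (P T0) < m" using T2[of T0] T0 by simp
    with step T show "snd (P T) = m" "P T0 = (fst (P T), m - 1)"
      by (cases "P T"; cases "P T0"; auto simp: unit_def)+
  qed
  have su: "s < u" using s rows m1 by (metis diff_gt_0_iff_gt less_trans nat_less_le one_less_numeral_iff order_less_irrefl semiring_norm(76))
  have ne: "fst (P T) \<noteq> fst (P s)"
  proof
    assume "fst (P T) = fst (P s)"
    then have "P T0 = P s" using rT s by (simp add: prod_eq_iff)
    then have "T0 = s" by (simp add: ipath_inj[OF ip])
    then show False using T0 vT uv su by simp
  qed
  show False
  proof (cases "fst (P T) < fst (P s)")
    case True
    show False
      by (rule lap_impossible[OF no P su _ s(2) rT(1) T2 _ True u deep]) (use uv vT m1 in auto)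
  next
    case False
    define f where "f = (\<lambda>v::pos. (- fst v, snd v))"
    have f: "grid_iso f" unfolding f_def by (rule iso_mirror)
    define P' where "P' = f \<circ> P"
    have ff: "f \<circ> P' = P" by (auto simp: f_def P'_def)
    have P': "irun (\<lambda>q v. stp q (f v)) q0 P' st" using irun_iso[OF f, of stp q0 P' st] P ff by simp
    have no': "\<not> up_run (\<lambda>q v. stp q (f v)) q0" using up_run_iso[OF f, of stp q0] no by argo
    have t': "tsys (\<lambda>q v. stp q (f v)) q0 Q" by (rule tsys_iso[OF f t])
    have "snd (P' k) = snd (P k)" for k by (simp add: P'_def f_def)
    then have deep': "\<exists>k\<le>v. snd (P' k) \<le> - int (tsys.depth Q)"
      using deep uv by (metis less_imp_le order_trans)
    show False
      by (rule tsys.lap_impossible[OF t' no' P' _ vT, of s m])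
        (use su uv s rT T2 m1 False ne v deep' in \<open>auto simp: P'_def f_def erec_def wrec_def\<close>)
  qed
qed

theorem irun_periodic:
  assumes t: "tsys stp q0 Q" and P: "irun stp q0 P st"
  shows "up_run stp q0"
proof (rule ccontr)
  assume no: "\<not> up_run stp q0"
  interpret tsys stp q0 Q by (rule t)
  note ip = irun_ipath[OF P]
  have P0: "P 0 = (0,0)" using P by (simp add: irun_def run_def)
  \<comment> \<open>If a half axis were hit only boundedly far out, the outermost hit would have a
    free axis ray. The symmetry \<open>f\<close> selects the half axis.\<close>
  have unb: "\<exists>k. snd (f (P k)) = 0 \<and> X < fst (f (P k))" if f: "grid_iso f" for f X
  proof (rule ccontr)
    assume "\<not> ?thesis"
    then have bd: "snd ((f \<circ> P) k) = 0 \<Longrightarrow> fst ((f \<circ> P) k) \<le> X" for k by (auto simp: not_less)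
    have "snd ((f \<circ> P) 0) = 0" using P0 iso_zero[OF f] by simp
    from evis_exists[of "f \<circ> P", OF this bd] obtain e where e: "evis (f \<circ> P) e" by blast
    define d where "d = inv f (1,0)"
    have fd: "f d = (1,0)" using f by (simp add: d_def surj_f_inv_f[OF bij_is_surj[OF iso_bij[OF f]]])
    have "unit d" using iso_unit[OF f, of d] fd by simp
    moreover have "P k \<noteq> ray (P e) d i" if "1 \<le> i" for k i
    proof
      assume "P k = ray (P e) d i"
      then have "(f \<circ> P) k = ray ((f \<circ> P) e) (1,0) i" by (simp add: iso_ray[OF f] fd)
      then show False using evis_ray[OF e that, of "(f \<circ> P) k" k] by simp
    qed
    ultimately show False using periodic_if_free_ray[OF t P] no by blast
  qed
  have unbE: "\<exists>k. snd (P k) = 0 \<and> X < fst (P k)" for X using unb[OF iso_id, of X] by simp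
  have unbW: "\<exists>k. snd (P k) = 0 \<and> fst (P k) < X" for X
    using unb[OF iso_mirror(1), of "- X"] by auto
  have unbN: "\<exists>k. X < snd (P k)" for X using unb[OF iso_cw, of X] by (auto simp: cw_def)
  have unbS: "\<exists>k. snd (P k) < X" for X
    using unb[OF iso_comp[OF iso_cw iso_mirror(2)], of "- X"] by (auto simp: cw_def)
  define dp where "dp = int (tsys.depth Q)"
  \<comment> \<open>Both bounds are beyond \<open>depth\<close> and 1, so they supply
    \<open>deep\<close> and \<open>high\<close> also after north and south are exchanged.\<close>
  obtain k1 k2 where k12: "snd (P k1) > dp + 1" "snd (P k2) < - dp - 1" using unbN unbS by meson
  have dp: "0 < dp" by (simp add: dp_def depth_def)
  define K where "K = max k1 k2"
  have later_e: "\<exists>k>n. erec P k" for n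
  proof -
    obtain B where B: "\<And>k. k \<le> n \<Longrightarrow> \<bar>fst (P k)\<bar> < B" using finite_prefix_bound[of n P] by blast
    obtain k where "snd (P k) = 0" "B < fst (P k)" using unbE by blast
    with erec_above[OF ip this(1)] obtain j where "erec P j" "B < fst (P j)" by force
    then show ?thesis using B[of j] by (meson abs_le_D1 less_imp_le not_le)
  qed
  have later_w: "\<exists>k>n. wrec P k" for n
  proof -
    obtain B where B: "\<And>k. k \<le> n \<Longrightarrow> \<bar>fst (P k)\<bar> < B" using finite_prefix_bound[of n P] by blast
    obtain k where "snd (P k) = 0" "fst (P k) < - B" using unbW by blast
    with wrec_below[OF ip this(1)] obtain j where j: "wrec P j" "fst (P j) < - B" by force
    then have "\<not> j \<le> n" using B[of j] by (auto simp: abs_less_iff)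
    then show ?thesis using j by (auto simp: not_le)
  qed
  obtain u0 where u0: "K < u0" "erec P u0" using later_e by blast
  \<comment> \<open>The next west record \<open>v\<close>, the last east record \<open>u\<close>
    before it and the last west record \<open>w\<close> up to \<open>u\<close> are chosen so that
    between \<open>u\<close> and \<open>v\<close> the axis row is met only strictly between
    \<open>P w\<close> and \<open>P u\<close>, as \<open>no_crossing_between\<close> asks.\<close>
  define v where "v = (LEAST k. u0 < k \<and> wrec P k)"
  have v: "u0 < v" "wrec P v" unfolding v_def using LeastI_ex[OF later_w[of u0]] by auto
  have vmin: "\<not> wrec P k" if "u0 < k" "k < v" for k
    using not_less_Least[of k "\<lambda>k. u0 < k \<and> wrec P k"] that by (simp add: v_def)
  define u where "u = Max {k. k < v \<and> erec P k}"
  have finu: "finite {k. k < v \<and> erec P k}" "u0 \<in> {k. k < v \<and> erec P k}" using u0 v by auto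
  have "u \<in> {k. k < v \<and> erec P k}" unfolding u_def by (rule Max_in) (use finu in auto)
  then have u: "u < v" "erec P u" by auto
  have u0u: "u0 \<le> u" using Max_ge[OF finu] by (simp add: u_def)
  have umax: "\<not> erec P k" if "u < k" "k < v" for k
    using Max_ge[OF finu(1), of k] that unfolding u_def[symmetric] by auto
  define w where "w = Max {k. k \<le> u \<and> wrec P k}"
  have "wrec P 0" using P0 by (simp add: wrec_def)
  then have finw: "finite {k. k \<le> u \<and> wrec P k}" "0 \<in> {k. k \<le> u \<and> wrec P k}" by auto
  have "w \<in> {k. k \<le> u \<and> wrec P k}" unfolding w_def by (rule Max_in) (use finw in auto)
  then have w: "w \<le> u" "wrec P w" by auto
  have wmax: "k \<le> w" if "k \<le> u" "wrec P k" for k using Max_ge[OF finw(1), of k] that by (simp add: w_def)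
  have rows: "snd (P u) = 0" "snd (P w) = 0" using u w by (auto simp: erec_def wrec_def)
  have "0 < u" using u0 u0u by simp
  then have u_pos: "0 < fst (P u)" using u(2) P0 by (auto simp: erec_def)
  have w_le: "fst (P w) \<le> 0"
    using wrec_mono[OF \<open>wrec P 0\<close> w(2)] P0 by simp
  have wu: "w < u" using w(1) u_pos w_le by (cases "w = u") auto
  have low: "fst (P w) \<le> fst (P k)" if kv: "k < v" "snd (P k) = 0" for k
  proof -
    obtain j where j: "j \<le> k" "wrec P j" "fst (P j) \<le> fst (P k)" using wrec_below[OF ip kv(2)] by blast
    have "j \<le> u" using vmin[of j] j kv u0u by (meson le_less_trans not_le)
    then have "fst (P w) \<le> fst (P j)" using wrec_mono[OF j(2) w(2)] wmax[OF _ j(2)] by simp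
    then show ?thesis using j(3) by simp
  qed
  have upp: "fst (P k) \<le> fst (P u)" if kv: "k < v" "snd (P k) = 0" for k
  proof -
    obtain j where j: "j \<le> k" "erec P j" "fst (P k) \<le> fst (P j)" using erec_above[OF ip kv(2)] by blast
    have "j \<le> u" using umax[of j] j kv by (meson le_less_trans not_le)
    then have "fst (P j) \<le> fst (P u)" by (rule erec_mono[OF j(2) u(2)])
    then show ?thesis using j(3) by simp
  qed
  have not_both: False if "u < a" "a < v" "\<And>k. k \<le> u \<Longrightarrow> snd (P k) < snd (P a)"
      "u < b" "b < v" "\<And>k. k \<le> u \<Longrightarrow> snd (P b) < snd (P k)" for a b
  proof (rule no_crossing_between[OF ip wu, of 0 v a b])
    show "fst (P w) < fst (P k) \<and> fst (P k) < fst (P u)" if k: "u < k" "k < v" "snd (P k) = 0" for k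
    proof -
      have "P k \<noteq> P w" "P k \<noteq> P u" using k wu by (auto simp: ipath_inj[OF ip])
      then have "fst (P k) \<noteq> fst (P w)" "fst (P k) \<noteq> fst (P u)" using k(3) rows by (auto simp: prod_eq_iff)
      then show ?thesis using low[OF k(2,3)] upp[OF k(2,3)] by simp
    qed
    show "fst (P w) \<le> fst (P k) \<and> fst (P k) \<le> fst (P u)" if "k \<le> u" "snd (P k) = 0" for k
      using low upp that u by auto
  qed (use rows that in auto)
  have ku: "k1 \<le> u" "k2 \<le> u" using u0 u0u by (auto simp: K_def)
  show False
  proof (cases "\<forall>k. u < k \<longrightarrow> k < v \<longrightarrow> (\<exists>j\<le>u. snd (P k) \<le> snd (P j))")
    case True
    show False
    proof (rule lap_contradiction[OF t no P u(1,2) v(2)])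
      show "\<exists>k\<le>u. snd (P k) \<le> - int (tsys.depth Q)" using k12 ku dp by (auto simp: dp_def intro!: exI[of _ k2])
      show "\<exists>k\<le>u. 1 < snd (P k)" using k12 ku dp by (auto intro!: exI[of _ k1])
    qed (use True unbN in auto)
  next
    case False
    then obtain a where a0: "u < a" "a < v" "\<not> (\<exists>j\<le>u. snd (P a) \<le> snd (P j))" by blast
    then have a: "u < a" "a < v" "\<And>k. k \<le> u \<Longrightarrow> snd (P k) < snd (P a)" by (simp_all, meson not_le)
    \<comment> \<open>Since \<open>a\<close> rises above the whole old path, no point before
      \<open>v\<close> sinks below all of it; in the mirror image this is the hypothesis
      \<open>quiet\<close> of \<open>lap_contradiction\<close>.\<close>
    have quiet: "\<exists>j\<le>u. snd (P j) \<le> snd (P k)" if "u < k" "k < v" for k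
      using not_both[OF a that] by (meson not_le)
    define f where "f = (\<lambda>v::pos. (fst v, - snd v))"
    have f: "grid_iso f" unfolding f_def by (rule iso_mirror)
    define P' where "P' = f \<circ> P"
    have ff: "f \<circ> P' = P" by (auto simp: f_def P'_def)
    have P': "irun (\<lambda>q v. stp q (f v)) q0 P' st" using irun_iso[OF f, of stp q0 P' st] P ff by simp
    have no': "\<not> up_run (\<lambda>q v. stp q (f v)) q0" using up_run_iso[OF f, of stp q0] no by argo
    have t': "tsys (\<lambda>q v. stp q (f v)) q0 Q" by (rule tsys_iso[OF f t])
    show False
    proof (rule lap_contradiction[OF t' no' P' u(1)])
      show "erec P' u" "wrec P' v" using u v by (auto simp: P'_def f_def erec_def wrec_def)
      show "\<exists>j\<le>u. snd (P' k) \<le> snd (P' j)" if "u < k" "k < v" for k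
        using quiet[OF that] by (auto simp: P'_def f_def)
      show "\<exists>k\<le>u. snd (P' k) \<le> - int (tsys.depth Q)"
        using k12 ku dp by (auto simp: dp_def P'_def f_def intro!: exI[of _ k1])
      show "\<exists>k\<le>u. 1 < snd (P' k)" using k12 ku dp by (auto simp: P'_def f_def intro!: exI[of _ k2])
      show "\<exists>k. X < snd (P' k)" for X
      proof -
        obtain k where "snd (P k) < - X" using unbS by blast
        then show ?thesis by (intro exI[of _ k]) (simp add: P'_def f_def)
      qed
    qed
  qed
qed

section \<open>From transition systems to tile assembly\<close>

definition tstep :: "'g tile set \<Rightarrow> 'g tile \<Rightarrow> pos \<Rightarrow> 'g tile \<Rightarrow> bool" where
  "tstep Q q v q' \<longleftrightarrow> q \<in> Q \<and> q' \<in> Q \<and> (\<exists>d. v = vec d \<and> q d = q' (opp d))"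

lemma padd_eq: "padd u v = u + v"
  by (simp add: padd_def prod_eq_iff)

lemma vec_inj: "vec d = vec d' \<Longrightarrow> d = d'"
  by (cases d; cases d') auto

lemma unit_vec: "unit (vec d)"
  by (cases d) (auto simp: unit_def)

lemma opp_opp: "opp (opp d) = d"
  by (cases d) auto

lemma vec_opp: "vec (opp d) = - vec d"
  by (cases d) auto

lemma bond_iff:
  "bond \<alpha> u v \<longleftrightarrow> (\<exists>q q' d. \<alpha> u = Some q \<and> \<alpha> v = Some q' \<and> v - u = vec d \<and> q d = q' (opp d))"
proof -
  have "v = padd u (vec d) \<longleftrightarrow> v - u = vec d" for d by (auto simp: padd_eq prod_eq_iff)
  then show ?thesis by (auto simp: bond_def dom_def)
qed

lemma bond_sym: "bond \<alpha> u v \<Longrightarrow> bond \<alpha> v u"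
proof -
  assume "bond \<alpha> u v"
  then obtain q q' d where d: "\<alpha> u = Some q" "\<alpha> v = Some q'" "v - u = vec d" "q d = q' (opp d)"
    by (auto simp: bond_iff)
  have "u - v = vec (opp d)" using d(3) minus_diff_eq[of v u] by (simp add: vec_opp)
  then show ?thesis using d opp_opp[of d] by (metis bond_iff)
qed

text \<open>\<open>I\<close> is an initial segment of the indices, finite or everything, so that
  finite runs and infinite paths are treated at once.\<close>

lemma producible_path:
  assumes "\<alpha> (0,0) = Some \<sigma>" "ran \<alpha> \<subseteq> insert \<sigma> T" "P 0 = (0,0)" "dom \<alpha> = P ` I"
    and I: "\<And>k. Suc k \<in> I \<Longrightarrow> k \<in> I \<and> bond \<alpha> (P k) (P (Suc k))"
  shows "producible T \<sigma> \<alpha>"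
proof -
  have "k \<in> I \<Longrightarrow> (bond \<alpha>)\<^sup>*\<^sup>* (0,0) (P k)" for k
  proof (induction k)
    case (Suc k)
    then show ?case using I[of k] by (meson rtranclp.rtrancl_into_rtrancl)
  qed (simp add: assms(3))
  then have "\<forall>v\<in>dom \<alpha>. (bond \<alpha>)\<^sup>*\<^sup>* (0,0) v" unfolding assms(4) by blast
  then show ?thesis using assms(1,2) by (simp add: producible_def)
qed

text \<open>The bonds between consecutive tiles already connect the assembly; other neighbouring
  tiles may match or not. This is where temperature 1 enters.\<close>

lemma run_producible:
  assumes r: "run (tstep (insert \<sigma> T)) \<sigma> P s n"
  shows "\<exists>\<beta>. producible T \<sigma> \<beta> \<and> (\<forall>k\<le>n. \<beta> (P k) = Some (s k))"
proof -
  have inj: "inj_on P {..n}" and P0: "P 0 = (0,0)" and s0: "s 0 = \<sigma>"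
    and st: "\<And>k. k < n \<Longrightarrow> tstep (insert \<sigma> T) (s k) (P (Suc k) - P k) (s (Suc k))"
    using r by (auto simp: run_def)
  define \<beta> where "\<beta> v = (if v \<in> P ` {..n} then Some (s (the_inv_into {..n} P v)) else None)" for v
  have b: "\<beta> (P k) = Some (s k)" if "k \<le> n" for k
    using that by (simp add: \<beta>_def the_inv_into_f_f[OF inj])
  have sQ: "s k \<in> insert \<sigma> T" if "k \<le> n" for k
    using that st[of "k - 1"] s0 by (cases k) (auto simp: tstep_def)
  have "producible T \<sigma> \<beta>"
  proof (rule producible_path[where P = P and I = "{..n}"])
    show "\<beta> (0,0) = Some \<sigma>" using b[of 0] P0 s0 by simp
    show dom: "dom \<beta> = P ` {..n}" by (auto simp: \<beta>_def dom_def)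
    show "ran \<beta> \<subseteq> insert \<sigma> T"
    proof
      fix q assume "q \<in> ran \<beta>"
      then obtain v where v: "\<beta> v = Some q" by (auto simp: ran_def)
      then obtain k where "k \<le> n" "v = P k" using dom by blast
      then show "q \<in> insert \<sigma> T" using v b sQ by auto
    qed
    show "k \<in> {..n} \<and> bond \<beta> (P k) (P (Suc k))" if "Suc k \<in> {..n}" for k
      using that b[of k] b[of "Suc k"] st[of k] by (auto simp: bond_iff tstep_def)
  qed (rule P0)
  then show ?thesis using b by blast
qed

text \<open>A bond leading back to a position on the run truncates the run there, which keeps it
  self-avoiding.\<close>

lemma reach_run:
  assumes p: "producible T \<sigma> \<beta>" and v: "(bond \<beta>)\<^sup>*\<^sup>* (0,0) v"
  shows "\<exists>P s n. run (tstep (insert \<sigma> T)) \<sigma> P s n \<and> P n = v \<and> (\<forall>k\<le>n. \<beta> (P k) = Some (s k))"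
  using v
proof (induction rule: rtranclp_induct)
  case base
  have "run (tstep (insert \<sigma> T)) \<sigma> (\<lambda>_. (0,0)) (\<lambda>_. \<sigma>) 0" by (simp add: run_def)
  then show ?case using p by (auto simp: producible_def)
next
  case (step y z)
  then obtain P s n where r: "run (tstep (insert \<sigma> T)) \<sigma> P s n" "P n = y" "\<forall>k\<le>n. \<beta> (P k) = Some (s k)"
    by blast
  show ?case
  proof (cases "z \<in> P ` {..n}")
    case True
    then obtain k where "k \<le> n" "z = P k" by auto
    then show ?thesis using r run_prefix[OF r(1), of k] by (metis order_trans)
  next
    case False
    obtain q q' d where d: "\<beta> y = Some q" "\<beta> z = Some q'" "z - y = vec d" "q d = q' (opp d)"
      using step.hyps(2) by (auto simp: bond_iff)
    have "q \<in> insert \<sigma> T" "q' \<in> insert \<sigma> T" using p d unfolding producible_def by (meson ranI subsetD)+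
    moreover have "s n = q" using r(2) r(3)[rule_format, of n] d(1) by simp
    ultimately have st: "tstep (insert \<sigma> T) (s n) (z - P n) q'" using d r(2) by (auto simp: tstep_def)
    have "inj_on (P(Suc n := z)) {..Suc n}"
      using r(1) False by (auto simp: run_def atMost_Suc inj_on_fun_updI)
    then have "run (tstep (insert \<sigma> T)) \<sigma> (P(Suc n := z)) (s(Suc n := q')) (Suc n)"
      using r(1) st by (auto simp: run_def less_Suc_eq)
    moreover have "\<forall>k\<le>Suc n. \<beta> ((P(Suc n := z)) k) = Some ((s(Suc n := q')) k)"
      using r(3) d(2) by (auto simp: le_Suc_eq)
    ultimately show ?thesis by (metis fun_upd_same)
  qed
qed

section \<open>Reading off the ultimately periodic word\<close>

lemma periodic_shift:
  assumes g: "\<And>r. g (n2 + r) = g (n1 + r)" and n: "n1 \<le> (n2::nat)"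
  shows "g (n1 + i * (n2 - n1) + j) = g (n1 + j)"
proof (induction i)
  case (Suc i)
  have "n1 + Suc i * (n2 - n1) + j = n2 + (i * (n2 - n1) + j)" using n by simp
  then show ?case using Suc g by (simp add: add.assoc)
qed simp

lemma disp_snoc: "disp (xs @ [d]) = disp xs + vec d"
  by (induction xs) (auto simp: disp_def padd_eq add.assoc prod_eq_iff)

text \<open>The word \<open>m\<close> spells the first \<open>n1\<close> steps and \<open>p\<close>
  those from \<open>n1\<close> to \<open>n2\<close>. The equivalence \<open>bond\<close> says that
  the path is induced, so the restriction of \<open>A\<close> to it has no bonds besides the
  steps.\<close>

lemma contains_up_path_intro:
  assumes A: "A (0,0) = Some \<sigma>" "ran A \<subseteq> insert \<sigma> T"
    and R: "R 0 = (0,0)" "inj R"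
    and bond: "\<And>a b. bond A (R a) (R b) \<longleftrightarrow> a = Suc b \<or> b = Suc a"
    and n: "n1 < n2"
    and per: "\<And>r. R (n2 + r) - R n2 = R (n1 + r) - R n1" "\<And>r. A (R (n2 + r)) = A (R (n1 + r))"
  shows "contains_up_path T \<sigma> A"
proof -
  have "\<exists>d. R (Suc k) - R k = vec d" for k using bond[of k "Suc k"] by (auto simp: bond_iff)
  then obtain w where w: "\<And>k. R (Suc k) - R k = vec (w k)" by metis
  have seg: "disp (map w [a..<a + k]) = R (a + k) - R a" for a k
  proof (induction k)
    case (Suc k)
    then show ?case using w[of "a + k"] by (simp add: disp_snoc) (simp add: prod_eq_iff)
  qed (simp add: disp_def prod_eq_iff)
  have w_per: "w (n2 + r) = w (n1 + r)" for r
  proof (rule vec_inj)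
    have "R (Suc (n2 + r)) - R (n2 + r) = R (Suc (n1 + r)) - R (n1 + r)"
      using per(1)[of r] per(1)[of "Suc r"] by (simp add: prod_eq_iff)
    then show "vec (w (n2 + r)) = vec (w (n1 + r))" using w by simp
  qed
  define L where "L = n2 - n1"
  define m where "m = map w [0..<n1]"
  define p where "p = map w [n1..<n2]"
  have len: "length m = n1" "length p = L" "0 < L" using n by (simp_all add: m_def p_def L_def)
  have up: "upword m p = w"
  proof
    fix k
    show "upword m p k = w k"
    proof (cases "k < n1")
      case True
      then show ?thesis by (simp add: upword_def m_def)
    next
      case False
      let ?r = "(k - n1) mod L" and ?i = "(k - n1) div L"
      have r: "?r < L" using len by simp
      have "k = n1 + ?i * L + ?r" using False by simp
      then have "w k = w (n1 + ?r)"
        using periodic_shift[of w n2 n1 ?i ?r, OF w_per] n unfolding L_def by simp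
      moreover have "p ! ?r = w (n1 + ?r)" using r by (simp add: p_def L_def)
      ultimately show ?thesis using False len by (simp add: upword_def)
    qed
  qed
  have walk: "walkpos (upword m p) = R"
    using seg[of 0] R(1) by (auto simp: up walkpos_def prod_eq_iff)
  have dm: "disp m = R n1" using seg[of 0 n1] R(1) by (simp add: m_def prod_eq_iff)
  have dj: "disp (take j p) = R (n1 + j) - R n1" if "j \<le> L" for j
  proof -
    have "take j p = map w [n1..<n1 + j]" using that n by (intro nth_equalityI) (simp_all add: p_def L_def take_map)
    then show ?thesis using seg by simp
  qed
  have dp: "disp p = R n2 - R n1" using dj[of L] len n by (simp add: L_def)
  have Rper: "R (n1 + i * L + j) = R (n1 + j) + psmul i (disp p)" for i j
  proof (induction i)
    case (Suc i)
    have "n1 + Suc i * L + j = n2 + (i * L + j)" using n by (simp add: L_def)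
    then have "R (n1 + Suc i * L + j) = R (n2 + (i * L + j))" by (rule arg_cong)
    also have "\<dots> = R (n1 + i * L + j) + disp p"
      using per(1)[of "i * L + j"] by (simp add: dp prod_eq_iff add.assoc)
    finally have "R (n1 + Suc i * L + j) = R (n1 + i * L + j) + disp p" .
    then show ?case using Suc by (simp add: psmul_def prod_eq_iff algebra_simps)
  qed (simp add: psmul_def prod_eq_iff)
  define \<beta> where "\<beta> = A |` range R"
  have Rdom: "R k \<in> dom A" for k using bond[of k "Suc k"] by (auto simp: bond_iff)
  then have "range R \<subseteq> dom A" by blast
  then have dom: "dom \<beta> = range R" unfolding \<beta>_def dom_restrict by blast
  have bR: "\<beta> (R k) = A (R k)" for k by (simp add: \<beta>_def)
  have bbond: "bond \<beta> (R a) (R b) \<longleftrightarrow> a = Suc b \<or> b = Suc a" for a b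
    using bond[of a b] by (simp add: bond_iff bR)
  have prod: "producible T \<sigma> \<beta>"
  proof (rule producible_path[where P = R and I = UNIV])
    show "\<beta> (0,0) = Some \<sigma>" using bR[of 0] R A by simp
    show "ran \<beta> \<subseteq> insert \<sigma> T" using A(2) by (auto simp: \<beta>_def ran_def restrict_map_def split: if_splits)
  qed (use dom bbond R in auto)
  have bonds: "bond \<beta> u v \<longleftrightarrow> (\<exists>k. (u = R k \<and> v = R (Suc k)) \<or> (v = R k \<and> u = R (Suc k)))" for u v
  proof
    assume uv: "bond \<beta> u v"
    then have "u \<in> range R" "v \<in> range R" unfolding dom[symmetric] by (simp_all add: bond_def)
    then obtain a b where ab: "u = R a" "v = R b" by blast
    show "\<exists>k. (u = R k \<and> v = R (Suc k)) \<or> (v = R k \<and> u = R (Suc k))"       using uv bbond[of a b] unfolding ab by metis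
  next
    assume "\<exists>k. (u = R k \<and> v = R (Suc k)) \<or> (v = R k \<and> u = R (Suc k))"
    then obtain k where "(u = R k \<and> v = R (Suc k)) \<or> (v = R k \<and> u = R (Suc k))" ..
    then show "bond \<beta> u v" using bbond[of k "Suc k"] bbond[of "Suc k" k] by auto
  qed
  have tiles: "\<beta> (padd (padd (disp m) (psmul i (disp p))) (disp (take j p))) = \<beta> (padd (disp m) (disp (take j p)))"
    if "j \<le> length p" for i j
  proof -
    have j: "disp (take j p) = R (n1 + j) - R n1" using dj that len by simp
    have "padd (padd (disp m) (psmul i (disp p))) (disp (take j p)) = R (n1 + i * L + j)"
      unfolding Rper padd_eq dm j by (simp add: prod_eq_iff)
    moreover have "padd (disp m) (disp (take j p)) = R (n1 + j)" unfolding padd_eq dm j by (simp add: prod_eq_iff)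
    moreover have "A (R (n1 + i * L + j)) = A (R (n1 + j))"
      using periodic_shift[of "\<lambda>k. A (R k)" n2 n1 i j, OF per(2)] n unfolding L_def by simp
    ultimately show ?thesis by (simp add: bR)
  qed
  have "p \<noteq> []" using len by auto
  then have "up_assembly_path T \<sigma> \<beta> m p"
    unfolding up_assembly_path_def walk using prod R dom bonds tiles by blast
  moreover have "\<beta> = A |` dom \<beta>" unfolding dom by (simp add: \<beta>_def)
  ultimately show ?thesis unfolding contains_up_path_def by blast
qed

text \<open>A run may fold back so that non-consecutive tiles bind; always jumping to the farthest
  bound tile yields an induced path, and the jumps inherit the period.\<close>

lemma induced_subsequence:
  assumes fin: "\<And>k. finite {l. B k l}" and suc: "\<And>k. B k (Suc k)" and q: "0 < q"
    and per: "\<And>k l. i \<le> k \<Longrightarrow> i \<le> l \<Longrightarrow> B (k + q) (l + q) \<longleftrightarrow> B k l"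
  shows "\<exists>g n1 n2 c. g 0 = 0 \<and> strict_mono g \<and> (\<forall>a. B (g a) (g (Suc a))) \<and>
    (\<forall>a b. Suc a < b \<longrightarrow> \<not> B (g a) (g b)) \<and> n1 < n2 \<and> i \<le> g n1 \<and> (\<forall>r. g (n2 + r) = g (n1 + r) + c * q)"
proof -
  define f where "f k = Max {l. B k l}" for k
  have f_le: "l \<le> f k" if "B k l" for k l using Max_ge[OF fin[of k], of l] that by (simp add: f_def)
  have "{l. B k l} \<noteq> {}" for k using suc by blast
  then have "f k \<in> {l. B k l}" for k unfolding f_def using Max_in[OF fin] by blast
  then have Bf: "B k (f k)" for k by simp
  have fgt: "k < f k" for k using f_le[OF suc, of k] by simp
  \<comment> \<open>Since \<open>f\<close> moves forward, \<open>f (k + q) - q\<close> is still at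
    least \<open>i\<close>, and the periodicity of \<open>B\<close> may be used backwards as
    well.\<close>
  have f_shift: "f (k + q) = f k + q" if k: "i \<le> k" for k
  proof (rule antisym)
    have "B (k + q) (f k + q)" using per[of k "f k"] k fgt[of k] Bf by simp
    then show "f k + q \<le> f (k + q)" by (rule f_le)
    have "i \<le> f (k + q) - q" "f (k + q) - q + q = f (k + q)" using fgt[of "k + q"] k by linarith+
    then have "B k (f (k + q) - q)" using per[of k "f (k + q) - q"] Bf[of "k + q"] k by simp
    then show "f (k + q) \<le> f k + q" using f_le by fastforce
  qed
  have f_shifts: "f (k + c * q) = f k + c * q" if k: "i \<le> k" for k c
  proof (induction c)
    case (Suc c)
    then show ?case using f_shift[of "k + c * q"] k by (simp add: algebra_simps)
  qed simp
  define g where "g a = (f ^^ a) 0" for a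
  have g: "g 0 = 0" "g (Suc a) = f (g a)" for a by (simp_all add: g_def)
  have mono: "strict_mono g" by (simp add: strict_mono_Suc_iff g fgt)
  have g_ge: "a \<le> g a" for a using strict_mono_imp_increasing[OF mono] by simp
  \<comment> \<open>Beyond \<open>i\<close> the jumps commute with shifts by \<open>q\<close>, so
    two visited indices with the same residue modulo \<open>q\<close> make the jump sequence
    periodic.\<close>
  have "finite ((\<lambda>a. g a mod q) ` {i..})" using q by (auto intro: finite_subset[of _ "{..<q}"])
  then obtain a0 where "infinite {a \<in> {i..}. g a mod q = g a0 mod q}"
    using pigeonhole_infinite[OF infinite_Ici] by blast
  then obtain n1 n2 where n: "n1 < n2" "i \<le> n1" "g n1 mod q = g n2 mod q"
    by (smt (verit, best) finite_nat_set_iff_bounded_le mem_Collect_eq not_le atLeast_iff infinite_nat_iff_unbounded)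
  have lt: "g n1 < g n2" using n mono by (simp add: strict_monoD)
  then obtain c where c: "g n2 = g n1 + c * q"
    using n(3) by (metis less_imp_le mod_eq_dvd_iff_nat dvd_def le_add_diff_inverse mult.commute)
  have "g (n2 + r) = g (n1 + r) + c * q" for r
  proof (induction r)
    case (Suc r)
    then show ?case using f_shifts[of "g (n1 + r)" c] g_ge[of "n1 + r"] n by (simp add: g)
  qed (simp add: c)
  moreover have "\<not> B (g a) (g b)" if "Suc a < b" for a b
    using f_le[of "g a" "g b"] strict_monoD[OF mono that] by (auto simp: g)
  moreover have "B (g a) (g (Suc a))" for a by (simp add: g Bf)
  moreover have "i \<le> g n1" using g_ge[of n1] n by simp
  ultimately show ?thesis using g(1) mono n(1) by blast
qed

section \<open>Confluent tile systems as transition systems\<close>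

locale confluent_tas =
  fixes T :: "'g tile set" and \<sigma> :: "'g tile"
  assumes finT: "finite T" and confluent: "confluent T \<sigma>"
begin

abbreviation "Q \<equiv> insert \<sigma> T"
abbreviation "A \<equiv> alpha_max T \<sigma>"

text \<open>Two runs ending in one position are parts of producible assemblies, whose agreement
  there is exactly \<open>conf\<close>.\<close>

lemma tsys_tstep: "tsys (tstep Q) \<sigma> Q"
proof
  show "finite Q" "\<sigma> \<in> Q" using finT by auto
  show "unit v" if "tstep Q q v q'" for q v q' using that by (auto simp: tstep_def unit_vec)
  show "q \<in> Q \<and> q' \<in> Q" if "tstep Q q v q'" for q v q' using that by (auto simp: tstep_def)
next
  fix P s n P' s' n'
  assume r: "run (tstep Q) \<sigma> P s n" "run (tstep Q) \<sigma> P' s' n'" "P n = P' n'"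
  obtain \<beta> where b: "producible T \<sigma> \<beta>" "\<beta> (P n) = Some (s n)" using run_producible[OF r(1)] by blast
  obtain \<beta>' where b': "producible T \<sigma> \<beta>'" "\<beta>' (P' n') = Some (s' n')" using run_producible[OF r(2)] by blast
  have "P n \<in> dom \<beta> \<inter> dom \<beta>'" using b b' r(3) by auto
  then have "\<beta> (P n) = \<beta>' (P n)" using confluent b b' unfolding confluent_def by blast
  then show "s n = s' n'" using b b' r(3) by simp
qed

lemma alpha_max_some: "A v = Some q \<Longrightarrow> \<exists>\<beta>. producible T \<sigma> \<beta> \<and> \<beta> v = Some q"
proof -
  assume q: "A v = Some q"
  then have ex: "\<exists>\<beta>. producible T \<sigma> \<beta> \<and> v \<in> dom \<beta>" by (auto simp: alpha_max_def split: if_splits)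
  show ?thesis using someI_ex[OF ex] q ex by (auto simp: alpha_max_def)
qed

lemma alpha_maxI: "producible T \<sigma> \<beta> \<Longrightarrow> \<beta> v = Some q \<Longrightarrow> A v = Some q"
proof -
  assume b: "producible T \<sigma> \<beta>" "\<beta> v = Some q"
  have ex: "\<exists>\<beta>. producible T \<sigma> \<beta> \<and> v \<in> dom \<beta>" using b by blast
  define \<gamma> where "\<gamma> = (SOME \<beta>. producible T \<sigma> \<beta> \<and> v \<in> dom \<beta>)"
  have c: "producible T \<sigma> \<gamma> \<and> v \<in> dom \<gamma>" unfolding \<gamma>_def by (rule someI_ex[OF ex])
  then have "\<gamma> v = \<beta> v" using confluent b unfolding confluent_def by blast
  then show ?thesis using b ex by (simp add: alpha_max_def \<gamma>_def)
qed

lemma alpha_max_seed: "A (0,0) = Some \<sigma>"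
proof (rule alpha_maxI)
  show "producible T \<sigma> [(0,0) \<mapsto> \<sigma>]" by (auto simp: producible_def split: if_splits)
qed simp

lemma ran_alpha_max: "ran A \<subseteq> Q"
proof
  fix q assume "q \<in> ran A"
  then obtain v where "A v = Some q" by (auto simp: ran_def)
  then obtain \<beta> where "producible T \<sigma> \<beta>" "\<beta> v = Some q" using alpha_max_some by blast
  then show "q \<in> Q" unfolding producible_def by (meson ranI subsetD)
qed

text \<open>A run moves by one unit per step, so a tile outside of the box of radius
  \<open>L\<close> is reached only by a run of length at least \<open>L\<close>.\<close>

lemma long_run:
  assumes "infinite (dom A)"
  shows "\<exists>P s. run (tstep Q) \<sigma> P s L"
proof -
  let ?box = "{- int L..int L} \<times> {- int L..int L}"
  have "\<not> dom A \<subseteq> ?box" using assms finite_subset by blast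
  then obtain v where v: "v \<in> dom A" "v \<notin> ?box" by blast
  then obtain \<beta> where b: "producible T \<sigma> \<beta>" "v \<in> dom \<beta>" using alpha_max_some by blast
  then have "(bond \<beta>)\<^sup>*\<^sup>* (0,0) v" by (simp add: producible_def)
  then obtain P s n where r: "run (tstep Q) \<sigma> P s n" "P n = v" using reach_run[OF b(1)] by blast
  have box: "\<bar>fst (P k)\<bar> \<le> int k \<and> \<bar>snd (P k)\<bar> \<le> int k" if "k \<le> n" for k
    using that
  proof (induction k)
    case 0
    then show ?case using r by (simp add: run_def)
  next
    case (Suc k)
    then obtain d where "P (Suc k) - P k = vec d" using r unfolding run_def tstep_def by (meson Suc_le_lessD)
    then have "unit (P (Suc k) - P k)" by (simp add: unit_vec)
    then have "\<bar>fst (P (Suc k)) - fst (P k)\<bar> \<le> 1" "\<bar>snd (P (Suc k)) - snd (P k)\<bar> \<le> 1"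
      by (auto simp: unit_def prod_eq_iff)
    then show ?case using Suc.IH Suc.prems by (simp add: abs_le_iff)
  qed
  have "L \<le> n"
  proof (rule ccontr)
    assume "\<not> L \<le> n"
    then have "v \<in> ?box" using box[of n] r(2) by (auto simp: mem_Times_iff)
    then show False using v by simp
  qed
  then show ?thesis using run_prefix[OF r(1)] by blast
qed

text \<open>\<open>good n x\<close> says that the part of \<open>x\<close> up to index
  \<open>n\<close> extends to runs of every length. There are finitely many next steps and tiles, so
  one choice serves infinitely many lengths and, by truncation, all of them.\<close>

lemma infinite_run:
  assumes long: "\<And>L. \<exists>P s. run (tstep Q) \<sigma> P s L"
  shows "\<exists>P s. irun (tstep Q) \<sigma> P s"
proof -
  define ext where "ext n x m y \<longleftrightarrow> run (tstep Q) \<sigma> (fst y) (snd y) m \<and>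
    (\<forall>k\<le>n. fst y k = fst x k \<and> snd y k = snd x k)" for n x m and y :: "(nat \<Rightarrow> pos) \<times> (nat \<Rightarrow> 'g tile)"
  define good where "good n x \<longleftrightarrow> (\<forall>m\<ge>n. \<exists>y. ext n x m y)" for n x
  have "\<exists>h. \<forall>n. good n (h n) \<and> (\<forall>k\<le>n. fst (h (Suc n)) k = fst (h n) k \<and> snd (h (Suc n)) k = snd (h n) k)"
  proof (rule dependent_nat_choice)
    have "ext 0 ((\<lambda>_. (0,0)), (\<lambda>_. \<sigma>)) m (P, s)" if "run (tstep Q) \<sigma> P s m" for P s m
      using that by (simp add: ext_def run_def)
    then show "\<exists>x. good 0 x" using long unfolding good_def by meson
  next
    fix x :: "(nat \<Rightarrow> pos) \<times> (nat \<Rightarrow> 'g tile)" and n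
    assume g: "good n x"
    define Y where "Y m = (SOME y. ext n x m y)" for m
    have Y: "ext n x m (Y m)" if "n \<le> m" for m
      using g that unfolding good_def Y_def by (meson someI_ex)
    let ?v = "\<lambda>m. (fst (Y m) (Suc n) - fst x n, snd (Y m) (Suc n))"
    have "?v m \<in> {v. unit v} \<times> Q" if "Suc n \<le> m" for m
    proof -
      have "ext n x m (Y m)" using Y that by simp
      then have "fst (Y m) n = fst x n"
        and "tstep Q (snd (Y m) n) (fst (Y m) (Suc n) - fst (Y m) n) (snd (Y m) (Suc n))"
        using that unfolding ext_def run_def by (blast, meson Suc_le_lessD)
      then show ?thesis by (auto simp: tstep_def unit_vec)
    qed
    then have "?v ` {Suc n..} \<subseteq> {v. unit v} \<times> Q" by blast
    then have "finite (?v ` {Suc n..})" by (rule finite_subset) (use finite_units finT in simp)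
    then obtain m0 where inf: "infinite {m \<in> {Suc n..}. ?v m = ?v m0}"
      using pigeonhole_infinite[OF infinite_Ici] by blast
    define y where "y = ((fst x)(Suc n := fst (Y m0) (Suc n)), (snd x)(Suc n := snd (Y m0) (Suc n)))"
    have "good (Suc n) y" unfolding good_def
    proof (intro allI impI)
      fix m assume "Suc n \<le> m"
      obtain m' where m': "m < m'" "Suc n \<le> m'" "?v m' = ?v m0"
        using inf unfolding infinite_nat_iff_unbounded by blast
      then have e: "ext n x m' (Y m')" using Y by simp
      have "run (tstep Q) \<sigma> (fst (Y m')) (snd (Y m')) m" by (rule run_prefix[OF conjunct1[OF e[unfolded ext_def]]]) (use m'(1) in simp)
      then have "ext (Suc n) y m (Y m')" using e m'(3) by (auto simp: ext_def y_def le_Suc_eq)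
      then show "\<exists>z. ext (Suc n) y m z" by blast
    qed
    moreover have "\<forall>k\<le>n. fst y k = fst x k \<and> snd y k = snd x k" by (simp add: y_def)
    ultimately show "\<exists>y. good (Suc n) y \<and> (\<forall>k\<le>n. fst y k = fst x k \<and> snd y k = snd x k)" by blast
  qed
  then obtain h where h: "\<And>n. good n (h n)"
    "\<And>n k. k \<le> n \<Longrightarrow> fst (h (Suc n)) k = fst (h n) k \<and> snd (h (Suc n)) k = snd (h n) k" by blast
  have agree: "fst (h n) k = fst (h k) k \<and> snd (h n) k = snd (h k) k" if "k \<le> n" for n k
    using that
  proof (induction n rule: dec_induct)
    case (step n)
    then show ?case using h(2)[of k n] by simp
  qed simp
  have "run (tstep Q) \<sigma> (\<lambda>k. fst (h k) k) (\<lambda>k. snd (h k) k) n" for n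
  proof -
    obtain y where y: "ext n (h n) n y" using h(1)[of n] unfolding good_def by blast
    have e: "fst (h k) k = fst y k" "snd (h k) k = snd y k" if "k \<le> n" for k
      using agree[OF that] y that by (auto simp: ext_def)
    have r: "run (tstep Q) \<sigma> (fst y) (snd y) n" using y by (simp add: ext_def)
    have "inj_on (\<lambda>k. fst (h k) k) {..n} = inj_on (fst y) {..n}" by (rule inj_on_cong) (use e in auto)
    then show ?thesis using r e[of 0] e by (auto simp: run_def)
  qed
  then show ?thesis unfolding irun_def by blast
qed

text \<open>Bonds of \<open>A\<close> between points of the run depend only on the displacement and
  the two states, so they inherit the period, and \<open>induced_subsequence\<close> applies to the
  relation \<open>B\<close> on indices.\<close>

lemma up_run_contains:
  assumes up: "up_run (tstep Q) \<sigma>"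
  shows "contains_up_path T \<sigma> A"
proof -
  obtain P s i j where r: "irun (tstep Q) \<sigma> P s" and ij: "i < j"
    and per: "\<And>k. P (j + k) - P j = P (i + k) - P i" "\<And>k. s (j + k) = s (i + k)"
    using up unfolding up_run_def by metis
  interpret tsys "tstep Q" \<sigma> Q by (rule tsys_tstep)
  note ip = irun_ipath[OF r]
  have injP: "inj P" using ip by (simp add: ipath_def)
  have AP: "A (P k) = Some (s k)" for k
  proof -
    have "run (tstep Q) \<sigma> P s k" using r by (simp add: irun_def)
    then obtain \<beta> where "producible T \<sigma> \<beta>" "\<beta> (P k) = Some (s k)" using run_producible by blast
    then show ?thesis by (rule alpha_maxI)
  qed
  define q where "q = j - i"
  define c where "c = P j - P i"
  have Pq: "P (k + q) = P k + c" "s (k + q) = s k" if "i \<le> k" for k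
  proof -
    have k: "k + q = j + (k - i)" "k = i + (k - i)" using that ij by (auto simp: q_def)
    show "P (k + q) = P k + c" using per(1)[of "k - i"] k by (simp add: c_def prod_eq_iff)
    show "s (k + q) = s k" using per(2)[of "k - i"] k by simp
  qed
  define B where "B k l \<longleftrightarrow> bond A (P k) (P l)" for k l
  have B: "B k l \<longleftrightarrow> (\<exists>d. P l - P k = vec d \<and> s k d = s l (opp d))" for k l
    by (simp add: B_def bond_iff AP)
  have "\<exists>g n1 n2 c. g 0 = 0 \<and> strict_mono g \<and> (\<forall>a. B (g a) (g (Suc a))) \<and>
    (\<forall>a b. Suc a < b \<longrightarrow> \<not> B (g a) (g b)) \<and> n1 < n2 \<and> i \<le> g n1 \<and> (\<forall>r. g (n2 + r) = g (n1 + r) + c * q)"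
  proof (rule induced_subsequence)
    show "finite {l. B k l}" for k
    proof -
      have "(\<lambda>l. P l - P k) ` {l. B k l} \<subseteq> {v. unit v}" by (auto simp: B unit_vec)
      moreover have "inj_on (\<lambda>l. P l - P k) {l. B k l}" using injP by (auto simp: inj_on_def)
      ultimately show ?thesis using finite_units by (meson finite_imageD finite_subset)
    qed
    show "B k (Suc k)" for k
    proof -
      have "run (tstep Q) \<sigma> P s (Suc k)" using r by (simp add: irun_def)
      then show ?thesis by (auto simp: B run_def tstep_def)
    qed
    show "0 < q" using ij by (simp add: q_def)
    show "B (k + q) (l + q) \<longleftrightarrow> B k l" if "i \<le> k" "i \<le> l" for k l
      using that by (simp add: B Pq)
  qed
  then obtain g n1 n2 e where g: "g 0 = 0" "strict_mono g" "\<And>a. B (g a) (g (Suc a))"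
      "\<And>a b. Suc a < b \<Longrightarrow> \<not> B (g a) (g b)"
    and n: "n1 < n2" "i \<le> g n1" and gper: "\<And>r. g (n2 + r) = g (n1 + r) + e * q"
    by blast
  have gi: "i \<le> g (n1 + r)" for r
  proof -
    have "g n1 \<le> g (n1 + r)" using g(2) by (simp add: strict_mono_less_eq)
    then show ?thesis using n(2) by simp
  qed
  have multi: "P (k + t * q) = P k + (int t * fst c, int t * snd c) \<and> s (k + t * q) = s k" if "i \<le> k" for k t
  proof (induction t)
    case (Suc t)
    then show ?case using Pq[of "k + t * q"] that
      by (simp add: prod_eq_iff algebra_simps)
  qed (simp add: prod_eq_iff)
  show ?thesis
  proof (rule contains_up_path_intro[of A \<sigma> T "\<lambda>a. P (g a)" n1 n2])
    show "P (g 0) = (0,0)" using r g by (simp add: irun_def run_def)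
    show "inj (\<lambda>a. P (g a))" using inj_compose[OF injP strict_mono_imp_inj_on[OF g(2)]] by (simp add: o_def)
    have ne: "\<not> B k k" for k
    proof
      assume "B k k"
      then obtain d where "P k - P k = vec d" by (auto simp: B)
      then show False by (cases d) (auto simp: prod_eq_iff)
    qed
    have sym: "B k l \<Longrightarrow> B l k" for k l unfolding B_def by (rule bond_sym)
    show "bond A (P (g a)) (P (g b)) \<longleftrightarrow> a = Suc b \<or> b = Suc a" for a b
    proof -
      have "B (g a) (g b) \<longleftrightarrow> a = Suc b \<or> b = Suc a"
      proof (cases a b rule: linorder_cases)
        case less
        then show ?thesis using g(3)[of a] g(4)[of a b] by (cases "b = Suc a") auto
      next
        case greater
        then show ?thesis using g(3)[of b] g(4)[of b a] sym by (cases "a = Suc b") auto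
      qed (auto simp: ne)
      then show ?thesis by (simp add: B_def)
    qed
    show "P (g (n2 + r)) - P (g n2) = P (g (n1 + r)) - P (g n1)" for r
      using multi[OF gi[of r], of e] multi[OF gi[of 0], of e] gper[of r] gper[of 0] by (simp add: prod_eq_iff)
    show "A (P (g (n2 + r))) = A (P (g (n1 + r)))" for r
      unfolding AP using multi[OF gi[of r], of e] gper[of r] by simp
  qed (use n alpha_max_seed ran_alpha_max in auto)
qed

end

theorem mainTheorem6:
  fixes T :: "'g tile set" and \<sigma> :: "'g tile"
  assumes "finite T"
    and "confluent T \<sigma>"
  shows "finite (dom (alpha_max T \<sigma>)) \<or> contains_up_path T \<sigma> (alpha_max T \<sigma>)"
proof -
  interpret confluent_tas T \<sigma> using assms by unfold_locales
  show ?thesis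
    using long_run infinite_run irun_periodic[OF tsys_tstep] up_run_contains by blast
qed

end
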